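(* Asymptotically almost all matroids $M$ on $n$ elements satisfy $w(M)\ge \frac{1}{5n}$; that is, $|\{M\in\mathbb{M}_n: w(M)\ge 1/(5n)\}|/|\mathbb{M}_n|\to 1$ as $n\to\infty$.
   Context: $\mathbb{M}_n$ is the set of matroids with ground set $\{1,\dots,n\}$. For a matroid $M$ of rank $r$ on $n$ elements, $W(M)$ is the set of circuit-hyperplanes of $M$ (sets that are both a circuit and a hyperplane), and $w(M)=|W(M)|/\binom{n}{r}$. *)

theory Defs
  imports Complex_Main
begin

text \<open>A matroid is represented by the pair of its ground set and its family of independent sets.\<close>

type_synonym 'a setsys = "'a set \<times> 'a set set"

abbreviation ground :: "'a setsys \<Rightarrow> 'a set" where
  "ground M \<equiv> fst M"

abbreviation indeps :: "'a setsys \<Rightarrow> 'a set set" where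
  "indeps M \<equiv> snd M"

definition matroid :: "'a setsys \<Rightarrow> bool" where
  "matroid M \<longleftrightarrow>
     finite (ground M) \<and>
     indeps M \<subseteq> Pow (ground M) \<and>
     {} \<in> indeps M \<and>
     (\<forall>X\<in>indeps M. \<forall>Y. Y \<subseteq> X \<longrightarrow> Y \<in> indeps M) \<and>
     (\<forall>X\<in>indeps M. \<forall>Y\<in>indeps M. card X < card Y \<longrightarrow>
        (\<exists>e\<in>Y - X. insert e X \<in> indeps M))"

definition rank_of :: "'a setsys \<Rightarrow> 'a set \<Rightarrow> nat" where
  "rank_of M X = Max (card ` {Y \<in> indeps M. Y \<subseteq> X})"

definition matroid_rank :: "'a setsys \<Rightarrow> nat" where
  "matroid_rank M = rank_of M (ground M)"

definition circuit :: "'a setsys \<Rightarrow> 'a set \<Rightarrow> bool" where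
  "circuit M C \<longleftrightarrow> C \<subseteq> ground M \<and> C \<notin> indeps M \<and> (\<forall>D. D \<subset> C \<longrightarrow> D \<in> indeps M)"

definition closure_of_set :: "'a setsys \<Rightarrow> 'a set \<Rightarrow> 'a set" where
  "closure_of_set M X = {e \<in> ground M. rank_of M (insert e X) = rank_of M X}"

definition flat :: "'a setsys \<Rightarrow> 'a set \<Rightarrow> bool" where
  "flat M F \<longleftrightarrow> F \<subseteq> ground M \<and> closure_of_set M F = F"

text \<open>A hyperplane is a flat of rank one less than the matroid; writing this additively avoids
  truncated subtraction, so that a matroid of rank 0 has no hyperplanes.\<close>

definition hyperplane :: "'a setsys \<Rightarrow> 'a set \<Rightarrow> bool" where
  "hyperplane M H \<longleftrightarrow> flat M H \<and> rank_of M H + 1 = matroid_rank M"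

definition circuit_hyperplanes :: "'a setsys \<Rightarrow> 'a set set" where
  "circuit_hyperplanes M = {X. circuit M X \<and> hyperplane M X}"

definition ch_density :: "'a setsys \<Rightarrow> real" where
  "ch_density M =
     real (card (circuit_hyperplanes M)) / real (card (ground M) choose matroid_rank M)"

definition matroids_on :: "nat \<Rightarrow> nat setsys set" where
  "matroids_on n = {M. matroid M \<and> ground M = {1..n}}"

lemma finite_matroids_on: "finite (matroids_on n)"
proof (rule finite_subset)
  show "matroids_on n \<subseteq> {{1..n}} \<times> Pow (Pow {1..n})"
    unfolding matroids_on_def matroid_def by (fastforce simp del: atLeastAtMost_iff)
qed simp

lemma matroids_on_nonempty: "matroids_on n \<noteq> {}"
proof -
  have "({1..n}, {{}}) \<in> matroids_on n"
    by (auto simp: matroids_on_def matroid_def)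
  then show ?thesis by blast
qed

end

theory Submission
  imports Defs "HOL-Analysis.Convex" "HOL-Real_Asymp.Real_Asymp"
begin

text \<open>Fix the rank \<open>r\<close>, write \<open>N\<close> for the central binomial coefficient, and view the nonbases of a
  matroid as a set of vertices of the Johnson graph on the \<open>r\<close>-sets; circuit-hyperplanes are its
  isolated vertices. A nonbasis that is not isolated lies in a set of about \<open>n\<close> or \<open>n\<^sup>2\<close> nonbases that
  is cheap to name (all \<open>r\<close>-sets containing a given dependent set, or contained in a given nonspanning
  set, or adjacent to a given set). Greedily, \<open>o(N / (n log n))\<close> such certificates leave at most \<open>n / 8\<close>
  unknown sets in each certificate of size about \<open>n\<close>. Together with the families of cocircuits and
  circuits of size at most \<open>n / 8\<close> this is a description of size \<open>o(N / n)\<close>.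

  Now let two matroids without loops and coloops share this description, and let \<open>P + x\<close>, with \<open>P\<close>
  dependent in the first one, be a basis of the second. Then the complement of the hyperplane spanned
  by \<open>P\<close> in the second is a small cocircuit \<open>D\<close>, hence one of both, and the sets \<open>P + y\<close> with \<open>y \<in> D\<close>
  have the same status in every matroid with that description. So the undetermined nonbases fall into
  classes that are mutually nonadjacent, and nontrivial unless the set is a circuit-hyperplane; a choice
  of representatives is a stable set that determines the matroid. Many nontrivial classes give
  many stable sets per matroid, and stable sets inject into matroids as sparse paving
  matroids; few nontrivial classes and few circuit-hyperplanes give stable sets of size below
  \<open>0.205 N / n\<close>, of which there are at most \<open>2\<close> to the power \<open>0.98 N / n\<close> by the Kleitman--Winston
  argument, whereas there are at least \<open>2\<close> to the power \<open>N / n\<close> matroids. Matroids with a loop or a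
  coloop are rare because deleting it leaves a matroid with exponentially many single-element
  extensions.\<close>

section \<open>Covers and stable sets in finite graphs\<close>

text \<open>The only lower bound used for the number of matroids is 2 to the power
  \<open>N / n\<close>, so an absolute upper bound helps only if its exponent stays below that. This
  forces the split on the number of nontrivial classes: a matroid with many of them occupies
  exponentially many stable sets and is compared with the unknown total itself; only the other
  matroids need an absolute count. The target \<open>o(N / (n log n))\<close> for the number of
  certificates has its logarithm because naming q of about N certificates costs about q log (N / q).
  Certificates of size about \<open>n\<close> could be needed \<open>N / n\<close> times if used
  alone; those of size about \<open>n^2\<close> are there to prevent this. The bound
  \<open>n / 8\<close> works because sets of that size are exponentially fewer than N, so that whole
  families of them can be recorded for \<open>o(N / n)\<close> bits. The constant: the r-sets
  containing a fixed (r-1)-set, or lying in a fixed (r+1)-set, form a clique, and one of the two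
  kinds has cliques of at least \<open>n / 2\<close> vertices. Hence vertex sets beyond about
  \<open>2 N / n\<close> contain many edges, and a stable set of size \<open>N / (5 n)\<close>
  behaves like a subset of density 1/10 in a set of size \<open>2 N / n\<close>.\<close>

lemma greedy_cover:
  fixes \<theta> :: real
  assumes "finite F" and "finite Y" and pos: "0 < \<theta>"
  obtains I where "I \<subseteq> F" "real (card I) * \<theta> \<le> real (card Y)"
    "\<And>U. U \<in> F \<Longrightarrow> real (card (U \<inter> (Y - \<Union>I))) < \<theta>"
proof -
  \<comment> \<open>A largest family whose members account on average for \<theta> elements of
    \<open>Y\<close> each. Any \<open>U\<close> that still covers \<theta> new elements could be
    adjoined to it, so none is left.\<close>
  define G where "G = {I \<in> Pow F. real (card I) * \<theta> \<le> real (card (Y \<inter> \<Union>I))}"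
  have finG: "finite G" using \<open>finite F\<close> by (simp add: G_def)
  have "card ` G \<noteq> {}" by (auto simp: G_def)
  then have "Max (card ` G) \<in> card ` G" using finG by (intro Max_in) auto
  then obtain I where I: "I \<in> G" and "Max (card ` G) = card I" by auto
  then have mx: "\<And>J. J \<in> G \<Longrightarrow> card J \<le> card I"
    using finG by (metis Max_ge finite_imageI image_eqI)
  have IF: "I \<subseteq> F" and Ic: "real (card I) * \<theta> \<le> real (card (Y \<inter> \<Union>I))"
    using I by (auto simp: G_def)
  have finI: "finite I" using IF \<open>finite F\<close> finite_subset by blast
  show thesis
  proof
    show "I \<subseteq> F" by fact
    show "real (card I) * \<theta> \<le> real (card Y)"
      using Ic card_mono[of Y "Y \<inter> \<Union>I"] \<open>finite Y\<close> by force
    fix U assume U: "U \<in> F"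
    show "real (card (U \<inter> (Y - \<Union>I))) < \<theta>"
    proof (rule ccontr)
      assume "\<not> ?thesis"
      then have big: "\<theta> \<le> real (card (U \<inter> (Y - \<Union>I)))" by simp
      have "U \<notin> I"
      proof
        assume "U \<in> I"
        then have "U \<inter> (Y - \<Union>I) = {}" by blast
        then show False using big pos by simp
      qed
      have eq: "Y \<inter> \<Union>(insert U I) = (Y \<inter> \<Union>I) \<union> (U \<inter> (Y - \<Union>I))" by blast
      have "card (Y \<inter> \<Union>(insert U I)) = card (Y \<inter> \<Union>I) + card (U \<inter> (Y - \<Union>I))"
        unfolding eq using \<open>finite Y\<close> by (intro card_Un_disjoint) auto
      then have "insert U I \<in> G"
        using U IF Ic big \<open>U \<notin> I\<close> finI by (auto simp: G_def algebra_simps)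
      then show False using mx[of "insert U I"] \<open>U \<notin> I\<close> finI by simp
    qed
  qed
qed

lemma sum_power_card_Pow:
  fixes w :: "'b::comm_semiring_1"
  assumes "finite F"
  shows "(\<Sum>I\<in>Pow F. w ^ card I) = (1 + w) ^ card F"
  using assms
proof (induction F)
  case (insert x F)
  have "(\<Sum>I\<in>Pow (insert x F). w ^ card I) = (\<Sum>I\<in>Pow F. w ^ card I) + (\<Sum>I\<in>insert x ` Pow F. w ^ card I)"
    unfolding Pow_insert using insert by (intro sum.union_disjoint) auto
  also have "(\<Sum>I\<in>insert x ` Pow F. w ^ card I) = (\<Sum>I\<in>Pow F. w ^ card (insert x I))"
    using insert by (subst sum.reindex) (auto simp: inj_on_def insert_ident)
  also have "\<dots> = w * (\<Sum>I\<in>Pow F. w ^ card I)"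
    unfolding sum_distrib_left
  proof (rule sum.cong)
    fix I assume "I \<in> Pow F"
    then have "finite I" "x \<notin> I" using insert finite_subset by auto
    then show "w ^ card (insert x I) = w * w ^ card I" by simp
  qed simp
  finally show ?case using insert by (simp add: algebra_simps)
qed simp

text \<open>Markov's inequality for the weight \<open>w ^ card I\<close>, whose total over all
  subsets is at most exp (w |F|). In the application \<open>F\<close> is the pool of certificates
  and ln (1 / w) is the price of naming one of them.\<close>

lemma card_small_subsets:
  fixes w q :: real
  assumes "finite F" "0 < w" "w \<le> 1" "0 \<le> q"
  shows "real (card {I. I \<subseteq> F \<and> real (card I) \<le> q}) \<le> exp (w * real (card F) + q * ln (1 / w))"
proof -
  have eq: "(\<Sum>I\<in>Pow F. w ^ card I) = (1 + w) ^ card F"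
    using assms(1) by (rule sum_power_card_Pow)
  have "real (card {I. I \<subseteq> F \<and> real (card I) \<le> q}) * w powr q
      = (\<Sum>I\<in>{I. I \<subseteq> F \<and> real (card I) \<le> q}. w powr q)" by simp
  also have "\<dots> \<le> (\<Sum>I\<in>{I. I \<subseteq> F \<and> real (card I) \<le> q}. w ^ card I)"
  proof (rule sum_mono)
    fix I assume "I \<in> {I. I \<subseteq> F \<and> real (card I) \<le> q}"
    then have "w powr q \<le> w powr real (card I)" using assms by (intro powr_mono') auto
    then show "w powr q \<le> w ^ card I" using assms by (simp add: powr_realpow)
  qed
  also have "\<dots> \<le> (\<Sum>I\<in>Pow F. w ^ card I)"
    using assms by (intro sum_mono2) auto
  also have "\<dots> \<le> exp (w * real (card F))"
    unfolding eq using assms power_mono[OF exp_ge_add_one_self[of w], of "card F"]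
    by (simp add: exp_of_nat_mult[symmetric] mult.commute)
  finally have "real (card {I. I \<subseteq> F \<and> real (card I) \<le> q}) \<le> exp (w * real (card F)) / w powr q"
    using assms by (simp add: field_simps)
  also have "\<dots> = exp (w * real (card F) + q * ln (1 / w))"
    using assms by (simp add: powr_def exp_diff ln_div)
  finally show ?thesis .
qed

text \<open>Cauchy-Schwarz for the numbers \<open>d b\<close> of vertices whose block set contains
  \<open>b\<close>: if \<open>A\<close> is large compared with \<open>B\<close>, many pairs share a
  block, and by \<open>inter\<close> each such pair is an edge. In the Johnson graph the blocks are
  (r-1)-subsets or (r+1)-supersets.\<close>

lemma double_counting_degree:
  fixes blk :: "'a \<Rightarrow> 'b set"
  assumes "finite A" "finite B"
    and blk: "\<And>x. x \<in> A \<Longrightarrow> blk x \<subseteq> B \<and> card (blk x) = k"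
    and inter: "\<And>x y. x \<in> A \<Longrightarrow> y \<in> A \<Longrightarrow> x \<noteq> y \<Longrightarrow> card (blk x \<inter> blk y) \<le> of_bool (adj x y)"
  shows "(k * card A)\<^sup>2 \<le> card B * (k * card A + (\<Sum>x\<in>A. card {y\<in>A. y \<noteq> x \<and> adj x y}))"
proof -
  define d where "d b = (\<Sum>x\<in>A. of_bool (b \<in> blk x) :: nat)" for b
  have card_blk: "card S = (\<Sum>b\<in>B. of_bool (b \<in> S))" if "S \<subseteq> B" for S
    using that \<open>finite B\<close> by (simp add: Int_absorb1 Int_def[symmetric] of_bool_def sum.If_cases)
  have "(\<Sum>b\<in>B. d b) = (\<Sum>x\<in>A. card (blk x))"
    unfolding d_def by (subst sum.swap) (intro sum.cong refl card_blk[symmetric], use blk in auto)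
  then have sumd: "(\<Sum>b\<in>B. d b) = k * card A" using blk by (simp add: mult.commute)
  have "(\<Sum>b\<in>B. (d b)\<^sup>2) = (\<Sum>b\<in>B. \<Sum>x\<in>A. \<Sum>y\<in>A. of_bool (b \<in> blk x \<inter> blk y))"
    by (simp add: d_def power2_eq_square sum_product of_bool_conj)
  also have "\<dots> = (\<Sum>x\<in>A. \<Sum>b\<in>B. \<Sum>y\<in>A. of_bool (b \<in> blk x \<inter> blk y))"
    by (rule sum.swap)
  also have "\<dots> = (\<Sum>x\<in>A. \<Sum>y\<in>A. card (blk x \<inter> blk y))"
    by (intro sum.cong refl, subst sum.swap) (intro sum.cong refl card_blk[symmetric], use blk in auto)
  also have "\<dots> \<le> (\<Sum>x\<in>A. k + card {y\<in>A. y \<noteq> x \<and> adj x y})"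
  proof (rule sum_mono)
    fix x assume x: "x \<in> A"
    have "(\<Sum>y\<in>A. card (blk x \<inter> blk y)) = card (blk x) + (\<Sum>y\<in>A - {x}. card (blk x \<inter> blk y))"
      using x \<open>finite A\<close> by (simp add: sum.remove)
    also have "(\<Sum>y\<in>A - {x}. card (blk x \<inter> blk y)) \<le> (\<Sum>y\<in>A - {x}. of_bool (adj x y))"
      using inter[OF x] by (intro sum_mono) blast
    also have "\<dots> = card {y\<in>A. y \<noteq> x \<and> adj x y}"
    proof -
      have "{y\<in>A. y \<noteq> x \<and> adj x y} = (A - {x}) \<inter> {y. adj x y}" by blast
      then show ?thesis using \<open>finite A\<close> by (simp add: of_bool_def sum.If_cases)
    qed
    finally show "(\<Sum>y\<in>A. card (blk x \<inter> blk y)) \<le> k + card {y\<in>A. y \<noteq> x \<and> adj x y}"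
      using blk x by simp
  qed
  also have "\<dots> = k * card A + (\<Sum>x\<in>A. card {y\<in>A. y \<noteq> x \<and> adj x y})"
    by (simp add: sum.distrib mult.commute)
  finally have sq: "(\<Sum>b\<in>B. (d b)\<^sup>2) \<le> k * card A + (\<Sum>x\<in>A. card {y\<in>A. y \<noteq> x \<and> adj x y})" .
  have "(\<Sum>b\<in>B. real (d b))\<^sup>2 \<le> (\<Sum>b\<in>B. (real (d b))\<^sup>2) * real (card B)"
    by (rule sum_squared_le_sum_of_squares)
  then have "(\<Sum>b\<in>B. d b)\<^sup>2 \<le> (\<Sum>b\<in>B. (d b)\<^sup>2) * card B"
    by (simp only: of_nat_le_iff flip: of_nat_mult of_nat_power of_nat_sum)
  also have "\<dots> \<le> (k * card A + (\<Sum>x\<in>A. card {y\<in>A. y \<noteq> x \<and> adj x y})) * card B"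
    using sq by (rule mult_right_mono) simp
  finally show ?thesis unfolding sumd by (simp add: mult.commute)
qed

definition stable_sets :: "('a \<Rightarrow> 'a \<Rightarrow> bool) \<Rightarrow> 'a set \<Rightarrow> 'a set set" where
  "stable_sets adj A = {T. T \<subseteq> A \<and> (\<forall>x\<in>T. \<forall>y\<in>T. \<not> adj x y)}"

lemma finite_stable_sets: "finite A \<Longrightarrow> finite (stable_sets adj A)"
  by (rule finite_subset[of _ "Pow A"]) (auto simp: stable_sets_def)

text \<open>Kleitman--Winston, in generating-function form: \<open>L\<close> bounds the number of high-degree vertices that can
  be chosen before at most \<open>m\<close> vertices are left, and each of them costs a factor \<open>1 / w\<close>.\<close>

lemma stable_sets_weight_le:
  fixes y w \<beta> m :: real
  assumes finV: "finite V" and y: "0 \<le> y" "y \<le> 1" and w: "0 < w" "w \<le> 1"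
    and step: "\<And>A. A \<subseteq> V \<Longrightarrow> m < real (card A) \<Longrightarrow>
      \<exists>v\<in>A. \<beta> * real (card A) \<le> real (card {u\<in>A. u = v \<or> adj v u})"
  shows "A \<subseteq> V \<Longrightarrow> real (card A) * (1 - \<beta>) ^ L \<le> m \<Longrightarrow>
    (\<Sum>T\<in>stable_sets adj A. y ^ card T) \<le> (1 + y) powr m * ((1 + w) ^ card A * (1 / w) ^ L)"
proof (induction "card A" arbitrary: A L rule: less_induct)
  case less
  have finA: "finite A" using less.prems finV finite_subset by blast
  show ?case
  proof (cases "real (card A) \<le> m")
    case True
    have "(\<Sum>T\<in>stable_sets adj A. y ^ card T) \<le> (\<Sum>T\<in>Pow A. y ^ card T)"
      using y finA by (intro sum_mono2) (auto simp: stable_sets_def)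
    also have "\<dots> = (1 + y) ^ card A"
      using finA by (rule sum_power_card_Pow)
    also have "\<dots> = (1 + y) powr real (card A)" using y by (simp add: powr_realpow)
    also have "\<dots> \<le> (1 + y) powr m" using True y by (intro powr_mono) auto
    also have "\<dots> \<le> (1 + y) powr m * ((1 + w) ^ card A * (1 / w) ^ L)"
      using w mult_mono[of 1 "(1 + w) ^ card A" 1 "(1 / w) ^ L"]
      by (simp add: mult_le_cancel_left1)
    finally show ?thesis .
  next
    case False
    then obtain v where v: "v \<in> A"
      and \<beta>: "\<beta> * real (card A) \<le> real (card {u\<in>A. u = v \<or> adj v u})"
      using step[of A] less.prems by auto
    define N where "N = {u\<in>A. u = v \<or> adj v u}"
    have NA: "N \<subseteq> A" "v \<in> N" using v by (auto simp: N_def)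
    have "card N \<le> card A" using NA finA card_mono by blast
    then have "\<beta> * real (card A) \<le> real (card A)" using \<beta> by (simp add: N_def)
    moreover have cA: "0 < card A" using v finA card_gt_0_iff by blast
    ultimately have \<beta>1: "\<beta> \<le> 1" by simp
    \<comment> \<open>\<open>L = 0\<close> would say that \<open>card A\<close> is at most
      \<open>m\<close>, which this case excludes.\<close>
    obtain L' where L: "L = Suc L'" using less.prems False by (cases L) auto
    have card1: "card (A - {v}) = card A - 1" using v finA by simp
    have cardN: "real (card (A - N)) \<le> (1 - \<beta>) * real (card A)"
      using \<beta> NA finA \<open>card N \<le> card A\<close>
      by (simp add: N_def[symmetric] card_Diff_subset finite_subset algebra_simps)
    have lt: "card (A - N) \<le> card A - 1"
      using NA finA card1 card_mono[of "A - {v}" "A - N"] by auto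
    have p1: "(\<Sum>T\<in>stable_sets adj (A - {v}). y ^ card T)
        \<le> (1 + y) powr m * ((1 + w) ^ (card A - 1) * (1 / w) ^ L)"
    proof -
      have "real (card (A - {v})) * (1 - \<beta>) ^ L \<le> real (card A) * (1 - \<beta>) ^ L"
        using \<beta>1 card1 by (intro mult_right_mono) auto
      then show ?thesis using less.hyps[of "A - {v}" L] less.prems card1 cA by auto
    qed
    have p2: "(\<Sum>T\<in>stable_sets adj (A - N). y ^ card T)
        \<le> (1 + y) powr m * ((1 + w) ^ (card A - 1) * (1 / w) ^ L')"
    proof -
      have "real (card (A - N)) * (1 - \<beta>) ^ L' \<le> ((1 - \<beta>) * real (card A)) * (1 - \<beta>) ^ L'"
        using \<beta>1 cardN by (intro mult_right_mono) auto
      also have "\<dots> \<le> m" using less.prems L by (simp add: mult_ac)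
      finally have "(\<Sum>T\<in>stable_sets adj (A - N). y ^ card T)
        \<le> (1 + y) powr m * ((1 + w) ^ card (A - N) * (1 / w) ^ L')"
        using less.hyps[of "A - N" L'] less.prems(1) lt cA by (meson Diff_subset diff_less le_less_trans
            less_one subset_trans)
      also have "\<dots> \<le> (1 + y) powr m * ((1 + w) ^ (card A - 1) * (1 / w) ^ L')"
        using w lt by (intro mult_left_mono mult_right_mono power_increasing) auto
      finally show ?thesis .
    qed
    \<comment> \<open>Branching on \<open>v\<close>: a stable set through \<open>v\<close> meets
      \<open>N\<close> in \<open>v\<close> alone, so it is \<open>v\<close> together with a stable
      set of \<open>A - N\<close>.\<close>
    define S1 where "S1 = {T \<in> stable_sets adj A. v \<notin> T}"
    define S2 where "S2 = {T \<in> stable_sets adj A. v \<in> T}"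
    have fin: "finite S1" "finite S2" using finite_stable_sets[OF finA] by (auto simp: S1_def S2_def)
    have "stable_sets adj A = S1 \<union> S2" "S1 \<inter> S2 = {}" by (auto simp: S1_def S2_def)
    then have "(\<Sum>T\<in>stable_sets adj A. y ^ card T) = (\<Sum>T\<in>S1. y ^ card T) + (\<Sum>T\<in>S2. y ^ card T)"
      using fin by (simp add: sum.union_disjoint)
    also have "S1 = stable_sets adj (A - {v})" by (auto simp: S1_def stable_sets_def)
    also have "(\<Sum>T\<in>S2. y ^ card T) = y * (\<Sum>T\<in>S2. y ^ card (T - {v}))"
      unfolding sum_distrib_left
    proof (rule sum.cong)
      fix T assume T: "T \<in> S2"
      then have "finite T" using finA finite_subset by (auto simp: S2_def stable_sets_def)
      then show "y ^ card T = y * y ^ card (T - {v})"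
        using T card.remove[of T v] by (metis (no_types, lifting) S2_def mem_Collect_eq power_Suc)
    qed simp
    also have "(\<Sum>T\<in>S2. y ^ card (T - {v})) = (\<Sum>T\<in>(\<lambda>T. T - {v}) ` S2. y ^ card T)"
      by (subst sum.reindex) (auto simp: inj_on_def S2_def)
    also have "\<dots> \<le> (\<Sum>T\<in>stable_sets adj (A - N). y ^ card T)"
      using y finA by (intro sum_mono2 finite_stable_sets) (auto simp: S2_def stable_sets_def N_def)
    finally have "(\<Sum>T\<in>stable_sets adj A. y ^ card T)
        \<le> (\<Sum>T\<in>stable_sets adj (A - {v}). y ^ card T) + y * (\<Sum>T\<in>stable_sets adj (A - N). y ^ card T)"
      using y by (simp add: mult_left_mono)
    also have "\<dots> \<le> (1 + y) powr m * ((1 + w) ^ (card A - 1) * (1 / w) ^ L)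
        + y * ((1 + y) powr m * ((1 + w) ^ (card A - 1) * (1 / w) ^ L'))"
      using p1 p2 y by (intro add_mono mult_left_mono) auto
    also have "\<dots> = (1 + y) powr m * ((1 + w) ^ (card A - 1) * (1 / w) ^ L * (1 + y * w))"
      using w by (simp add: L field_simps)
    also have "\<dots> \<le> (1 + y) powr m * ((1 + w) ^ card A * (1 / w) ^ L)"
    proof -
      have "(1 + w) ^ card A = (1 + w) ^ (card A - 1) * (1 + w)"
        using cA by (metis Suc_diff_1 power_Suc2)
      moreover have "y * w \<le> w" using y w by (simp add: mult_left_le_one_le)
      ultimately have "(1 + w) ^ (card A - 1) * (1 + y * w) \<le> (1 + w) ^ card A"
        using w by simp
      then have "(1 / w) ^ L * ((1 + w) ^ (card A - 1) * (1 + y * w)) \<le> (1 / w) ^ L * (1 + w) ^ card A"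
        using w by (intro mult_left_mono) auto
      then show ?thesis
        by (intro mult_left_mono) (simp_all only: mult_ac powr_ge_zero)
    qed
    finally show ?thesis .
  qed
qed

section \<open>Base systems and the Johnson graph\<close>

definition rsets :: "'a set \<Rightarrow> nat \<Rightarrow> 'a set set" where
  "rsets E r = {X. X \<subseteq> E \<and> card X = r}"

definition johnson :: "'a set \<Rightarrow> 'a set \<Rightarrow> bool" where
  "johnson X Y \<longleftrightarrow> card (X - Y) = 1 \<and> card (Y - X) = 1"

text \<open>All members of \<open>up E r P\<close> (with \<open>card P \<le> r\<close>) are nonbases iff \<open>P\<close> is dependent; all members of
  \<open>dn E r Q\<close> (with \<open>card Q \<ge> r\<close>) are nonbases iff \<open>Q\<close> is nonspanning. Complementation of bases, \<open>co\<close>, is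
  matroid duality and exchanges the two.\<close>

definition up :: "'a set \<Rightarrow> nat \<Rightarrow> 'a set \<Rightarrow> 'a set set" where
  "up E r P = {X \<in> rsets E r. P \<subseteq> X}"

definition dn :: "'a set \<Rightarrow> nat \<Rightarrow> 'a set \<Rightarrow> 'a set set" where
  "dn E r Q = {X \<in> rsets E r. X \<subseteq> Q}"

abbreviation co :: "'a set \<Rightarrow> 'a set set \<Rightarrow> 'a set set" where
  "co E F \<equiv> (\<lambda>X. E - X) ` F"

lemma finite_rsets: "finite E \<Longrightarrow> finite (rsets E r)"
  by (rule finite_subset[of _ "Pow E"]) (auto simp: rsets_def)

lemma finite_rsets_elem: "finite E \<Longrightarrow> X \<in> rsets E r \<Longrightarrow> finite X"
  by (auto simp: rsets_def finite_subset)

lemma rsets_elem_card: "X \<in> rsets E r \<Longrightarrow> card X = r"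
  by (simp add: rsets_def)

lemma card_rsets: "finite E \<Longrightarrow> card (rsets E r) = card E choose r"
  by (simp add: rsets_def n_subsets)

lemma johnson_irrefl: "\<not> johnson X X"
  by (simp add: johnson_def)

lemma johnsonE:
  assumes "johnson X Y"
  obtains P x y where "X = insert x P" "Y = insert y P" "x \<notin> P" "y \<notin> P" "x \<noteq> y"
proof -
  obtain x y where xy: "X - Y = {x}" "Y - X = {y}"
    using assms by (auto simp: johnson_def card_1_singleton_iff)
  show thesis
  proof (rule that)
    show "X = insert x (X \<inter> Y)" "Y = insert y (X \<inter> Y)" "x \<notin> X \<inter> Y" "y \<notin> X \<inter> Y" "x \<noteq> y"
      using xy by blast+
  qed
qed

lemma johnson_insert: "x \<notin> P \<Longrightarrow> y \<notin> P \<Longrightarrow> x \<noteq> y \<Longrightarrow> johnson (insert x P) (insert y P)"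
proof -
  assume a: "x \<notin> P" "y \<notin> P" "x \<noteq> y"
  then have "insert x P - insert y P = {x}" "insert y P - insert x P = {y}" by auto
  then show ?thesis by (simp add: johnson_def)
qed

lemma johnson_co: "X \<subseteq> E \<Longrightarrow> Y \<subseteq> E \<Longrightarrow> johnson (E - X) (E - Y) \<longleftrightarrow> johnson X Y"
proof -
  assume "X \<subseteq> E" "Y \<subseteq> E"
  then have "E - X - (E - Y) = Y - X" "E - Y - (E - X) = X - Y" by auto
  then show ?thesis by (auto simp: johnson_def)
qed

lemma co_mem_iff: "F \<subseteq> Pow E \<Longrightarrow> X \<subseteq> E \<Longrightarrow> E - X \<in> co E F \<longleftrightarrow> X \<in> F"
proof
  assume a: "F \<subseteq> Pow E" "X \<subseteq> E" "E - X \<in> co E F"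
  then obtain Y where "Y \<in> F" "E - X = E - Y" by auto
  moreover have "X = E - (E - X)" "Y = E - (E - Y)" using a \<open>Y \<in> F\<close> by auto
  ultimately show "X \<in> F" by metis
qed blast

lemma rsets_co: "finite E \<Longrightarrow> r \<le> card E \<Longrightarrow> X \<in> rsets E r \<Longrightarrow> E - X \<in> rsets E (card E - r)"
  by (auto simp: rsets_def card_Diff_subset finite_subset)

lemma co_dn: "finite E \<Longrightarrow> r \<le> card E \<Longrightarrow> Q \<subseteq> E \<Longrightarrow> co E (dn E r Q) = up E (card E - r) (E - Q)"
proof (intro set_eqI iffI)
  fix X assume a: "finite E" "r \<le> card E" "Q \<subseteq> E" "X \<in> up E (card E - r) (E - Q)"
  then have "E - X \<in> rsets E r" using rsets_co[of E "card E - r" X] by (simp add: up_def)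
  moreover have "X = E - (E - X)" "E - X \<subseteq> Q" using a by (auto simp: up_def rsets_def)
  ultimately show "X \<in> co E (dn E r Q)" unfolding dn_def by blast
qed (auto simp: up_def dn_def intro: rsets_co)

text \<open>Complementation turns \<open>exchange\<close> into \<open>coexchange\<close> and back.
  With both as assumptions duality is an instance of the locale, and statements about
  \<open>up\<close> transfer to \<open>dn\<close>.\<close>

locale base_system =
  fixes E :: "'a set" and r :: nat and Bs :: "'a set set"
  assumes finE: "finite E" and r_le: "r \<le> card E" and bases: "Bs \<subseteq> rsets E r"
    and exchange: "\<And>B C x. B \<in> Bs \<Longrightarrow> C \<in> Bs \<Longrightarrow> x \<in> B - C \<Longrightarrow> \<exists>y\<in>C - B. insert y (B - {x}) \<in> Bs"
    and coexchange: "\<And>B C x. B \<in> Bs \<Longrightarrow> C \<in> Bs \<Longrightarrow> x \<in> C - B \<Longrightarrow> \<exists>y\<in>B - C. insert x (B - {y}) \<in> Bs"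
begin

lemma bases_sub: "Bs \<subseteq> Pow E"
  using bases by (auto simp: rsets_def)

lemma dual: "base_system E (card E - r) (co E Bs)"
proof
  show "co E Bs \<subseteq> rsets E (card E - r)"
    using bases rsets_co[OF finE r_le] by blast
next
  fix B C x assume "B \<in> co E Bs" "C \<in> co E Bs" "x \<in> B - C"
  then obtain B' C' where *: "B' \<in> Bs" "C' \<in> Bs" "B = E - B'" "C = E - C'" "x \<in> C' - B'" by auto
  then obtain y where y: "y \<in> B' - C'" "insert x (B' - {y}) \<in> Bs" using coexchange by blast
  have "insert y (B - {x}) = E - insert x (B' - {y})"
    using * y bases_sub by auto
  then show "\<exists>y\<in>C - B. insert y (B - {x}) \<in> co E Bs"
    using y * bases_sub by (intro bexI[of _ y]) auto
next
  fix B C x assume "B \<in> co E Bs" "C \<in> co E Bs" "x \<in> C - B"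
  then obtain B' C' where *: "B' \<in> Bs" "C' \<in> Bs" "B = E - B'" "C = E - C'" "x \<in> B' - C'" "x \<in> E" by auto
  then obtain y where y: "y \<in> C' - B'" "insert y (B' - {x}) \<in> Bs" using exchange by blast
  have "insert x (B - {y}) = E - insert y (B' - {x})"
    using * y bases_sub by auto
  then show "\<exists>y\<in>B - C. insert x (B - {y}) \<in> co E Bs"
    using y * bases_sub by (intro bexI[of _ y]) auto
qed (use finE r_le in auto)

lemma co_int_empty: "F \<subseteq> Pow E \<Longrightarrow> co E F \<inter> co E Bs = {} \<longleftrightarrow> F \<inter> Bs = {}"
proof
  assume F: "F \<subseteq> Pow E"
  have iff: "E - Y \<in> co E Bs \<longleftrightarrow> Y \<in> Bs" if "Y \<in> F" for Y
    using co_mem_iff[OF bases_sub, of Y] that F by auto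
  show "co E F \<inter> co E Bs = {}" if "F \<inter> Bs = {}"
  proof (rule ccontr)
    assume "co E F \<inter> co E Bs \<noteq> {}"
    then obtain Y where "Y \<in> F" "E - Y \<in> co E Bs" by auto
    then show False using iff that by auto
  qed
  show "F \<inter> Bs = {}" if "co E F \<inter> co E Bs = {}"
    using that by auto
qed

text \<open>If P = X \<inter> Y were independent, some basis would be P + u; if X \<union> Y were
  spanning, exchanging u towards a basis inside it could only bring in one of the two elements
  outside P, which makes \<open>X\<close> or \<open>Y\<close> a basis.\<close>

lemma adjacent_nonbases:
  assumes "X \<in> rsets E r - Bs" "Y \<in> rsets E r - Bs" "johnson X Y"
  shows "up E r (X \<inter> Y) \<inter> Bs = {} \<or> dn E r (X \<union> Y) \<inter> Bs = {}"
proof (rule ccontr)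
  assume "\<not> ?thesis"
  then obtain B C where B: "B \<in> Bs" "X \<inter> Y \<subseteq> B" and C: "C \<in> Bs" "C \<subseteq> X \<union> Y"
    by (auto simp: up_def dn_def)
  obtain P x y where xy: "X = insert x P" "Y = insert y P" "x \<notin> P" "y \<notin> P" "x \<noteq> y"
    using \<open>johnson X Y\<close> by (rule johnsonE)
  have P: "X \<inter> Y = P" "X \<union> Y = insert x (insert y P)" using xy by auto
  have fin: "finite X" "finite B" "card X = r" "card B = r"
    using assms(1) B(1) bases by (auto intro: finite_rsets_elem[OF finE] simp: rsets_elem_card)
  have "card P + 1 = r" using xy(1,3) fin(1,3) by auto
  then have "card (B - P) = 1"
    using fin(2,4) B(2) P(1) by (simp add: card_Diff_subset finite_subset)
  then obtain u where u: "B - P = {u}" by (auto simp: card_1_singleton_iff)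
  then have Bu: "B = insert u P" using B P by blast
  have "u \<noteq> x" "u \<noteq> y" using Bu xy assms B by auto
  then have "u \<in> B - C" using C P u by auto
  then obtain z where z: "z \<in> C - B" "insert z (B - {u}) \<in> Bs" using exchange B C by blast
  have "B - {u} = P" using u Bu by blast
  moreover have "z = x \<or> z = y" using z C Bu P by blast
  ultimately show False using z xy assms by auto
qed

text \<open>Being adjacent to a basis, \<open>X\<close> has nullity one and so a unique circuit.
  Both X - x1 and X - x2 contain it, hence it avoids both elements. The proof replays this with
  basis exchanges.\<close>

lemma up_pair:
  assumes X: "X \<in> rsets E r" and B: "B \<in> Bs" "johnson X B"
    and x: "x1 \<in> X" "x2 \<in> X" "x1 \<noteq> x2"
    and up: "up E r (X - {x1}) \<inter> Bs = {}" "up E r (X - {x2}) \<inter> Bs = {}"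
  shows "up E r (X - {x1, x2}) \<inter> Bs = {}"
proof (rule ccontr)
  assume "\<not> ?thesis"
  then obtain C where C: "C \<in> Bs" "X - {x1, x2} \<subseteq> C" by (auto simp: up_def)
  have no: "D \<notin> Bs" if "X - {x1} \<subseteq> D \<or> X - {x2} \<subseteq> D" for D
    using that up bases by (auto simp: up_def)
  obtain P c y where P: "X = insert c P" "B = insert y P" "c \<notin> P" "y \<notin> P" "c \<noteq> y"
    using B(2) by (rule johnsonE)
  then have cy: "X - {c} \<subseteq> B" "B \<subseteq> insert y X" "c \<in> X" "c \<notin> B" "y \<notin> X" by auto
  have c: "c \<noteq> x1" "c \<noteq> x2" using no[of B] B cy by blast+
  have x12: "x1 \<notin> C" "x2 \<notin> C" using no[of C] C by blast+
  have fin: "finite X" "finite C" "card X = r" "card C = r"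
    using X C(1) bases by (auto intro: finite_rsets_elem[OF finE] simp: rsets_elem_card)
  have "card (X - {x1, x2}) + 2 = r"
    using fin x card_Diff_subset[of "{x1,x2}" X] card_mono[of X "{x1,x2}"] by simp
  then have "card (C - (X - {x1, x2})) = 2" using fin C by (simp add: card_Diff_subset)
  then obtain u v where uv: "C - (X - {x1, x2}) = {u, v}" "u \<noteq> v" by (auto simp: card_2_iff)
  then have Cuv: "C = insert u (insert v (X - {x1, x2}))" using C by blast
  have uvX: "u \<notin> X" "v \<notin> X" using uv x12 by auto
  \<comment> \<open>The two elements u, v of \<open>C\<close> outside \<open>X\<close> are exchanged
    towards \<open>B\<close>, one after the other. \<open>B\<close> has only y outside
    \<open>X\<close>, so the incoming element is y at the first exchange and x1 or x2 at the second;
    the latter gives a basis containing X - x1 or X - x2. One of u, v differs from y, and that one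
    goes out at the start.\<close>
  have main: False if u: "u \<noteq> v" "u \<noteq> y" "C = insert u (insert v (X - {x1, x2}))" "u \<notin> X" "v \<notin> X" for u v
  proof -
    have "u \<in> C - B" using u cy by auto
    then obtain z where z: "z \<in> B - C" "insert z (C - {u}) \<in> Bs" using exchange B C by blast
    have zin: "z \<in> {x1, x2, y}" using z cy u by blast
    have sub: "X - {x1, x2} \<subseteq> C - {u}" using u by auto
    then have "z \<noteq> x1" "z \<noteq> x2" using no[of "insert z (C - {u})"] z(2) by auto
    with zin have zy: "z = y" by simp
    define D where "D = insert y (insert v (X - {x1, x2}))"
    have D: "D \<in> Bs" using z u zy by (simp add: D_def insert_Diff_if)
    have "v \<noteq> y" using z u zy by blast
    then have "v \<in> D - B" using u cy by (auto simp: D_def)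
    then obtain z' where z': "z' \<in> B - D" "insert z' (D - {v}) \<in> Bs" using exchange B D by blast
    have "z' = x1 \<or> z' = x2" using z' cy by (auto simp: D_def)
    moreover have "X - {x1, x2} \<subseteq> D - {v}" using u by (auto simp: D_def)
    ultimately have "X - {x1} \<subseteq> insert z' (D - {v}) \<or> X - {x2} \<subseteq> insert z' (D - {v})" by auto
    then show False using no[of "insert z' (D - {v})"] z'(2) by simp
  qed
  show False
  proof (cases "u = y")
    case True
    show ?thesis by (rule main[of v u]) (use uv True Cuv uvX in auto)
  next
    case False
    show ?thesis by (rule main[of u v]) (use uv False Cuv uvX in auto)
  qed
qed

lemma dn_pair:
  assumes X: "X \<in> rsets E r" and B: "B \<in> Bs" "johnson X B"
    and y: "y1 \<in> E - X" "y2 \<in> E - X" "y1 \<noteq> y2"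
    and dn: "dn E r (insert y1 X) \<inter> Bs = {}" "dn E r (insert y2 X) \<inter> Bs = {}"
  shows "dn E r (insert y1 (insert y2 X)) \<inter> Bs = {}"
proof -
  interpret d: base_system E "card E - r" "co E Bs" by (rule dual)
  have XE: "X \<subseteq> E" "B \<subseteq> E" using X B bases by (auto simp: rsets_def)
  have conv: "up E (card E - r) (E - Q) \<inter> co E Bs = {} \<longleftrightarrow> dn E r Q \<inter> Bs = {}" if "Q \<subseteq> E" for Q
  proof -
    have "dn E r Q \<subseteq> Pow E" by (auto simp: dn_def rsets_def)
    then show ?thesis using co_dn[OF finE r_le that] co_int_empty[of "dn E r Q"] by simp
  qed
  have eq: "E - X - {y} = E - insert y X" for y by blast
  have "up E (card E - r) ((E - X) - {y1, y2}) \<inter> co E Bs = {}"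
  proof (rule d.up_pair[where B = "E - B"])
    show "johnson (E - X) (E - B)" using B XE by (simp add: johnson_co)
    show "up E (card E - r) (E - X - {y1}) \<inter> co E Bs = {}"
      using conv[of "insert y1 X"] dn XE y by (simp add: eq)
    show "up E (card E - r) (E - X - {y2}) \<inter> co E Bs = {}"
      using conv[of "insert y2 X"] dn XE y by (simp add: eq)
  qed (use B y rsets_co[OF finE r_le X] in auto)
  moreover have "E - X - {y1, y2} = E - insert y1 (insert y2 X)" by blast
  ultimately show ?thesis using conv[of "insert y1 (insert y2 X)"] XE y by simp
qed

end

section \<open>Matroids with a common description\<close>

definition isolated :: "'a set \<Rightarrow> nat \<Rightarrow> 'a set set \<Rightarrow> 'a set set" where
  "isolated E r Bs = {X \<in> rsets E r - Bs. \<forall>Y\<in>rsets E r - Bs. \<not> johnson X Y}"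

text \<open>\<open>MM\<close> consists of matroids, given by their bases, with the same known nonbases \<open>Kn\<close> and the same
  transversals (codependent sets) and dependent sets of size at most \<open>a\<close>.\<close>

locale indistinct =
  fixes E :: "'a set" and r a :: nat and MM :: "'a set set set" and Kn :: "'a set set"
  assumes finE: "finite E" and r_le: "r \<le> card E" and Kn_sub: "Kn \<subseteq> rsets E r"
    and sys: "\<And>Bs. Bs \<in> MM \<Longrightarrow> base_system E r Bs"
    and known: "\<And>Bs. Bs \<in> MM \<Longrightarrow> Kn \<inter> Bs = {}"
    and unk_up: "\<And>Bs P. Bs \<in> MM \<Longrightarrow> P \<subseteq> E \<Longrightarrow> Suc (card P) = r \<Longrightarrow> up E r P \<inter> Bs = {} \<Longrightarrow>
      card (up E r P - Kn) \<le> a"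
    and unk_dn: "\<And>Bs Q. Bs \<in> MM \<Longrightarrow> Q \<subseteq> E \<Longrightarrow> card Q = Suc r \<Longrightarrow> dn E r Q \<inter> Bs = {} \<Longrightarrow>
      card (dn E r Q - Kn) \<le> a"
    and transversal: "\<And>Bs Cs D. Bs \<in> MM \<Longrightarrow> Cs \<in> MM \<Longrightarrow> D \<subseteq> E \<Longrightarrow> card D \<le> a \<Longrightarrow>
      \<forall>B\<in>Bs. B \<inter> D \<noteq> {} \<Longrightarrow> \<forall>B\<in>Cs. B \<inter> D \<noteq> {}"
    and dependent: "\<And>Bs Cs D. Bs \<in> MM \<Longrightarrow> Cs \<in> MM \<Longrightarrow> D \<subseteq> E \<Longrightarrow> card D \<le> a \<Longrightarrow>
      \<forall>B\<in>Bs. \<not> D \<subseteq> B \<Longrightarrow> \<forall>B\<in>Cs. \<not> D \<subseteq> B"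
    and no_coloop: "\<And>Bs e. Bs \<in> MM \<Longrightarrow> e \<in> E \<Longrightarrow> \<exists>B\<in>Bs. e \<notin> B"
    and no_loop: "\<And>Bs e. Bs \<in> MM \<Longrightarrow> e \<in> E \<Longrightarrow> \<exists>B\<in>Bs. e \<in> B"
begin

lemma base_sub: "Bs \<in> MM \<Longrightarrow> B \<in> Bs \<Longrightarrow> B \<in> rsets E r"
  using base_system.bases[OF sys] by auto

lemma base_subE: "Bs \<in> MM \<Longrightarrow> B \<in> Bs \<Longrightarrow> B \<subseteq> E"
  using base_sub by (auto simp: rsets_def)

lemma co_up: "P \<subseteq> E \<Longrightarrow> co E (up E r P) = dn E (card E - r) (E - P)"
proof -
  assume P: "P \<subseteq> E"
  have "co E (dn E (card E - r) (E - P)) = up E r P"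
    using co_dn[OF finE, of "card E - r" "E - P"] P r_le by (simp add: double_diff)
  moreover have "co E (co E F) = F" if "F \<subseteq> Pow E" for F
  proof -
    have "co E (co E F) = (\<lambda>X. E - (E - X)) ` F" by (simp add: image_image)
    also have "\<dots> = (\<lambda>X. X) ` F" using that by (intro image_cong) auto
    finally show ?thesis by simp
  qed
  ultimately show ?thesis by (metis (no_types, lifting) dn_def mem_Collect_eq Pow_iff rsets_def subsetI)
qed

text \<open>The assumptions come in pairs that complementation swaps: \<open>unk_up\<close> with
  \<open>unk_dn\<close>, \<open>transversal\<close> with \<open>dependent\<close>,
  \<open>no_coloop\<close> with \<open>no_loop\<close>.\<close>

lemma dual: "indistinct E (card E - r) a (co E ` MM) (co E Kn)"
proof (rule indistinct.intro)
  show "co E Kn \<subseteq> rsets E (card E - r)"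
    using Kn_sub rsets_co[OF finE r_le] by auto
next
  fix Bs assume "Bs \<in> co E ` MM"
  then obtain Cs where Cs: "Cs \<in> MM" "Bs = co E Cs" by auto
  interpret c: base_system E r Cs using Cs sys by simp
  have dn: "dn E r Q \<subseteq> Pow E" "up E r Q \<subseteq> Pow E" for Q by (auto simp: dn_def up_def rsets_def)
  show "base_system E (card E - r) Bs" using c.dual Cs by simp
  have "Kn \<subseteq> Pow E" using Kn_sub by (auto simp: rsets_def)
  then show "co E Kn \<inter> Bs = {}" using c.co_int_empty known Cs by simp
  have diff: "card (co E F - co E Kn) \<le> card (F - Kn)" if "F \<subseteq> Pow E" for F
  proof -
    have "finite (F - Kn)" using that finE by (meson finite_Diff finite_Pow_iff finite_subset)
    moreover have "co E F - co E Kn \<subseteq> co E (F - Kn)" by auto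
    ultimately show ?thesis by (meson card_image_le card_mono finite_imageI order_trans)
  qed
  show "card (up E (card E - r) P - co E Kn) \<le> a"
    if "P \<subseteq> E" "Suc (card P) = card E - r" "up E (card E - r) P \<inter> Bs = {}" for P
  proof -
    have eq: "up E (card E - r) P = co E (dn E r (E - P))"
      using co_dn[OF finE r_le, of "E - P"] that by (simp add: double_diff)
    have "card (E - P) = Suc r" using that finE by (simp add: card_Diff_subset finite_subset)
    moreover have "dn E r (E - P) \<inter> Cs = {}" using that eq Cs c.co_int_empty dn by simp
    ultimately have "card (dn E r (E - P) - Kn) \<le> a" using unk_dn Cs by simp
    then show ?thesis using eq diff[of "dn E r (E - P)"] dn by simp
  qed
  show "card (dn E (card E - r) Q - co E Kn) \<le> a"
    if "Q \<subseteq> E" "card Q = Suc (card E - r)" "dn E (card E - r) Q \<inter> Bs = {}" for Q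
  proof -
    have eq: "dn E (card E - r) Q = co E (up E r (E - Q))"
      using co_up[of "E - Q"] that by (simp add: double_diff)
    have "card Q \<le> card E" using that finE card_mono by blast
    then have "Suc (card (E - Q)) = r" using that finE r_le by (simp add: card_Diff_subset finite_subset)
    moreover have "up E r (E - Q) \<inter> Cs = {}" using that eq Cs c.co_int_empty dn by simp
    ultimately have "card (up E r (E - Q) - Kn) \<le> a" using unk_up Cs by simp
    then show ?thesis using eq diff[of "up E r (E - Q)"] dn by simp
  qed
  show "\<exists>B\<in>Bs. e \<notin> B" if "e \<in> E" for e
    using no_loop[OF Cs(1) that] Cs(2) by auto
  show "\<exists>B\<in>Bs. e \<in> B" if "e \<in> E" for e
    using no_coloop[OF Cs(1) that] Cs(2) that by auto
next
  have eq: "(\<forall>B\<in>co E Cs. B \<inter> D \<noteq> {}) \<longleftrightarrow> (\<forall>B\<in>Cs. \<not> D \<subseteq> B)" if "D \<subseteq> E" for D Cs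
    using that by auto
  have eq2: "(\<forall>B\<in>co E Cs. \<not> D \<subseteq> B) \<longleftrightarrow> (\<forall>B\<in>Cs. B \<inter> D \<noteq> {})" if "D \<subseteq> E" for D Cs
    using that by auto
  show "\<forall>B\<in>Cs. B \<inter> D \<noteq> {}" if h: "Bs \<in> co E ` MM" "Cs \<in> co E ` MM" "D \<subseteq> E" "card D \<le> a"
    "\<forall>B\<in>Bs. B \<inter> D \<noteq> {}" for Bs Cs D
  proof -
    obtain Bs' Cs' where *: "Bs' \<in> MM" "Bs = co E Bs'" "Cs' \<in> MM" "Cs = co E Cs'" using h by auto
    have "\<forall>B\<in>Bs'. \<not> D \<subseteq> B" using h(5) unfolding *(2) by (simp only: eq[OF h(3)])
    then have "\<forall>B\<in>Cs'. \<not> D \<subseteq> B" by (rule dependent[OF *(1,3) h(3,4)])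
    then show ?thesis unfolding *(4) by (simp only: eq[OF h(3)])
  qed
  show "\<forall>B\<in>Cs. \<not> D \<subseteq> B" if h: "Bs \<in> co E ` MM" "Cs \<in> co E ` MM" "D \<subseteq> E" "card D \<le> a"
    "\<forall>B\<in>Bs. \<not> D \<subseteq> B" for Bs Cs D
  proof -
    obtain Bs' Cs' where *: "Bs' \<in> MM" "Bs = co E Bs'" "Cs' \<in> MM" "Cs = co E Cs'" using h by auto
    have "\<forall>B\<in>Bs'. B \<inter> D \<noteq> {}" using h(5) unfolding *(2) by (simp only: eq2[OF h(3)])
    then have "\<forall>B\<in>Cs'. B \<inter> D \<noteq> {}" by (rule transversal[OF *(1,3) h(3,4)])
    then show ?thesis unfolding *(4) by (simp only: eq2[OF h(3)])
  qed
qed (use finE in auto)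

text \<open>\<open>D\<close> is the complement of the hyperplane spanned by \<open>P\<close> in
  \<open>Cs\<close>. It is small because the sets P + y with y in \<open>D\<close> are bases of
  \<open>Cs\<close>, so none of them is known, whereas \<open>Bs\<close> allows at most
  \<open>a\<close> unknown sets above its dependent set \<open>P\<close>. Smallness lets
  \<open>transversal\<close> carry \<open>D\<close> to every other member of
  \<open>MM\<close>.\<close>

lemma up_cocircuit:
  assumes Bs: "Bs \<in> MM" and P: "P \<subseteq> E" "Suc (card P) = r" "up E r P \<inter> Bs = {}"
    and Cs: "Cs \<in> MM" and x: "x \<notin> P" "insert x P \<in> Cs"
  defines "D \<equiv> {y \<in> E - P. insert y P \<in> Cs}"
  shows "x \<in> D" "D \<subseteq> E - P" "card D \<le> a" "\<And>Ds B. Ds \<in> MM \<Longrightarrow> B \<in> Ds \<Longrightarrow> B \<inter> D \<noteq> {}"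
proof -
  interpret c: base_system E r Cs using Cs by (rule sys)
  have finP: "finite P" using P finE finite_subset by blast
  show xD: "x \<in> D" using x base_subE[OF Cs x(2)] by (auto simp: D_def)
  show DE: "D \<subseteq> E - P" by (auto simp: D_def)
  have "insert y P \<in> up E r P - Kn" if "y \<in> D" for y
    using that known[OF Cs] P finP by (auto simp: D_def up_def rsets_def)
  moreover have "inj_on (\<lambda>y. insert y P) D"
    using DE by (auto simp: inj_on_def)
  moreover have "finite (up E r P - Kn)"
    using finite_rsets[OF finE, of r] by (auto simp: up_def)
  ultimately have "card D \<le> card (up E r P - Kn)"
    by (meson card_inj_on_le image_subsetI)
  then show cD: "card D \<le> a" using unk_up[OF Bs P] by simp
  have "B \<inter> D \<noteq> {}" if B: "B \<in> Cs" for B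
  proof (cases "x \<in> B")
    case False
    then obtain z where "z \<in> B - insert x P" "insert z (insert x P - {x}) \<in> Cs"
      using c.exchange[OF x(2) B] by blast
    then have "z \<in> B \<inter> D" using x base_subE[OF Cs B] by (auto simp: D_def)
    then show ?thesis by blast
  qed (use xD in auto)
  then show "B \<inter> D \<noteq> {}" if "Ds \<in> MM" "B \<in> Ds" for Ds B
    using transversal[OF Cs that(1) _ cD] DE that by blast
qed

text \<open>Minimality of the cocircuit \<open>D\<close> is shared as well: the basis P + y of
  \<open>Cs\<close> misses D - y, so some basis of \<open>Ds\<close> meets \<open>D\<close> at most
  in y. Exchanging x out of P + x towards that basis brings in an element z such that P + z must
  meet \<open>D\<close>, and this leaves only z = y.\<close>

lemma up_status_imp:
  assumes Bs: "Bs \<in> MM" and P: "P \<subseteq> E" "Suc (card P) = r" "up E r P \<inter> Bs = {}"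
    and Cs: "Cs \<in> MM" and x: "x \<notin> P" "insert x P \<in> Cs" "y \<notin> P" "insert y P \<in> Cs"
    and Ds: "Ds \<in> MM" "insert x P \<in> Ds"
  shows "insert y P \<in> Ds"
proof (cases "x = y")
  case False
  define D where "D = {y \<in> E - P. insert y P \<in> Cs}"
  note D = up_cocircuit[OF Bs P Cs x(1,2), folded D_def]
  have yD: "y \<in> D" using x(3,4) base_subE[OF Cs x(4)] by (auto simp: D_def)
  have finD: "finite D" using D(2) finE finite_subset by blast
  interpret d: base_system E r Ds using Ds(1) by (rule sys)
  have "insert y P \<inter> (D - {y}) = {}" using D(2) by auto
  then have "\<not> (\<forall>B\<in>Cs. B \<inter> (D - {y}) \<noteq> {})" using x by blast
  moreover have "card (D - {y}) \<le> a" using D(3) finD card_Diff1_le[of D y] by simp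
  ultimately have "\<not> (\<forall>B\<in>Ds. B \<inter> (D - {y}) \<noteq> {})"
    using transversal[OF Ds(1) Cs, of "D - {y}"] D(2) by blast
  then obtain B where B: "B \<in> Ds" "B \<inter> (D - {y}) = {}" by blast
  have "x \<in> insert x P - B" using B False D(1) by auto
  then obtain z where z: "z \<in> B - insert x P" "insert z (insert x P - {x}) \<in> Ds"
    using d.exchange[OF Ds(2) B(1)] by blast
  have zP: "insert z P \<in> Ds" using z x(1) by simp
  have "insert z P \<inter> D \<noteq> {}" using D(4)[OF Ds(1) zP] .
  then have "z \<in> D" using D(2) by auto
  then have "z = y" using z B by auto
  then show ?thesis using zP by simp
qed (use Ds in simp)

lemma up_status:
  assumes "Bs \<in> MM" "P \<subseteq> E" "Suc (card P) = r" "up E r P \<inter> Bs = {}"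
    "Cs \<in> MM" "x \<notin> P" "insert x P \<in> Cs" "y \<notin> P" "insert y P \<in> Cs" "Ds \<in> MM"
  shows "insert x P \<in> Ds \<longleftrightarrow> insert y P \<in> Ds"
  using up_status_imp[OF assms(1-5)] assms by blast

text \<open>Here the absence of coloops enters: a basis avoiding x still meets the cocircuit, so the
  cocircuit has a second element.\<close>

lemma up_partner:
  assumes "Bs \<in> MM" "P \<subseteq> E" "Suc (card P) = r" "up E r P \<inter> Bs = {}"
    "Cs \<in> MM" "x \<notin> P" "insert x P \<in> Cs"
  shows "\<exists>y\<in>E - P. y \<noteq> x \<and> (\<forall>Ds\<in>MM. insert x P \<in> Ds \<longleftrightarrow> insert y P \<in> Ds)"
proof -
  define D where "D = {y \<in> E - P. insert y P \<in> Cs}"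
  note D = up_cocircuit[OF assms(1-7), folded D_def]
  obtain B where B: "B \<in> Cs" "x \<notin> B" using no_coloop[OF assms(5), of x] D by blast
  then obtain y where y: "y \<in> B" "y \<in> D" using D(4)[OF assms(5)] by blast
  then have yy: "y \<notin> P" "insert y P \<in> Cs" "y \<in> E - P" "y \<noteq> x" using B by (auto simp: D_def)
  show ?thesis
    using up_status[OF assms(1-7) yy(1,2)] yy by blast
qed

text \<open>The cocircuit \<open>D\<close> is computed in \<open>Ds\<close> but meets every basis of
  \<open>Cs\<close>, in particular P + x, and only x can be the common element. So all undetermined
  sets above \<open>P\<close> share one status.\<close>

lemma up_adjacent:
  assumes "Bs \<in> MM" "P \<subseteq> E" "Suc (card P) = r" "up E r P \<inter> Bs = {}"
    and Cs: "Cs \<in> MM" and x: "x \<notin> P" "insert x P \<in> Cs" and Ds: "Ds \<in> MM" and y: "y \<notin> P" "insert y P \<in> Ds"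
    and Fs: "Fs \<in> MM"
  shows "insert x P \<in> Fs \<longleftrightarrow> insert y P \<in> Fs"
proof -
  define D where "D = {z \<in> E - P. insert z P \<in> Ds}"
  note D = up_cocircuit[OF assms(1-4) Ds y, folded D_def]
  have "insert x P \<inter> D \<noteq> {}" using D(4)[OF Cs x(2)] .
  then have "x \<in> D" using D(2) by auto
  then have "insert x P \<in> Ds" by (simp add: D_def)
  then show ?thesis using up_status[OF assms(1-4) Ds x(1) _ y Fs] by blast
qed

section \<open>Undetermined nonbases, their classes, and the encoding by stable sets\<close>

definition eqv :: "'a set \<Rightarrow> 'a set \<Rightarrow> bool" where
  "eqv X Y \<longleftrightarrow> (\<forall>Bs\<in>MM. X \<in> Bs \<longleftrightarrow> Y \<in> Bs)"

text \<open>A set that is a nonbasis throughout \<open>MM\<close> separates nothing; only the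
  remaining nonbases have to be encoded.\<close>

definition und :: "'a set set \<Rightarrow> 'a set set" where
  "und Bs = {X \<in> rsets E r - Bs. \<exists>Cs\<in>MM. X \<in> Cs}"

lemma co_base_iff: "Bs \<in> MM \<Longrightarrow> X \<subseteq> E \<Longrightarrow> E - X \<in> co E Bs \<longleftrightarrow> X \<in> Bs"
  using co_mem_iff[of Bs E X] base_subE by blast

lemma adjacent_cases:
  assumes Bs: "Bs \<in> MM" and X: "X \<in> rsets E r - Bs" and Y: "Y \<in> rsets E r - Bs" and "johnson X Y"
  obtains (up) P x y where "X = insert x P" "Y = insert y P" "x \<notin> P" "y \<notin> P" "P \<subseteq> E"
      "Suc (card P) = r" "up E r P \<inter> Bs = {}"
  | (dn) P x y where "E - X = insert x P" "E - Y = insert y P" "x \<notin> P" "y \<notin> P" "P \<subseteq> E"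
      "Suc (card P) = card E - r" "up E (card E - r) P \<inter> co E Bs = {}"
proof -
  interpret b: base_system E r Bs using Bs by (rule sys)
  obtain P x y where xy: "X = insert x P" "Y = insert y P" "x \<notin> P" "y \<notin> P" "x \<noteq> y"
    using \<open>johnson X Y\<close> by (rule johnsonE)
  have XE: "X \<subseteq> E" "Y \<subseteq> E" "card X = r" using X Y by (auto simp: rsets_def)
  have PE: "P \<subseteq> E" "x \<in> E" "y \<in> E" using XE xy by auto
  have finP: "finite P" using PE finE finite_subset by blast
  have cP: "Suc (card P) = r" using XE xy(1,3) finP by simp
  have IU: "X \<inter> Y = P" "X \<union> Y = insert x (insert y P)" using xy by auto
  consider "up E r P \<inter> Bs = {}" | "dn E r (insert x (insert y P)) \<inter> Bs = {}"
    using b.adjacent_nonbases[OF X Y \<open>johnson X Y\<close>] IU by auto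
  then show thesis
  proof cases
    case 1
    then show thesis using up xy PE cP by blast
  next
    case 2
    define Q where "Q = insert x (insert y P)"
    have Q: "Q \<subseteq> E" "card Q = Suc r" using PE xy(3-5) finP cP by (auto simp: Q_def)
    then have "Suc r \<le> card E" using finE card_mono by metis
    then have cQ: "Suc (card (E - Q)) = card E - r"
      using Q finE by (simp add: card_Diff_subset finite_subset)
    have "dn E r Q \<subseteq> Pow E" by (auto simp: dn_def rsets_def)
    then have "up E (card E - r) (E - Q) \<inter> co E Bs = {}"
      using 2 b.co_int_empty[of "dn E r Q"] co_dn[OF finE r_le Q(1)] by (simp add: Q_def)
    moreover have "E - Q \<subseteq> E" by blast
    moreover have "E - X = insert y (E - Q)" "E - Y = insert x (E - Q)" "y \<notin> E - Q" "x \<notin> E - Q"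
      using PE xy by (auto simp: Q_def)
    ultimately show thesis using cQ by (intro dn[of y "E - Q" x])
  qed
qed

lemma und_adjacent_eqv:
  assumes Bs: "Bs \<in> MM" and X: "X \<in> und Bs" and Y: "Y \<in> und Bs" and adj: "johnson X Y"
  shows "eqv X Y"
proof -
  obtain Cs where Cs: "Cs \<in> MM" "X \<in> Cs" using X by (auto simp: und_def)
  obtain Ds where Ds: "Ds \<in> MM" "Y \<in> Ds" using Y by (auto simp: und_def)
  have XY: "X \<in> rsets E r - Bs" "Y \<in> rsets E r - Bs" using X Y by (auto simp: und_def)
  then have XE: "X \<subseteq> E" "Y \<subseteq> E" by (auto simp: rsets_def)
  interpret d: indistinct E "card E - r" a "co E ` MM" "co E Kn" by (rule dual)
  show ?thesis
    using Bs XY adj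
  proof (cases rule: adjacent_cases)
    case (up P x y)
    then show ?thesis using up_adjacent[OF Bs up(5-7) Cs(1) up(3) _ Ds(1) up(4)] Cs(2) Ds(2)
      by (auto simp: eqv_def)
  next
    case (dn P x y)
    have c: "insert x P \<in> co E Cs" using Cs(2) dn(1) by (metis image_eqI)
    have d: "insert y P \<in> co E Ds" using Ds(2) dn(2) by (metis image_eqI)
    show ?thesis
      unfolding eqv_def
    proof
      fix Fs assume Fs: "Fs \<in> MM"
      have "insert x P \<in> co E Fs \<longleftrightarrow> insert y P \<in> co E Fs"
        by (rule d.up_adjacent[OF _ dn(5-7) _ dn(3) c _ dn(4) d]) (use Bs Cs Ds Fs in auto)
      then show "X \<in> Fs \<longleftrightarrow> Y \<in> Fs"
        unfolding dn(1)[symmetric] dn(2)[symmetric] co_base_iff[OF Fs XE(1)] co_base_iff[OF Fs XE(2)] .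
    qed
  qed
qed

text \<open>\<open>Y\<close> may be any nonbasis, known or not. Hence an undetermined set that is
  alone in its class has no nonbasis neighbour at all, which is what identifies it as
  isolated.\<close>

lemma und_partner:
  assumes Bs: "Bs \<in> MM" and X: "X \<in> und Bs" and Y: "Y \<in> rsets E r - Bs" and adj: "johnson X Y"
  shows "\<exists>Z\<in>rsets E r. Z \<noteq> X \<and> eqv X Z"
proof -
  obtain Cs where Cs: "Cs \<in> MM" "X \<in> Cs" using X by (auto simp: und_def)
  have XY: "X \<in> rsets E r - Bs" using X by (auto simp: und_def)
  then have XE: "X \<subseteq> E" by (auto simp: rsets_def)
  interpret d: indistinct E "card E - r" a "co E ` MM" "co E Kn" by (rule dual)
  show ?thesis
    using Bs XY Y adj
  proof (cases rule: adjacent_cases)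
    case (up P x y)
    then obtain z where z: "z \<in> E - P" "z \<noteq> x" "\<forall>Ds\<in>MM. insert x P \<in> Ds \<longleftrightarrow> insert z P \<in> Ds"
      using up_partner[OF Bs up(5-7) Cs(1) up(3)] Cs(2) by auto
    have "insert z P \<in> Cs" using z Cs up by auto
    then have "insert z P \<in> rsets E r" using base_sub Cs(1) by blast
    moreover have "insert z P \<noteq> X" using z up by auto
    ultimately show ?thesis
      using z(3) unfolding eqv_def up(1) by (intro bexI[of _ "insert z P"]) simp_all
  next
    case (dn P x y)
    have c: "insert x P \<in> co E Cs" using Cs(2) dn(1) by (metis image_eqI)
    obtain z where z: "z \<in> E - P" "z \<noteq> x" "\<forall>Ds\<in>co E ` MM. insert x P \<in> Ds \<longleftrightarrow> insert z P \<in> Ds"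
      using d.up_partner[OF _ dn(5-7) _ dn(3) c] Bs Cs by auto
    define Z where "Z = E - insert z P"
    have ZE: "Z \<subseteq> E" "E - Z = insert z P" using z dn(5) by (auto simp: Z_def)
    have iff: "X \<in> Fs \<longleftrightarrow> Z \<in> Fs" if Fs: "Fs \<in> MM" for Fs
    proof -
      have "E - X \<in> co E Fs \<longleftrightarrow> E - Z \<in> co E Fs" using z(3) Fs dn(1) ZE(2) by simp
      then show ?thesis unfolding co_base_iff[OF Fs XE] co_base_iff[OF Fs ZE(1)] .
    qed
    then have "Z \<in> rsets E r" using base_sub Cs by blast
    moreover have "Z \<noteq> X" using z(2) dn(1,3) ZE(2) by auto
    ultimately show ?thesis
      using iff unfolding eqv_def by (intro bexI[of _ Z]) simp_all
  qed
qed

definition cls :: "'a set \<Rightarrow> 'a set set" where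
  "cls X = {Y \<in> rsets E r. eqv X Y}"

definition rep :: "'a set set \<Rightarrow> 'a set" where
  "rep c = (SOME X. X \<in> c)"

definition rep2 :: "'a set set \<Rightarrow> 'a set" where
  "rep2 c = (SOME X. X \<in> c \<and> X \<noteq> rep c)"

definition big_classes :: "'a set set \<Rightarrow> 'a set set set" where
  "big_classes Bs = {c \<in> cls ` und Bs. \<exists>X\<in>c. X \<noteq> rep c}"

text \<open>One representative per class. The parameter \<open>Z\<close> is a free choice between
  two representatives in each nontrivial class, so one matroid owns as many encodings as
  \<open>big_classes\<close> has subsets.\<close>

definition encode :: "'a set set \<Rightarrow> 'a set set set \<Rightarrow> 'a set set" where
  "encode Bs Z = (\<lambda>c. if c \<in> Z then rep2 c else rep c) ` cls ` und Bs"

lemma cls_eq_iff: "X \<in> rsets E r \<Longrightarrow> Y \<in> rsets E r \<Longrightarrow> Y \<in> cls X \<longleftrightarrow> cls Y = cls X"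
  by (auto simp: cls_def eqv_def)

lemma rep_in: "X \<in> rsets E r \<Longrightarrow> rep (cls X) \<in> cls X"
  unfolding rep_def by (rule someI[of _ X]) (simp add: cls_def eqv_def)

lemma rep2_in: "c \<in> big_classes Bs \<Longrightarrow> rep2 c \<in> c \<and> rep2 c \<noteq> rep c"
  unfolding rep2_def by (rule someI_ex) (auto simp: big_classes_def)

lemma und_rsets: "und Bs \<subseteq> rsets E r"
  by (auto simp: und_def)

lemma cls_und: "Bs \<in> MM \<Longrightarrow> X \<in> und Bs \<Longrightarrow> cls X \<subseteq> und Bs"
  by (auto simp: und_def cls_def eqv_def)

lemma finite_und: "finite (und Bs)"
  using finite_rsets[OF finE] und_rsets finite_subset by blast

lemma pick_in:
  assumes "Z \<subseteq> big_classes Bs" "X \<in> und Bs"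
  shows "(if cls X \<in> Z then rep2 (cls X) else rep (cls X)) \<in> cls X"
  using assms rep_in[of X] rep2_in[of "cls X" Bs] und_rsets by auto

lemma cls_pick:
  assumes "Z \<subseteq> big_classes Bs" "X \<in> und Bs"
  shows "cls (if cls X \<in> Z then rep2 (cls X) else rep (cls X)) = cls X"
proof -
  define p where "p = (if cls X \<in> Z then rep2 (cls X) else rep (cls X))"
  have p: "p \<in> cls X" unfolding p_def by (rule pick_in[OF assms])
  have "X \<in> rsets E r" "p \<in> rsets E r" using p und_rsets assms(2) by (auto simp: cls_def)
  then have "cls p = cls X" using p by (simp add: cls_eq_iff)
  then show ?thesis unfolding p_def .
qed

lemma encode_sub: "Bs \<in> MM \<Longrightarrow> Z \<subseteq> big_classes Bs \<Longrightarrow> encode Bs Z \<subseteq> und Bs"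
proof
  fix S assume a: "Bs \<in> MM" "Z \<subseteq> big_classes Bs" "S \<in> encode Bs Z"
  then obtain X where X: "X \<in> und Bs" "S = (if cls X \<in> Z then rep2 (cls X) else rep (cls X))"
    by (auto simp: encode_def simp del: if_split)
  show "S \<in> und Bs" using pick_in[OF a(2) X(1)] cls_und[OF a(1) X(1)] unfolding X(2) by blast
qed

lemma cls_encode: "Z \<subseteq> big_classes Bs \<Longrightarrow> cls ` encode Bs Z = cls ` und Bs"
  unfolding encode_def image_image by (intro image_cong refl) (rule cls_pick)

lemma und_eq_Union_encode: "Bs \<in> MM \<Longrightarrow> Z \<subseteq> big_classes Bs \<Longrightarrow> und Bs = \<Union>(cls ` encode Bs Z)"
  unfolding cls_encode using cls_und und_rsets by (fastforce simp: cls_def eqv_def)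

text \<open>Adjacent members of \<open>und\<close> are equivalent, and the encoding takes just one
  set from each class.\<close>

lemma encode_stable:
  assumes Bs: "Bs \<in> MM" and Z: "Z \<subseteq> big_classes Bs"
  shows "encode Bs Z \<in> stable_sets johnson (rsets E r)"
  unfolding stable_sets_def
proof (intro CollectI conjI ballI notI)
  show "encode Bs Z \<subseteq> rsets E r" using encode_sub[OF Bs Z] und_rsets by blast
  fix S T assume ST: "S \<in> encode Bs Z" "T \<in> encode Bs Z" "johnson S T"
  then have "S \<in> und Bs" "T \<in> und Bs" using encode_sub[OF Bs Z] by auto
  then have "T \<in> cls S" using und_adjacent_eqv[OF Bs _ _ ST(3)] und_rsets by (auto simp: cls_def)
  then have eq: "cls T = cls S"
    using cls_eq_iff \<open>S \<in> und Bs\<close> \<open>T \<in> und Bs\<close> und_rsets by blast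
  obtain X Y where X: "X \<in> und Bs" "S = (if cls X \<in> Z then rep2 (cls X) else rep (cls X))"
    and Y: "Y \<in> und Bs" "T = (if cls Y \<in> Z then rep2 (cls Y) else rep (cls Y))"
    using ST by (auto simp: encode_def simp del: if_split)
  have "cls X = cls S" "cls Y = cls T" using cls_pick[OF Z X(1)] cls_pick[OF Z Y(1)] X(2) Y(2) by auto
  then have "S = T" using X(2) Y(2) eq by simp
  then show False using ST(3) by (simp add: johnson_irrefl)
qed

lemma und_determines:
  assumes Bs: "Bs \<in> MM" and Cs: "Cs \<in> MM" and eq: "und Bs = und Cs"
  shows "Bs = Cs"
proof -
  have det: "Fs = {X \<in> rsets E r. (\<exists>Cs\<in>MM. X \<in> Cs) \<and> X \<notin> und Fs}" if "Fs \<in> MM" for Fs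
    using that base_sub by (auto simp: und_def)
  show ?thesis using det[OF Bs] det[OF Cs] unfolding eq by simp
qed

text \<open>Classes depend on \<open>MM\<close> only, so an encoding returns \<open>und Bs\<close>
  as the union of the classes it meets, and \<open>und_determines\<close> returns \<open>Bs\<close>.
  Then \<open>Z\<close> is read off from the second representatives that occur.\<close>

lemma encode_inj: "inj_on (\<lambda>(Bs, Z). encode Bs Z) (Sigma MM (\<lambda>Bs. Pow (big_classes Bs)))"
proof (rule inj_onI, clarify)
  fix Bs Z Cs Y
  assume Bs: "Bs \<in> MM" and Z: "Z \<subseteq> big_classes Bs" and Cs: "Cs \<in> MM" and Y: "Y \<subseteq> big_classes Cs"
    and eq: "encode Bs Z = encode Cs Y"
  have "und Bs = und Cs"
    using und_eq_Union_encode[OF Bs Z] und_eq_Union_encode[OF Cs Y] eq by simp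
  then have B: "Bs = Cs" using Bs Cs und_determines by blast
  have rec: "W = {c \<in> big_classes Bs. rep2 c \<in> encode Bs W}" if W: "W \<subseteq> big_classes Bs" for W
  proof (intro set_eqI iffI)
    fix c assume c: "c \<in> W"
    then have "c \<in> cls ` und Bs" using W by (auto simp: big_classes_def)
    then have "rep2 c \<in> encode Bs W" using c by (force simp: encode_def)
    then show "c \<in> {c \<in> big_classes Bs. rep2 c \<in> encode Bs W}" using c W by auto
  next
    fix c assume c: "c \<in> {c \<in> big_classes Bs. rep2 c \<in> encode Bs W}"
    then obtain X where X: "X \<in> und Bs" "rep2 c = (if cls X \<in> W then rep2 (cls X) else rep (cls X))"
      by (auto simp: encode_def simp del: if_split)
    obtain X' where X': "X' \<in> und Bs" "c = cls X'" using c by (auto simp: big_classes_def)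
    have "rep2 c \<in> c" "rep2 c \<noteq> rep c" using c rep2_in by auto
    then have "cls (rep2 c) = c" using X' cls_eq_iff[of X' "rep2 c"] und_rsets by (auto simp: cls_def)
    moreover have "cls (rep2 c) = cls X" using cls_pick[OF W X(1)] X(2) by simp
    ultimately have "cls X = c" by simp
    then show "c \<in> W" using X(2) \<open>rep2 c \<noteq> rep c\<close> by metis
  qed
  have "Z = {c \<in> big_classes Bs. rep2 c \<in> encode Bs Z}" by (rule rec[OF Z])
  also have "\<dots> = {c \<in> big_classes Bs. rep2 c \<in> encode Bs Y}" using eq B by simp
  also have "\<dots> = Y" using rec[of Y] Y B by simp
  finally show "Bs = Cs \<and> Z = Y" using B by simp
qed

lemma finite_MM: "finite MM"
proof (rule finite_subset)
  show "MM \<subseteq> Pow (rsets E r)" using base_sub by blast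
  show "finite (Pow (rsets E r))" using finite_rsets[OF finE] by simp
qed

text \<open>By \<open>und_partner\<close> every class outside \<open>big_classes\<close> consists of
  a single isolated nonbasis.\<close>

lemma card_encode_le:
  assumes Bs: "Bs \<in> MM"
  shows "card (encode Bs {}) \<le> card (isolated E r Bs) + card (big_classes Bs)"
proof -
  define S where "S = cls ` und Bs - big_classes Bs"
  have fin: "finite (cls ` und Bs)" using finite_und by simp
  have "S \<subseteq> cls ` isolated E r Bs"
  proof
    fix c assume c: "c \<in> S"
    then obtain X where X: "X \<in> und Bs" "c = cls X" by (auto simp: S_def)
    have one: "Y = rep c" if "Y \<in> c" for Y using c that by (auto simp: S_def big_classes_def)
    have XX: "X \<in> c" using X und_rsets by (auto simp: cls_def eqv_def)
    have "\<not> johnson X Y" if "Y \<in> rsets E r - Bs" for Y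
    proof
      assume "johnson X Y"
      then obtain Z where "Z \<in> rsets E r" "Z \<noteq> X" "eqv X Z"
        using und_partner[OF Bs X(1) \<open>Y \<in> rsets E r - Bs\<close>] by blast
      then have "Z \<in> c" using X by (simp add: cls_def)
      then show False using one[OF XX] one \<open>Z \<noteq> X\<close> by metis
    qed
    then have "X \<in> isolated E r Bs" using X(1) by (auto simp: isolated_def und_def)
    then show "c \<in> cls ` isolated E r Bs" using X by simp
  qed
  moreover have fi: "finite (isolated E r Bs)"
    using finite_rsets[OF finE] by (auto simp: isolated_def intro: finite_subset)
  ultimately have "card S \<le> card (isolated E r Bs)"
    by (meson card_image_le card_mono finite_imageI order_trans)
  moreover have "card (cls ` und Bs) = card S + card (big_classes Bs)"
  proof -
    have "big_classes Bs \<subseteq> cls ` und Bs" by (auto simp: big_classes_def)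
    then show ?thesis using fin unfolding S_def
      by (metis card_Diff_subset card_mono finite_subset le_add_diff_inverse2)
  qed
  moreover have "card (encode Bs {}) \<le> card (cls ` und Bs)"
    unfolding encode_def using fin by (rule card_image_le)
  ultimately show ?thesis by simp
qed

text \<open>Split at \<open>c\<close> nontrivial classes. Above it, each matroid occupies 2^c stable
  sets of its own; below it, \<open>encode Bs {}\<close> is a small stable set that determines the
  matroid.\<close>

lemma card_le_stable_sets:
  assumes iso: "\<And>Bs. Bs \<in> MM \<Longrightarrow> card (isolated E r Bs) \<le> w"
  shows "real (card MM) \<le> real (card (stable_sets johnson (rsets E r))) / 2 ^ c
    + real (card {T \<in> stable_sets johnson (rsets E r). card T \<le> w + c})"
proof -
  define M1 where "M1 = {Bs \<in> MM. c \<le> card (big_classes Bs)}"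
  define M2 where "M2 = {Bs \<in> MM. card (big_classes Bs) < c}"
  let ?S = "stable_sets johnson (rsets E r)"
  have finS: "finite ?S" using finite_stable_sets finite_rsets[OF finE] by blast
  have fin: "finite M1" "finite M2" using finite_MM by (auto simp: M1_def M2_def)
  have finb: "finite (big_classes Bs)" for Bs
    using finite_und[of Bs] by (simp add: big_classes_def)
  have "MM = M1 \<union> M2" "M1 \<inter> M2 = {}" by (auto simp: M1_def M2_def)
  then have "card MM = card M1 + card M2" using fin by (simp add: card_Un_disjoint)
  moreover have "card M1 * 2 ^ c \<le> card ?S"
  proof -
    have "card M1 * 2 ^ c = (\<Sum>Bs\<in>M1. 2 ^ c)" by simp
    also have "\<dots> \<le> (\<Sum>Bs\<in>M1. card (Pow (big_classes Bs)))"
      using finb by (intro sum_mono) (auto simp: card_Pow M1_def)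
    also have "\<dots> = card (Sigma M1 (\<lambda>Bs. Pow (big_classes Bs)))"
      using fin finb by simp
    also have "\<dots> \<le> card ?S"
    proof (rule card_inj_on_le[OF _ _ finS])
      show "inj_on (\<lambda>(Bs, Z). encode Bs Z) (Sigma M1 (\<lambda>Bs. Pow (big_classes Bs)))"
        by (rule inj_on_subset[OF encode_inj]) (auto simp: M1_def)
      show "(\<lambda>(Bs, Z). encode Bs Z) ` Sigma M1 (\<lambda>Bs. Pow (big_classes Bs)) \<subseteq> ?S"
        using encode_stable by (auto simp: M1_def)
    qed
    finally show ?thesis .
  qed
  then have "real (card M1) \<le> real (card ?S) / 2 ^ c"
    by (simp add: pos_le_divide_eq flip: of_nat_le_iff[where 'a=real])
  moreover have "card M2 \<le> card {T \<in> ?S. card T \<le> w + c}"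
  proof (rule card_inj_on_le)
    show "inj_on (\<lambda>Bs. encode Bs {}) M2"
      using encode_inj by (auto simp: inj_on_def M2_def)
    show "(\<lambda>Bs. encode Bs {}) ` M2 \<subseteq> {T \<in> ?S. card T \<le> w + c}"
      using encode_stable card_encode_le iso by (fastforce simp: M2_def)
  qed (use finS in simp)
  ultimately show ?thesis by simp
qed

end

section \<open>Certificates\<close>

lemma double_count_bound:
  fixes l u :: real
  assumes "finite A" "finite B"
    and l: "\<And>x. x \<in> A \<Longrightarrow> l \<le> real (card {y\<in>B. R x y})"
    and u: "\<And>y. y \<in> B \<Longrightarrow> real (card {x\<in>A. R x y}) \<le> u"
  shows "real (card A) * l \<le> real (card B) * u"
proof -
  have "real (card A) * l \<le> (\<Sum>x\<in>A. real (card {y\<in>B. R x y}))"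
    using sum_mono[of A "\<lambda>_. l"] l by simp
  also have "\<dots> = real (\<Sum>x\<in>A. \<Sum>y\<in>B. of_bool (R x y))"
    using assms(2) by (simp add: Int_def)
  also have "\<dots> = real (\<Sum>y\<in>B. \<Sum>x\<in>A. of_bool (R x y))"
    by (subst sum.swap) simp
  also have "\<dots> = (\<Sum>y\<in>B. real (card {x\<in>A. R x y}))"
    using assms(1) by (simp add: Int_def)
  also have "\<dots> \<le> real (card B) * u"
    using sum_mono[of B _ "\<lambda>_. u"] u by simp
  finally show ?thesis .
qed

lemma rsetsD: "finite E \<Longrightarrow> X \<in> rsets E r \<Longrightarrow> finite X \<and> card X = r \<and> X \<subseteq> E"
  by (auto simp: rsets_def finite_subset)

lemma card_rsets_le_central: "finite E \<Longrightarrow> real (card (rsets E k)) \<le> real (card E choose (card E div 2))"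
  by (simp add: card_rsets binomial_maximum)

text \<open>Two distinct r-sets can share only the (r-1)-set that is their intersection: these are
  the blocks for \<open>double_counting_degree\<close>.\<close>

lemma johnson_lower_blocks:
  assumes finE: "finite E" and X: "X \<in> rsets E r" "Y \<in> rsets E r"
  defines "blk \<equiv> \<lambda>X. (\<lambda>x. X - {x}) ` X"
  shows "blk X \<subseteq> rsets E (r - 1) \<and> card (blk X) = r"
    and "X \<noteq> Y \<Longrightarrow> card (blk X \<inter> blk Y) \<le> of_bool (johnson X Y)"
proof -
  have fin: "finite X" "finite Y" "card X = r" "card Y = r"
    using rsetsD[OF finE X(1)] rsetsD[OF finE X(2)] by simp_all
  have "inj_on (\<lambda>x. X - {x}) X" by (auto simp: inj_on_def)
  then show "blk X \<subseteq> rsets E (r - 1) \<and> card (blk X) = r"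
    using X fin by (auto simp: blk_def card_image rsets_def)
  assume ne: "X \<noteq> Y"
  have sub: "Z = X \<inter> Y \<and> johnson X Y" if Z: "Z \<in> blk X \<inter> blk Y" for Z
  proof -
    obtain x y where xy: "x \<in> X" "y \<in> Y" "Z = X - {x}" "Z = Y - {y}"
      using Z by (auto simp: blk_def)
    have "X = insert x Z" "Y = insert y Z" "x \<notin> Z" "y \<notin> Z" using xy by auto
    moreover from this ne have "x \<noteq> y" by auto
    ultimately show ?thesis using johnson_insert[of x Z y] by auto
  qed
  show "card (blk X \<inter> blk Y) \<le> of_bool (johnson X Y)"
  proof (cases "johnson X Y")
    case True
    have "blk X \<inter> blk Y \<subseteq> {X \<inter> Y}" using sub by auto
    then show ?thesis using True card_mono[of "{X \<inter> Y}"] by fastforce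
  next
    case False
    then have "blk X \<inter> blk Y = {}" using sub by auto
    then show ?thesis by simp
  qed
qed

lemma johnson_upper_blocks:
  assumes finE: "finite E" and X: "X \<in> rsets E r" "Y \<in> rsets E r"
  defines "blk \<equiv> \<lambda>X. (\<lambda>x. insert x X) ` (E - X)"
  shows "blk X \<subseteq> rsets E (Suc r) \<and> card (blk X) = card E - r"
    and "X \<noteq> Y \<Longrightarrow> card (blk X \<inter> blk Y) \<le> of_bool (johnson X Y)"
proof -
  have fin: "finite X" "finite Y" "card X = r" "card Y = r" "X \<subseteq> E" "Y \<subseteq> E"
    using rsetsD[OF finE X(1)] rsetsD[OF finE X(2)] by simp_all
  have "inj_on (\<lambda>x. insert x X) (E - X)" by (auto simp: inj_on_def)
  then show "blk X \<subseteq> rsets E (Suc r) \<and> card (blk X) = card E - r"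
    using fin by (auto simp: blk_def card_image rsets_def card_Diff_subset)
  assume ne: "X \<noteq> Y"
  have sub: "Z = X \<union> Y \<and> johnson X Y" if Z: "Z \<in> blk X \<inter> blk Y" for Z
  proof -
    obtain x y where xy: "x \<notin> X" "y \<notin> Y" "Z = insert x X" "Z = insert y Y"
      using Z by (auto simp: blk_def)
    have "x \<noteq> y"
    proof
      assume "x = y"
      then have "X = Z - {x}" "Y = Z - {x}" using xy by auto
      then show False using ne by simp
    qed
    then have "X - Y = {y}" "Y - X = {x}" "Z = X \<union> Y" using xy by auto
    then show ?thesis by (simp add: johnson_def)
  qed
  show "card (blk X \<inter> blk Y) \<le> of_bool (johnson X Y)"
  proof (cases "johnson X Y")
    case True
    have "blk X \<inter> blk Y \<subseteq> {X \<union> Y}" using sub by auto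
    then show ?thesis using True card_mono[of "{X \<union> Y}"] by fastforce
  next
    case False
    then have "blk X \<inter> blk Y = {}" using sub by auto
    then show ?thesis by simp
  qed
qed

text \<open>With \<open>r\<close> blocks per vertex and at most N blocks, Cauchy-Schwarz bounds the
  size by N / r plus N g / r^2. For \<open>r\<close> of order n this is \<open>o(N)\<close> as soon
  as the degree bound \<open>g\<close> is \<open>o(n^2)\<close>.\<close>

lemma card_sparse_le:
  fixes g :: real
  assumes finE: "finite E" and A: "A \<subseteq> rsets E r" and r: "0 < r" and g: "0 \<le> g"
    and deg: "\<And>X. X \<in> A \<Longrightarrow> real (card {Y\<in>A. Y \<noteq> X \<and> johnson X Y}) \<le> g"
  shows "real (card A) \<le> real (card E choose (card E div 2)) * (real r + g) / (real r)\<^sup>2"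
proof (cases "card A = 0")
  case False
  have finA: "finite A" using A finite_rsets[OF finE] finite_subset by blast
  have sub: "X \<in> rsets E r" if "X \<in> A" for X using that A by auto
  have "(r * card A)\<^sup>2 \<le> card (rsets E (r - 1)) * (r * card A + (\<Sum>X\<in>A. card {Y\<in>A. Y \<noteq> X \<and> johnson X Y}))"
    by (rule double_counting_degree[where blk = "\<lambda>X. (\<lambda>x. X - {x}) ` X"])
      (use finA finite_rsets[OF finE] johnson_lower_blocks[OF finE sub sub] in auto)
  then have "real ((r * card A)\<^sup>2) \<le> real (card (rsets E (r - 1)) *
      (r * card A + (\<Sum>X\<in>A. card {Y\<in>A. Y \<noteq> X \<and> johnson X Y})))"
    by (simp only: of_nat_le_iff)
  also have "\<dots> = real (card (rsets E (r - 1))) *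
      (real r * real (card A) + (\<Sum>X\<in>A. real (card {Y\<in>A. Y \<noteq> X \<and> johnson X Y})))" by simp
  also have "\<dots> \<le> real (card E choose (card E div 2)) * (real r * real (card A) + real (card A) * g)"
    using sum_mono[of A _ "\<lambda>_. g"] deg card_rsets_le_central[OF finE, of "r - 1"]
    by (intro mult_mono add_mono) (auto intro!: add_nonneg_nonneg sum_nonneg)
  finally have "real (card A) * ((real r)\<^sup>2 * real (card A))
      \<le> real (card A) * (real (card E choose (card E div 2)) * (real r + g))"
    by (simp add: power2_eq_square algebra_simps)
  then have "(real r)\<^sup>2 * real (card A) \<le> real (card E choose (card E div 2)) * (real r + g)"
    using False by (simp add: mult_le_cancel_left)
  then show ?thesis using r by (simp add: field_simps)
qed (use g in simp)

definition ball_J :: "'a set \<Rightarrow> nat \<Rightarrow> 'a set \<Rightarrow> 'a set set" where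
  "ball_J E r X = {Y \<in> rsets E r. Y = X \<or> johnson X Y}"

text \<open>These families have about n members: n - r + 1 for \<open>up\<close> and r + 1 for
  \<open>dn\<close>. Those of \<open>certs2\<close> have order n^2 in the middle ranks. The two
  sizes belong to the two phases of \<open>certificates\<close>.\<close>

definition certs1 :: "'a set \<Rightarrow> nat \<Rightarrow> 'a set set set" where
  "certs1 E r = up E r ` rsets E (r - 1) \<union> dn E r ` rsets E (r + 1)"

definition certs2 :: "'a set \<Rightarrow> nat \<Rightarrow> 'a set set set" where
  "certs2 E r = up E r ` rsets E (r - 2) \<union> dn E r ` rsets E (r + 2) \<union> ball_J E r ` rsets E r"

lemma finite_certs: "finite E \<Longrightarrow> finite (certs1 E r)" "finite E \<Longrightarrow> finite (certs2 E r)"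
  using finite_rsets by (auto simp: certs1_def certs2_def)

lemma certs_sub: "U \<in> certs1 E r \<union> certs2 E r \<Longrightarrow> U \<subseteq> rsets E r"
  by (auto simp: certs1_def certs2_def up_def dn_def ball_J_def)

lemma card_certs:
  assumes "finite E"
  shows "real (card (certs1 E r \<union> certs2 E r)) \<le> 5 * real (card E choose (card E div 2))"
proof -
  have im: "real (card (f ` rsets E k)) \<le> real (card E choose (card E div 2))" for f :: "'a set \<Rightarrow> 'a set set" and k
    using card_image_le[OF finite_rsets[OF assms], of f k] card_rsets_le_central[OF assms, of k] by linarith
  have un: "real (card (A \<union> B)) \<le> real (card A) + real (card B)" for A B :: "'a set set set"
    using card_Un_le[of A B] by linarith
  show ?thesis unfolding certs1_def certs2_def
    using im[of "up E r" "r - 1"] im[of "dn E r" "r + 1"] im[of "up E r" "r - 2"] im[of "dn E r" "r + 2"]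
      im[of "ball_J E r" r] un[of "up E r ` rsets E (r - 1)" "dn E r ` rsets E (r + 1)"]
      un[of "up E r ` rsets E (r - 2)" "dn E r ` rsets E (r + 2)"]
      un[of "up E r ` rsets E (r - 2) \<union> dn E r ` rsets E (r + 2)" "ball_J E r ` rsets E r"]
      un[of "up E r ` rsets E (r - 1) \<union> dn E r ` rsets E (r + 1)"
        "up E r ` rsets E (r - 2) \<union> dn E r ` rsets E (r + 2) \<union> ball_J E r ` rsets E r"]
    by linarith
qed

lemma card_pairs_ge:
  fixes t :: real
  assumes "finite R" "t \<le> real (card R)" "2 \<le> t"
  shows "t\<^sup>2 / 4 \<le> real (card {S. S \<subseteq> R \<and> card S = 2})"
proof -
  have "card {S. S \<subseteq> R \<and> card S = 2} = card R choose 2" using assms(1) by (rule n_subsets)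
  moreover have "real (card R choose 2) = real (card R) * (real (card R) - 1) / 2"
  proof -
    have "2 * (card R choose 2) = card R * (card R - 1)"
      unfolding choose_two by (rule dvd_mult_div_cancel) auto
    then have "2 * real (card R choose 2) = real (card R) * real (card R - 1)"
      by (metis of_nat_mult of_nat_numeral)
    moreover have "1 \<le> card R" using assms by linarith
    ultimately show ?thesis by (simp add: of_nat_diff)
  qed
  moreover have "t * (t / 2) \<le> real (card R) * (real (card R) - 1)"
    using assms by (intro mult_mono) auto
  ultimately show ?thesis by (simp add: power2_eq_square)
qed

section \<open>Nonbases that the quadratic certificates leave unrevealed\<close>

context base_system
begin

text \<open>The neighbours X - x + y of \<open>X\<close> form a grid indexed by X and E - X. By
  \<open>adjacent_nonbases\<close> the nonbases around a nonbasis \<open>X\<close> fill whole lines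
  of this grid: the rows x in \<open>rows X\<close> and the columns y in
  \<open>cols X\<close>.\<close>

definition rows :: "'a set \<Rightarrow> 'a set" where
  "rows X = {x \<in> X. up E r (X - {x}) \<inter> Bs = {}}"

definition cols :: "'a set \<Rightarrow> 'a set" where
  "cols X = {y \<in> E - X. dn E r (insert y X) \<inter> Bs = {}}"

text \<open>The basis in the ball of \<open>X\<close> is what \<open>up_pair\<close> needs to turn
  any two rows into a dependent (r-2)-set inside \<open>X\<close>. So at least t^2 / 4 such sets lie
  below each \<open>X\<close>, while each of them lies below at most \<theta> members of
  \<open>U\<close>.\<close>

lemma card_many_rows:
  fixes t \<theta> :: real
  assumes U: "U \<subseteq> rsets E r - Bs" and t: "2 \<le> t" and \<theta>: "0 \<le> \<theta>"
    and unk: "\<And>P. P \<in> rsets E (r - 2) \<Longrightarrow> up E r P \<inter> Bs = {} \<Longrightarrow> real (card (up E r P \<inter> U)) \<le> \<theta>"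
    and B: "B \<subseteq> U" "\<And>X. X \<in> B \<Longrightarrow> ball_J E r X \<inter> Bs \<noteq> {} \<and> t \<le> real (card (rows X))"
  shows "real (card B) * (t\<^sup>2 / 4) \<le> real (card E choose (card E div 2)) * \<theta>"
proof -
  define Ps where "Ps = {P \<in> rsets E (r - 2). up E r P \<inter> Bs = {}}"
  have finU: "finite U" using U finite_rsets[OF finE] finite_subset by blast
  have finB: "finite B" using B(1) finU finite_subset by blast
  have finP: "finite Ps" using finite_rsets[OF finE] by (simp add: Ps_def)
  have "real (card B) * (t\<^sup>2 / 4) \<le> real (card Ps) * \<theta>"
  proof (rule double_count_bound[OF finB finP, of _ "\<lambda>X P. P \<subseteq> X"])
    fix X assume X: "X \<in> B"
    have XK: "X \<in> rsets E r - Bs" using X B U by auto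
    then have finX: "finite X" "card X = r" "X \<subseteq> E" using rsetsD[OF finE, of X r] by auto
    obtain C where C: "C \<in> Bs" "johnson X C" using B(2)[OF X] XK by (auto simp: ball_J_def)
    have R: "rows X \<subseteq> X" by (auto simp: rows_def)
    then have finR: "finite (rows X)" using finX finite_subset by blast
    have "card {S. S \<subseteq> rows X \<and> card S = 2} \<le> card {P \<in> Ps. P \<subseteq> X}"
    proof (rule card_inj_on_le)
      show "inj_on (\<lambda>S. X - S) {S. S \<subseteq> rows X \<and> card S = 2}"
        using R by (auto simp: inj_on_def)
      show "(\<lambda>S. X - S) ` {S. S \<subseteq> rows X \<and> card S = 2} \<subseteq> {P \<in> Ps. P \<subseteq> X}"
      proof clarify
        fix S assume S: "S \<subseteq> rows X" "card S = 2"
        then obtain x1 x2 where x: "S = {x1, x2}" "x1 \<noteq> x2" by (auto simp: card_2_iff)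
        have x12: "x1 \<in> X" "x2 \<in> X" "up E r (X - {x1}) \<inter> Bs = {}" "up E r (X - {x2}) \<inter> Bs = {}"
          using S(1) x by (auto simp: rows_def)
        have "up E r (X - S) \<inter> Bs = {}"
          unfolding x(1) using up_pair[OF _ C x12(1,2) x(2) x12(3,4)] XK by simp
        moreover have "card (X - S) = r - 2"
          using finX x x12 by (simp add: card_Diff_subset)
        ultimately show "X - S \<in> Ps \<and> X - S \<subseteq> X" using finX by (auto simp: Ps_def rsets_def)
      qed
    qed (use finP in simp)
    then show "t\<^sup>2 / 4 \<le> real (card {P \<in> Ps. P \<subseteq> X})"
      using card_pairs_ge[OF finR _ t] B(2)[OF X] by force
  next
    fix P assume P: "P \<in> Ps"
    have "{X \<in> B. P \<subseteq> X} \<subseteq> up E r P \<inter> U" using B(1) U by (auto simp: up_def)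
    then have "card {X \<in> B. P \<subseteq> X} \<le> card (up E r P \<inter> U)" using finU by (intro card_mono) auto
    then show "real (card {X \<in> B. P \<subseteq> X}) \<le> \<theta>" using unk[of P] P by (force simp: Ps_def)
  qed
  also have "\<dots> \<le> real (card E choose (card E div 2)) * \<theta>"
  proof (rule mult_right_mono)
    have "card Ps \<le> card (rsets E (r - 2))"
      using finite_rsets[OF finE] by (intro card_mono) (auto simp: Ps_def)
    then show "real (card Ps) \<le> real (card E choose (card E div 2))"
      using card_rsets_le_central[OF finE, of "r - 2"] by linarith
  qed (use \<theta> in simp)
  finally show ?thesis .
qed

lemma card_many_cols:
  fixes t \<theta> :: real
  assumes U: "U \<subseteq> rsets E r - Bs" and t: "2 \<le> t" and \<theta>: "0 \<le> \<theta>"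
    and unk: "\<And>P. P \<in> rsets E (r + 2) \<Longrightarrow> dn E r P \<inter> Bs = {} \<Longrightarrow> real (card (dn E r P \<inter> U)) \<le> \<theta>"
    and B: "B \<subseteq> U" "\<And>X. X \<in> B \<Longrightarrow> ball_J E r X \<inter> Bs \<noteq> {} \<and> t \<le> real (card (cols X))"
  shows "real (card B) * (t\<^sup>2 / 4) \<le> real (card E choose (card E div 2)) * \<theta>"
proof -
  define Ps where "Ps = {P \<in> rsets E (r + 2). dn E r P \<inter> Bs = {}}"
  have finU: "finite U" using U finite_rsets[OF finE] finite_subset by blast
  have finB: "finite B" using B(1) finU finite_subset by blast
  have finP: "finite Ps" using finite_rsets[OF finE] by (simp add: Ps_def)
  have "real (card B) * (t\<^sup>2 / 4) \<le> real (card Ps) * \<theta>"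
  proof (rule double_count_bound[OF finB finP, of _ "\<lambda>X P. X \<subseteq> P"])
    fix X assume X: "X \<in> B"
    have XK: "X \<in> rsets E r - Bs" using X B U by auto
    then have finX: "finite X" "card X = r" "X \<subseteq> E" using rsetsD[OF finE, of X r] by auto
    obtain C where C: "C \<in> Bs" "johnson X C" using B(2)[OF X] XK by (auto simp: ball_J_def)
    have R: "cols X \<subseteq> E - X" by (auto simp: cols_def)
    then have finR: "finite (cols X)" using finE finite_subset by blast
    have "card {S. S \<subseteq> cols X \<and> card S = 2} \<le> card {P \<in> Ps. X \<subseteq> P}"
    proof (rule card_inj_on_le)
      show "inj_on (\<lambda>S. X \<union> S) {S. S \<subseteq> cols X \<and> card S = 2}"
        using R by (auto simp: inj_on_def)
      show "(\<lambda>S. X \<union> S) ` {S. S \<subseteq> cols X \<and> card S = 2} \<subseteq> {P \<in> Ps. X \<subseteq> P}"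
      proof clarify
        fix S assume S: "S \<subseteq> cols X" "card S = 2"
        then obtain x1 x2 where x: "S = {x1, x2}" "x1 \<noteq> x2" by (auto simp: card_2_iff)
        have x12: "x1 \<in> E - X" "x2 \<in> E - X" "dn E r (insert x1 X) \<inter> Bs = {}" "dn E r (insert x2 X) \<inter> Bs = {}"
          using S(1) x by (auto simp: cols_def)
        have "dn E r (X \<union> S) \<inter> Bs = {}"
          unfolding x(1) using dn_pair[OF _ C x12(1,2) x(2) x12(3,4)] XK by (simp add: Un_commute)
        moreover have "card (X \<union> S) = r + 2"
          using finX x x12 by simp
        ultimately show "X \<union> S \<in> Ps \<and> X \<subseteq> X \<union> S" using finX x x12 by (auto simp: Ps_def rsets_def)
      qed
    qed (use finP in simp)
    then show "t\<^sup>2 / 4 \<le> real (card {P \<in> Ps. X \<subseteq> P})"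
      using card_pairs_ge[OF finR _ t] B(2)[OF X] by force
  next
    fix P assume P: "P \<in> Ps"
    have "{X \<in> B. X \<subseteq> P} \<subseteq> dn E r P \<inter> U" using B(1) U by (auto simp: dn_def)
    then have "card {X \<in> B. X \<subseteq> P} \<le> card (dn E r P \<inter> U)" using finU by (intro card_mono) auto
    then show "real (card {X \<in> B. X \<subseteq> P}) \<le> \<theta>" using unk[of P] P by (force simp: Ps_def)
  qed
  also have "\<dots> \<le> real (card E choose (card E div 2)) * \<theta>"
  proof (rule mult_right_mono)
    have "card Ps \<le> card (rsets E (r + 2))"
      using finite_rsets[OF finE] by (intro card_mono) (auto simp: Ps_def)
    then show "real (card Ps) \<le> real (card E choose (card E div 2))"
      using card_rsets_le_central[OF finE, of "r + 2"] by linarith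
  qed (use \<theta> in simp)
  finally show ?thesis .
qed

text \<open>Such an \<open>X\<close> provides its own certificate \<open>ball_J E r X\<close>, so
  few of its neighbours are still in \<open>U\<close> and \<open>card_sparse_le\<close>
  applies.\<close>

lemma card_ball_free:
  fixes \<theta> :: real
  assumes U: "U \<subseteq> rsets E r - Bs" and \<theta>: "0 \<le> \<theta>" and r: "0 < r"
    and unk: "\<And>X. X \<in> rsets E r \<Longrightarrow> ball_J E r X \<inter> Bs = {} \<Longrightarrow> real (card (ball_J E r X \<inter> U)) \<le> \<theta>"
    and A: "A \<subseteq> U" "\<And>X. X \<in> A \<Longrightarrow> ball_J E r X \<inter> Bs = {}"
  shows "real (card A) \<le> real (card E choose (card E div 2)) * (real r + \<theta>) / (real r)\<^sup>2"
proof (rule card_sparse_le[OF finE _ r \<theta>])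
  have finU: "finite U" using U finite_rsets[OF finE] finite_subset by blast
  show "A \<subseteq> rsets E r" using A(1) U by auto
  fix X assume X: "X \<in> A"
  then have XV: "X \<in> rsets E r" using A(1) U by auto
  have "{Y \<in> A. Y \<noteq> X \<and> johnson X Y} \<subseteq> ball_J E r X \<inter> U"
    using A(1) U by (auto simp: ball_J_def)
  then have "card {Y \<in> A. Y \<noteq> X \<and> johnson X Y} \<le> card (ball_J E r X \<inter> U)"
    using finU by (intro card_mono) auto
  then show "real (card {Y \<in> A. Y \<noteq> X \<and> johnson X Y}) \<le> \<theta>"
    using unk[OF XV A(2)[OF X]] by linarith
qed

text \<open>All nonbasis neighbours of \<open>X\<close> lie in at most \<open>t\<close> rows and
  \<open>t\<close> columns of the grid, each of at most |E| entries; this bounds the degree for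
  \<open>card_sparse_le\<close>.\<close>

lemma card_few_rows_cols:
  fixes t :: real
  assumes r: "0 < r" and t: "0 \<le> t"
    and A: "A \<subseteq> rsets E r - Bs" "\<And>X. X \<in> A \<Longrightarrow> real (card (rows X)) \<le> t \<and> real (card (cols X)) \<le> t"
  shows "real (card A) \<le> real (card E choose (card E div 2)) * (real r + 2 * t * real (card E)) / (real r)\<^sup>2"
proof (rule card_sparse_le[OF finE _ r])
  show "0 \<le> 2 * t * real (card E)" using t by simp
  show "A \<subseteq> rsets E r" using A(1) by auto
  fix X assume X: "X \<in> A"
  have XK: "X \<in> rsets E r - Bs" using X A(1) by auto
  have fin: "finite X" "X \<subseteq> E" using rsetsD[OF finE, of X r] XK by auto
  have sub: "rows X \<subseteq> E" "cols X \<subseteq> E" using fin by (auto simp: rows_def cols_def)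
  then have finrc: "finite (rows X)" "finite (cols X)" using finE finite_subset by auto
  let ?g = "\<lambda>(x, y). insert y (X - {x})"
  have "{Y \<in> A. Y \<noteq> X \<and> johnson X Y} \<subseteq> ?g ` (rows X \<times> E \<union> E \<times> cols X)"
  proof
    fix Y assume "Y \<in> {Y \<in> A. Y \<noteq> X \<and> johnson X Y}"
    then have Y: "Y \<in> rsets E r - Bs" "johnson X Y" using A(1) by auto
    obtain P x y where xy: "X = insert x P" "Y = insert y P" "x \<notin> P" "y \<notin> P" "x \<noteq> y"
      using Y(2) by (rule johnsonE)
    have IU: "X \<inter> Y = X - {x}" "X \<union> Y = insert y X" "Y = insert y (X - {x})" "x \<in> X" "y \<notin> X"
      using xy by auto
    have xyE: "x \<in> E" "y \<in> E" using fin xy(1) Y(1) xy(2) by (auto simp: rsets_def)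
    have "up E r (X - {x}) \<inter> Bs = {} \<or> dn E r (insert y X) \<inter> Bs = {}"
      using adjacent_nonbases[OF XK Y] unfolding IU(1,2) .
    then have "(x, y) \<in> rows X \<times> E \<union> E \<times> cols X"
      using IU(4,5) xyE by (simp add: rows_def cols_def)
    then show "Y \<in> ?g ` (rows X \<times> E \<union> E \<times> cols X)"
      using IU(3) by (intro image_eqI[of _ _ "(x, y)"]) simp_all
  qed
  then have "card {Y \<in> A. Y \<noteq> X \<and> johnson X Y} \<le> card (?g ` (rows X \<times> E \<union> E \<times> cols X))"
    using finrc finE by (intro card_mono) auto
  also have "\<dots> \<le> card (rows X \<times> E \<union> E \<times> cols X)"
    using finrc finE by (intro card_image_le) auto
  also have "\<dots> \<le> card (rows X) * card E + card E * card (cols X)"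
    using card_Un_le[of "rows X \<times> E" "E \<times> cols X"] by (simp only: card_cartesian_product)
  finally have "real (card {Y \<in> A. Y \<noteq> X \<and> johnson X Y})
      \<le> real (card (rows X) * card E + card E * card (cols X))"
    by (simp only: of_nat_le_iff)
  also have "\<dots> \<le> t * real (card E) + real (card E) * t"
    unfolding of_nat_add of_nat_mult
    using A(2)[OF X] by (intro add_mono mult_mono) auto
  finally show "real (card {Y \<in> A. Y \<noteq> X \<and> johnson X Y}) \<le> 2 * t * real (card E)"
    by simp
qed

text \<open>Two greedy phases: first the certificates that cover about \<open>n\<^sup>2\<close> sets are used until each of
  them has little left to reveal; counting edges then shows that few nonbases remain, so that the
  certificates covering about \<open>n\<close> sets become affordable.\<close>

lemma certificates:
  fixes \<theta> t :: real and a :: nat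
  assumes r: "0 < r" and \<theta>: "0 < \<theta>" and t: "2 \<le> t" and a: "0 < a"
  defines "N \<equiv> real (card E choose (card E div 2))"
  obtains I where "I \<subseteq> certs1 E r \<union> certs2 E r" "\<Union>I \<inter> Bs = {}"
    "real (card I) \<le> N / \<theta> + N * (8 * \<theta> / t\<^sup>2
      + (2 * real r + \<theta> + 2 * t * real (card E)) / (real r)\<^sup>2) / real a"
    "\<And>U. U \<in> certs1 E r \<Longrightarrow> U \<inter> Bs = {} \<Longrightarrow> card (U - \<Union>I) \<le> a"
proof -
  define K where "K = rsets E r - Bs"
  define F1 where "F1 = {U \<in> certs1 E r. U \<inter> Bs = {}}"
  define F2 where "F2 = {U \<in> certs2 E r. U \<inter> Bs = {}}"
  have fin: "finite F1" "finite F2" "finite K"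
    using finite_certs[OF finE] finite_rsets[OF finE] by (auto simp: F1_def F2_def K_def)
  have N0: "0 \<le> N" by (simp add: N_def)
  have cK: "real (card K) \<le> N"
    using card_mono[OF finite_rsets[OF finE, of r], of K] card_rsets_le_central[OF finE, of r]
    unfolding N_def K_def by fastforce
  obtain I2 where I2: "I2 \<subseteq> F2" "real (card I2) * \<theta> \<le> real (card K)"
    "\<And>U. U \<in> F2 \<Longrightarrow> real (card (U \<inter> (K - \<Union>I2))) < \<theta>"
    using greedy_cover[OF fin(2,3) \<theta>] by metis
  define U where "U = K - \<Union>I2"
  have UK: "U \<subseteq> rsets E r - Bs" by (auto simp: U_def K_def)
  have finU: "finite U" using fin by (simp add: U_def)
  have unk: "real (card (W \<inter> U)) \<le> \<theta>" if "W \<in> certs2 E r" "W \<inter> Bs = {}" for W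
    using I2(3)[of W] that by (simp add: F2_def U_def)
  \<comment> \<open>Every unrevealed nonbasis falls into one of four types: no basis in its ball
    (\<open>A\<close>), a basis in the ball and many rows (\<open>B\<close>) or many columns
    (\<open>C\<close>), or few of both (\<open>D\<close>).\<close>
  define A where "A = {X \<in> U. ball_J E r X \<inter> Bs = {}}"
  define B where "B = {X \<in> U. ball_J E r X \<inter> Bs \<noteq> {} \<and> t \<le> real (card (rows X))}"
  define C where "C = {X \<in> U. ball_J E r X \<inter> Bs \<noteq> {} \<and> t \<le> real (card (cols X))}"
  define D where "D = {X \<in> U. real (card (rows X)) \<le> t \<and> real (card (cols X)) \<le> t}"
  have cA: "real (card A) \<le> N * (real r + \<theta>) / (real r)\<^sup>2"
    unfolding N_def by (rule card_ball_free[OF UK]) (use \<theta> r unk in \<open>auto simp: A_def certs2_def\<close>)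
  have cB: "real (card B) * (t\<^sup>2 / 4) \<le> N * \<theta>"
    unfolding N_def by (rule card_many_rows[OF UK t]) (use \<theta> unk in \<open>auto simp: B_def certs2_def\<close>)
  have cC: "real (card C) * (t\<^sup>2 / 4) \<le> N * \<theta>"
    unfolding N_def by (rule card_many_cols[OF UK t]) (use \<theta> unk in \<open>auto simp: C_def certs2_def\<close>)
  have cD: "real (card D) \<le> N * (real r + 2 * t * real (card E)) / (real r)\<^sup>2"
    unfolding N_def by (rule card_few_rows_cols[OF r]) (use t UK in \<open>auto simp: D_def\<close>)
  have "U \<subseteq> A \<union> B \<union> C \<union> D" by (auto simp: A_def B_def C_def D_def)
  then have "card U \<le> card (A \<union> B \<union> C \<union> D)"
    using finU by (intro card_mono) (auto simp: A_def B_def C_def D_def)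
  also have "\<dots> \<le> card A + card B + card C + card D"
    by (meson add_le_mono card_Un_le le_refl order_trans)
  finally have "real (card U) \<le> real (card A) + real (card B) + real (card C) + real (card D)"
    by linarith
  also have "\<dots> \<le> N * (real r + \<theta>) / (real r)\<^sup>2 + 4 * (N * \<theta>) / t\<^sup>2 + 4 * (N * \<theta>) / t\<^sup>2
      + N * (real r + 2 * t * real (card E)) / (real r)\<^sup>2"
  proof (intro add_mono cA cD)
    have "0 < t\<^sup>2" using t by simp
    then show "real (card B) \<le> 4 * (N * \<theta>) / t\<^sup>2" "real (card C) \<le> 4 * (N * \<theta>) / t\<^sup>2"
      using cB cC by (simp_all add: field_simps)
  qed
  also have "\<dots> = N * (8 * \<theta> / t\<^sup>2 + (2 * real r + \<theta> + 2 * t * real (card E)) / (real r)\<^sup>2)"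
    by (simp add: add_divide_distrib algebra_simps)
  finally have cU: "real (card U) \<le> N * (8 * \<theta> / t\<^sup>2 + (2 * real r + \<theta> + 2 * t * real (card E)) / (real r)\<^sup>2)" .
  have "0 < real a" using a by simp
  then obtain I1 where I1: "I1 \<subseteq> F1" "real (card I1) * real a \<le> real (card U)"
    "\<And>W. W \<in> F1 \<Longrightarrow> real (card (W \<inter> (U - \<Union>I1))) < real a"
    using greedy_cover[OF fin(1) finU] by metis
  show thesis
  proof (rule that[of "I1 \<union> I2"])
    show "I1 \<union> I2 \<subseteq> certs1 E r \<union> certs2 E r" using I1(1) I2(1) by (auto simp: F1_def F2_def)
    show "\<Union>(I1 \<union> I2) \<inter> Bs = {}" using I1(1) I2(1) by (auto simp: F1_def F2_def)
    have "real (card I2) \<le> N / \<theta>" using I2(2) cK \<theta> by (simp add: field_simps)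
    moreover have "real (card I1) \<le> N * (8 * \<theta> / t\<^sup>2 + (2 * real r + \<theta> + 2 * t * real (card E)) / (real r)\<^sup>2) / real a"
      using I1(2) cU a by (simp add: pos_le_divide_eq)
    moreover have "real (card (I1 \<union> I2)) \<le> real (card I1) + real (card I2)"
      using card_Un_le[of I1 I2] by linarith
    ultimately show "real (card (I1 \<union> I2)) \<le> N / \<theta> + N * (8 * \<theta> / t\<^sup>2
      + (2 * real r + \<theta> + 2 * t * real (card E)) / (real r)\<^sup>2) / real a" by linarith
    fix W assume W: "W \<in> certs1 E r" "W \<inter> Bs = {}"
    then have "W \<subseteq> K" using certs_sub[of W E r] by (auto simp: K_def)
    then have "W - \<Union>(I1 \<union> I2) \<subseteq> W \<inter> (U - \<Union>I1)" by (auto simp: U_def)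
    then have "card (W - \<Union>(I1 \<union> I2)) \<le> card (W \<inter> (U - \<Union>I1))"
      using finU by (intro card_mono) auto
    then show "card (W - \<Union>(I1 \<union> I2)) \<le> a" using I1(3)[of W] W by (simp add: F1_def)
  qed
qed

end

section \<open>Matroids\<close>

definition bases_of :: "'a setsys \<Rightarrow> 'a set set" where
  "bases_of M = {B \<in> indeps M. card B = matroid_rank M}"

lemma matroidD:
  assumes "matroid M"
  shows "finite (ground M)" "{} \<in> indeps M"
    "\<And>X. X \<in> indeps M \<Longrightarrow> X \<subseteq> ground M" "\<And>X. X \<in> indeps M \<Longrightarrow> finite X"
    "\<And>X Y. X \<in> indeps M \<Longrightarrow> Y \<subseteq> X \<Longrightarrow> Y \<in> indeps M"
    "\<And>X Y. X \<in> indeps M \<Longrightarrow> Y \<in> indeps M \<Longrightarrow> card X < card Y \<Longrightarrow> \<exists>e\<in>Y - X. insert e X \<in> indeps M"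
proof -
  show 1: "finite (ground M)" and "{} \<in> indeps M" and 2: "\<And>X. X \<in> indeps M \<Longrightarrow> X \<subseteq> ground M"
    using assms by (auto simp: matroid_def)
  show "finite X" if "X \<in> indeps M" for X
    using 1 2[OF that] by (rule finite_subset[rotated])
  show "Y \<in> indeps M" if "X \<in> indeps M" "Y \<subseteq> X" for X Y
    using assms that unfolding matroid_def by blast
  show "\<exists>e\<in>Y - X. insert e X \<in> indeps M" if "X \<in> indeps M" "Y \<in> indeps M" "card X < card Y" for X Y
    using assms that unfolding matroid_def by blast
qed

lemma rank_of_facts:
  assumes "matroid M"
  shows "Y \<in> indeps M \<Longrightarrow> Y \<subseteq> X \<Longrightarrow> card Y \<le> rank_of M X"
    and "\<exists>Y\<in>indeps M. Y \<subseteq> X \<and> card Y = rank_of M X"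
proof -
  let ?S = "card ` {Y \<in> indeps M. Y \<subseteq> X}"
  have "indeps M \<subseteq> Pow (ground M)" using matroidD(3)[OF assms] by blast
  then have fin: "finite ?S" using matroidD(1)[OF assms] finite_subset by fastforce
  then show "Y \<in> indeps M \<Longrightarrow> Y \<subseteq> X \<Longrightarrow> card Y \<le> rank_of M X"
    unfolding rank_of_def by (intro Max_ge) auto
  have "?S \<noteq> {}" using matroidD(2)[OF assms] by auto
  then have "rank_of M X \<in> ?S" unfolding rank_of_def using fin by (intro Max_in)
  then show "\<exists>Y\<in>indeps M. Y \<subseteq> X \<and> card Y = rank_of M X" by auto
qed

lemma card_le_matroid_rank: "matroid M \<Longrightarrow> Y \<in> indeps M \<Longrightarrow> card Y \<le> matroid_rank M"
  unfolding matroid_rank_def using rank_of_facts(1) matroidD(3) by blast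

lemma bases_of_nonempty: "matroid M \<Longrightarrow> \<exists>B. B \<in> bases_of M"
  unfolding bases_of_def matroid_rank_def using rank_of_facts(2)[of M "ground M"] by blast

lemma extend_indep:
  assumes M: "matroid M" and "I \<in> indeps M" and J: "J \<in> indeps M" and "card I \<le> card J"
  shows "\<exists>K\<in>indeps M. I \<subseteq> K \<and> K \<subseteq> I \<union> J \<and> card K = card J"
  using assms(2,4)
proof (induction "card J - card I" arbitrary: I)
  case (Suc d)
  then have "card I < card J" by simp
  then obtain e where e: "e \<in> J - I" "insert e I \<in> indeps M" using matroidD(6)[OF M Suc(3) J] by blast
  have "card (insert e I) = Suc (card I)" using e matroidD(4)[OF M Suc(3)] by simp
  then obtain K where "K \<in> indeps M" "insert e I \<subseteq> K" "K \<subseteq> insert e I \<union> J" "card K = card J"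
  proof -
    have "d = card J - card (insert e I)" "card (insert e I) \<le> card J"
      using Suc.hyps(2) \<open>card I < card J\<close> \<open>card (insert e I) = Suc (card I)\<close> by simp_all
    then show thesis using Suc.hyps(1)[of "insert e I"] e(2) that by blast
  qed
  then show ?case using e by (intro bexI[of _ K]) auto
qed auto

lemma indeps_eq_bases: "matroid M \<Longrightarrow> indeps M = {I. \<exists>B\<in>bases_of M. I \<subseteq> B}"
proof (intro set_eqI iffI CollectI)
  fix I assume M: "matroid M" and I: "I \<in> indeps M"
  obtain B where B: "B \<in> indeps M" "card B = matroid_rank M"
    using bases_of_nonempty[OF M] by (auto simp: bases_of_def)
  then show "\<exists>B\<in>bases_of M. I \<subseteq> B"
    using extend_indep[OF M I B(1)] card_le_matroid_rank[OF M I] by (auto simp: bases_of_def)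
next
  fix I assume "matroid M" "I \<in> {I. \<exists>B\<in>bases_of M. I \<subseteq> B}"
  then show "I \<in> indeps M" using matroidD(5)[of M] by (auto simp: bases_of_def)
qed

lemma bases_of_inject:
  assumes "matroid M" "matroid M'" "ground M = ground M'" "bases_of M = bases_of M'"
  shows "M = M'"
  using assms indeps_eq_bases by (metis prod_eqI)

lemma base_system_bases_of:
  assumes M: "matroid M"
  shows "base_system (ground M) (matroid_rank M) (bases_of M)"
proof
  let ?r = "matroid_rank M"
  show "finite (ground M)" using matroidD(1)[OF M] .
  obtain B where "B \<in> indeps M" "card B = ?r"
    using bases_of_nonempty[OF M] by (auto simp: bases_of_def)
  then show "?r \<le> card (ground M)"
    using matroidD(1,3)[OF M] by (metis card_mono)
  show "bases_of M \<subseteq> rsets (ground M) ?r"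
    using matroidD(3)[OF M] by (auto simp: bases_of_def rsets_def)
  fix B C x assume B: "B \<in> bases_of M" and C: "C \<in> bases_of M"
  have BC: "B \<in> indeps M" "C \<in> indeps M" "card B = ?r" "card C = ?r" "finite B" "finite C"
    using B C matroidD(4)[OF M] by (auto simp: bases_of_def)
  show "\<exists>y\<in>C - B. insert y (B - {x}) \<in> bases_of M" if x: "x \<in> B - C"
  proof -
    have I: "B - {x} \<in> indeps M" using matroidD(5)[OF M BC(1), of "B - {x}"] by simp
    have c: "Suc (card (B - {x})) = ?r" using x BC by (metis DiffD1 card_Suc_Diff1)
    then obtain y where y: "y \<in> C - (B - {x})" "insert y (B - {x}) \<in> indeps M"
      using matroidD(6)[OF M I BC(2)] BC(4) by auto
    have "card (insert y (B - {x})) = ?r" using y c BC(5) by simp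
    then show ?thesis using y x by (intro bexI[of _ y]) (auto simp: bases_of_def)
  qed
  show "\<exists>y\<in>B - C. insert x (B - {y}) \<in> bases_of M" if x: "x \<in> C - B"
  proof -
    \<comment> \<open>Extending (B \<inter> C) + x from \<open>B\<close> gives a basis that drops
      exactly one element of \<open>B\<close>, and this element is not in \<open>C\<close>.\<close>
    have I: "insert x (B \<inter> C) \<in> indeps M" using matroidD(5)[OF M BC(2), of "insert x (B \<inter> C)"] x by simp
    have "card (insert x (B \<inter> C)) \<le> card C" using x BC(6) by (intro card_mono) auto
    then obtain K where K: "K \<in> indeps M" "insert x (B \<inter> C) \<subseteq> K" "K \<subseteq> insert x (B \<inter> C) \<union> B" "card K = card B"
      using extend_indep[OF M I BC(1)] BC by auto
    have sub: "K \<subseteq> insert x B" using K by auto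
    have "card (insert x B) = Suc ?r" using x BC by simp
    then have "card (insert x B - K) = 1"
      using sub K(4) BC finite_subset[OF sub] by (simp add: card_Diff_subset)
    then obtain y where y: "insert x B - K = {y}" by (auto simp: card_1_singleton_iff)
    then have "y \<in> B - C" "K = insert x (B - {y})" using K(2) sub x by auto
    then show ?thesis using K BC by (auto simp: bases_of_def)
  qed
qed

text \<open>Isolation makes every X - x + y a basis. With a y outside \<open>X\<close> this shows
  that all proper subsets of \<open>X\<close> are independent; with an x inside \<open>X\<close>,
  that any new element raises the rank. The bounds on the rank provide such x and y.\<close>

lemma isolated_circuit_hyperplane:
  assumes M: "matroid M" and r: "0 < matroid_rank M" "matroid_rank M < card (ground M)"
    and X: "X \<in> isolated (ground M) (matroid_rank M) (bases_of M)"
  shows "X \<in> circuit_hyperplanes M"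
proof -
  let ?r = "matroid_rank M" and ?E = "ground M"
  have finE: "finite ?E" using matroidD(1)[OF M] .
  have XV: "X \<in> rsets ?E ?r" "X \<notin> bases_of M" using X by (auto simp: isolated_def)
  have Xf: "finite X" "card X = ?r" "X \<subseteq> ?E" using rsetsD[OF finE XV(1)] by auto
  have dep: "X \<notin> indeps M" using XV Xf by (auto simp: bases_of_def)
  have nb: "insert y (X - {x}) \<in> indeps M" if xy: "x \<in> X" "y \<in> ?E - X" for x y
  proof -
    have "card (insert y (X - {x})) = ?r" using xy Xf card_Suc_Diff1[of X x] by simp
    then have V: "insert y (X - {x}) \<in> rsets ?E ?r" using xy Xf by (auto simp: rsets_def)
    have "johnson (insert x (X - {x})) (insert y (X - {x}))" using xy by (intro johnson_insert) auto
    then have "johnson X (insert y (X - {x}))" using xy by (simp add: insert_absorb)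
    then have "insert y (X - {x}) \<in> bases_of M" using X V by (auto simp: isolated_def)
    then show ?thesis by (simp add: bases_of_def)
  qed
  have "X \<noteq> ?E" using r Xf by auto
  then obtain y0 where y0: "y0 \<in> ?E - X" using Xf by auto
  obtain x0 where x0: "x0 \<in> X" using r Xf by fastforce
  have "circuit M X"
    unfolding circuit_def
  proof (intro conjI allI impI)
    show "X \<subseteq> ?E" "X \<notin> indeps M" using Xf dep by auto
    fix D assume "D \<subset> X"
    then obtain x where "x \<in> X" "D \<subseteq> insert y0 (X - {x})" by blast
    then show "D \<in> indeps M" using matroidD(5)[OF M nb[OF _ y0]] by simp
  qed
  have Ix: "X - {x0} \<in> indeps M" using matroidD(5)[OF M nb[OF x0 y0], of "X - {x0}"] by (simp add: subset_insertI)
  have rX: "Suc (rank_of M X) = ?r"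
  proof -
    have "card (X - {x0}) \<le> rank_of M X" using rank_of_facts(1)[OF M Ix] by blast
    moreover have "Suc (card (X - {x0})) = ?r" using Xf x0 by (metis card_Suc_Diff1)
    moreover obtain Y where Y: "Y \<in> indeps M" "Y \<subseteq> X" "card Y = rank_of M X"
      using rank_of_facts(2)[OF M] by blast
    moreover have "Y \<noteq> X" using Y dep by auto
    then have "card Y < ?r" using Y Xf psubset_card_mono[of X Y] by auto
    ultimately show ?thesis by simp
  qed
  have "closure_of_set M X = X"
  proof (intro set_eqI iffI)
    fix e assume e: "e \<in> closure_of_set M X"
    show "e \<in> X"
    proof (rule ccontr)
      assume "e \<notin> X"
      then have eE: "e \<in> ?E - X" using e by (simp add: closure_of_set_def)
      have "card (insert e (X - {x0})) \<le> rank_of M (insert e X)"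
        using rank_of_facts(1)[OF M nb[OF x0 eE]] by blast
      moreover have "card (insert e (X - {x0})) = ?r" using eE x0 Xf card_Suc_Diff1[of X x0] by simp
      ultimately show False using e rX by (simp add: closure_of_set_def)
    qed
  next
    fix e assume "e \<in> X"
    then show "e \<in> closure_of_set M X" using Xf by (auto simp: closure_of_set_def insert_absorb)
  qed
  then have "hyperplane M X" using rX Xf by (simp add: hyperplane_def flat_def)
  then show ?thesis using \<open>circuit M X\<close> by (simp add: circuit_hyperplanes_def)
qed

section \<open>Sparse paving matroids and the lower bound for the number of matroids\<close>

lemma sparse_paving_matroid:
  assumes finE: "finite E" and r: "0 < r" and T: "T \<in> stable_sets johnson (rsets E r)"
  shows "matroid (E, {I. I \<subseteq> E \<and> card I \<le> r \<and> I \<notin> T})"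
proof -
  have Tr: "card X = r" if "X \<in> T" for X using that T by (auto simp: stable_sets_def rsets_def)
  have aug: "\<exists>e\<in>Y - X. card (insert e X) \<le> r \<and> insert e X \<notin> T"
    if X: "X \<subseteq> E" "card X \<le> r" "X \<notin> T" and Y: "Y \<subseteq> E" "card Y \<le> r" "Y \<notin> T" and lt: "card X < card Y" for X Y
  proof -
    have fin: "finite X" "finite Y" using X Y finE finite_subset by auto
    have "\<not> Y \<subseteq> X" using lt fin card_mono by (metis not_le)
    then obtain e where e: "e \<in> Y - X" by blast
    have ce: "card (insert e X) \<le> r" if "e \<in> Y - X" for e using that lt Y fin by simp
    \<comment> \<open>Only membership in \<open>T\<close> can block an augmentation. Two candidates
      e, f yield adjacent sets, of which the stable set \<open>T\<close> contains at most one; a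
      single candidate yields \<open>Y\<close> itself.\<close>
    show ?thesis
    proof (cases "Y - X = {e}")
      case True
      then have "Y \<subseteq> insert e X" by blast
      moreover have "card (insert e X) \<le> card Y" using e fin lt by simp
      ultimately have "insert e X = Y" using fin by (intro card_seteq[symmetric]) auto
      then show ?thesis using e Y by (intro bexI[of _ e]) auto
    next
      case False
      then obtain f where f: "f \<in> Y - X" "f \<noteq> e" using e by blast
      then have "johnson (insert e X) (insert f X)" using e by (intro johnson_insert) auto
      then have "insert e X \<notin> T \<or> insert f X \<notin> T" using T by (auto simp: stable_sets_def)
      then show ?thesis using ce[OF e] ce[OF f(1)] e f(1) by blast
    qed
  qed
  show ?thesis
    unfolding matroid_def fst_conv snd_conv
  proof (intro conjI ballI allI impI)
    show "{} \<in> {I. I \<subseteq> E \<and> card I \<le> r \<and> I \<notin> T}" using Tr[of "{}"] r by auto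
  next
    fix X Y assume X: "X \<in> {I. I \<subseteq> E \<and> card I \<le> r \<and> I \<notin> T}" and YX: "Y \<subseteq> X"
    have finX: "finite X" using X finE finite_subset by auto
    have le: "card Y \<le> card X" using card_mono[OF finX YX] .
    have "Y \<notin> T"
    proof
      assume "Y \<in> T"
      then have "card Y = card X" using Tr le X by fastforce
      then have "Y = X" using card_subset_eq[OF finX YX] by simp
      then show False using X \<open>Y \<in> T\<close> by simp
    qed
    then show "Y \<in> {I. I \<subseteq> E \<and> card I \<le> r \<and> I \<notin> T}" using X YX le by auto
  next
    fix X Y assume "X \<in> {I. I \<subseteq> E \<and> card I \<le> r \<and> I \<notin> T}" "Y \<in> {I. I \<subseteq> E \<and> card I \<le> r \<and> I \<notin> T}"
      "card X < card Y"
    then show "\<exists>e\<in>Y - X. insert e X \<in> {I. I \<subseteq> E \<and> card I \<le> r \<and> I \<notin> T}"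
      using aug[of X Y] by auto
  qed (use finE in auto)
qed

lemma card_stable_le_matroids:
  assumes "0 < r"
  shows "card (stable_sets johnson (rsets {1..n} r)) \<le> card (matroids_on n)"
proof (rule card_inj_on_le[OF _ _ finite_matroids_on])
  let ?f = "\<lambda>T. ({1..n}, {I. I \<subseteq> {1..n} \<and> card I \<le> r \<and> I \<notin> T})"
  show "?f ` stable_sets johnson (rsets {1..n} r) \<subseteq> matroids_on n"
    using sparse_paving_matroid[of "{1..n}" r] assms by (auto simp: matroids_on_def)
  show "inj_on ?f (stable_sets johnson (rsets {1..n} r))"
  proof (rule inj_onI)
    fix S T assume a: "S \<in> stable_sets johnson (rsets {1..n} r)" "T \<in> stable_sets johnson (rsets {1..n} r)" "?f S = ?f T"
    have rec: "R = {X \<in> rsets {1..n} r. X \<notin> snd (?f R)}" if "R \<in> stable_sets johnson (rsets {1..n} r)" for R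
      using that by (auto simp: stable_sets_def rsets_def)
    show "S = T" using rec[OF a(1)] rec[OF a(2)] unfolding a(3) by simp
  qed
qed

text \<open>The r-sets are coloured by the sum of their elements modulo n. Adjacent sets have sums
  differing by x - y with 0 < |x - y| < n, so each colour class is stable, and so is each of its
  subsets; a largest class has at least the average size.\<close>

lemma graham_sloane:
  assumes n: "0 < n"
  shows "2 powr (real (n choose r) / real n) \<le> real (card (stable_sets johnson (rsets {1..n} r)))"
proof -
  let ?V = "rsets {1..n} r" and ?f = "\<lambda>X. \<Sum>X mod n"
  have finV: "finite ?V" by (rule finite_rsets) simp
  have "\<exists>k<n. real (n choose r) / real n \<le> real (card {X \<in> ?V. ?f X = k})"
  proof (rule ccontr)
    assume "\<not> ?thesis"
    then have lt: "real (card {X \<in> ?V. ?f X = k}) < real (n choose r) / real n" if "k < n" for k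
      using that by force
    have "?V = (\<Union>k\<in>{..<n}. {X \<in> ?V. ?f X = k})" using n by auto
    then have "card ?V = (\<Sum>k<n. card {X \<in> ?V. ?f X = k})"
      using card_UN_disjoint[of "{..<n}" "\<lambda>k. {X \<in> ?V. ?f X = k}"] finV by auto
    then have "real (card ?V) = (\<Sum>k<n. real (card {X \<in> ?V. ?f X = k}))" by simp
    also have "\<dots> < (\<Sum>k<n. real (n choose r) / real n)"
      using lt n by (intro sum_strict_mono) auto
    also have "\<dots> = real (n choose r)" using n by simp
    finally show False by (simp add: card_rsets)
  qed
  then obtain k where k: "real (n choose r) / real n \<le> real (card {X \<in> ?V. ?f X = k})" by blast
  define C where "C = {X \<in> ?V. ?f X = k}"
  have finC: "finite C" using finV by (simp add: C_def)
  have "\<not> johnson X Y" if XY: "X \<in> C" "Y \<in> C" for X Y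
  proof
    assume "johnson X Y"
    then obtain P x y where xy: "X = insert x P" "Y = insert y P" "x \<notin> P" "y \<notin> P" "x \<noteq> y"
      by (rule johnsonE)
    have "finite X" "X \<subseteq> {1..n}" "Y \<subseteq> {1..n}"
      using XY rsetsD[of "{1..n}" X r] rsetsD[of "{1..n}" Y r] by (auto simp: C_def)
    then have P: "finite P" "x \<in> {1..n}" "y \<in> {1..n}" using xy by auto
    have "(x + \<Sum>P) mod n = (y + \<Sum>P) mod n" using XY xy P by (simp add: C_def)
    then have "(int x + int (\<Sum>P)) mod int n = (int y + int (\<Sum>P)) mod int n"
      by (metis of_nat_add of_nat_mod)
    then have "int n dvd int x - int y"
      by (metis add_diff_cancel_right mod_eq_dvd_iff)
    then have "\<bar>int n\<bar> \<le> \<bar>int x - int y\<bar>" using xy(5) by (intro dvd_imp_le_int) auto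
    then show False using P(2,3) by auto
  qed
  then have "Pow C \<subseteq> stable_sets johnson ?V" by (auto simp: stable_sets_def C_def)
  then have "card (Pow C) \<le> card (stable_sets johnson ?V)"
    using finite_stable_sets[OF finV] by (intro card_mono)
  then have le: "real (2 ^ card C) \<le> real (card (stable_sets johnson ?V))"
    unfolding card_Pow[OF finC] by (simp only: of_nat_le_iff)
  have "2 powr (real (n choose r) / real n) \<le> 2 powr real (card C)"
    using k unfolding C_def by (intro powr_mono) auto
  then have "2 powr (real (n choose r) / real n) \<le> real (2 ^ card C)" by (simp add: powr_realpow)
  then show ?thesis using le by (rule order_trans)
qed

text \<open>The extension of \<open>N\<close> by an element \<open>e\<close> placed freely in the flat spanned by \<open>S\<close>.\<close>

definition principal_ext :: "'a \<Rightarrow> 'a set \<Rightarrow> 'a setsys \<Rightarrow> 'a setsys" where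
  "principal_ext e S N = (insert e (ground N),
    indeps N \<union> insert e ` {I \<in> indeps N. \<exists>s\<in>S. s \<notin> I \<and> insert s I \<in> indeps N})"

lemma matroid_principal_ext:
  assumes N: "matroid N" and e: "e \<notin> ground N"
  shows "matroid (principal_ext e S N)"
proof -
  define A where "A = {I \<in> indeps N. \<exists>s\<in>S. s \<notin> I \<and> insert s I \<in> indeps N}"
  let ?I = "indeps N \<union> insert e ` A"
  have fin: "finite X" if "X \<in> indeps N" for X using matroidD(4)[OF N that] .
  have e': "e \<notin> X" if "X \<in> indeps N" for X using matroidD(3)[OF N that] e by auto
  have AN: "X \<in> indeps N" if "X \<in> A" for X using that by (simp add: A_def)
  have A: "X \<in> A" if "s \<in> S" "s \<notin> X" "insert s X \<in> indeps N" for s X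
    using that matroidD(5)[OF N that(3), of X] by (auto simp: A_def)
  have A_sub: "Y \<in> A" if X: "X \<in> A" and YX: "Y \<subseteq> X" for X Y
  proof -
    obtain s where s: "s \<in> S" "s \<notin> X" "insert s X \<in> indeps N" using X by (auto simp: A_def)
    show ?thesis using A[of s Y] s YX matroidD(5)[OF N s(3), of "insert s Y"] by auto
  qed
  note aug = matroidD(6)[OF N]
  have augI: "\<exists>x\<in>Y - X. insert x X \<in> ?I" if XY: "X \<in> ?I" "Y \<in> ?I" and lt: "card X < card Y" for X Y
  proof -
    consider (nn) "X \<in> indeps N" "Y \<in> indeps N"
      | (ne) J where "X \<in> indeps N" "J \<in> A" "Y = insert e J"
      | (en) I where "I \<in> A" "X = insert e I" "Y \<in> indeps N"
      | (ee) I J where "I \<in> A" "X = insert e I" "J \<in> A" "Y = insert e J"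
      using XY by auto
    then show ?thesis
    proof cases
      case nn
      then show ?thesis using aug[OF nn lt] by auto
    next
      case ne
      obtain s where s: "s \<in> S" "s \<notin> J" "insert s J \<in> indeps N" using ne(2) by (auto simp: A_def)
      have "card X < card (insert s J)"
        using lt ne(3) s(2) fin[OF AN[OF ne(2)]] e'[OF AN[OF ne(2)]] by simp
      then obtain z where z: "z \<in> insert s J - X" "insert z X \<in> indeps N"
        using aug[OF ne(1) s(3)] by blast
      show ?thesis
      proof (cases "z \<in> J")
        case True
        then show ?thesis using z ne(3) by (intro bexI[of _ z]) auto
      next
        case False
        then have "z = s" using z by simp
        then have "X \<in> A" using A[of s X] s(1) z by simp
        then show ?thesis using ne(3) e'[OF ne(1)] by (intro bexI[of _ e]) auto
      qed
    next
      case en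
      obtain s where s: "s \<in> S" "s \<notin> I" "insert s I \<in> indeps N" using en(1) by (auto simp: A_def)
      have "card (insert s I) < card Y"
        using lt en(2) s(2) fin[OF AN[OF en(1)]] e'[OF AN[OF en(1)]] by simp
      then obtain z where z: "z \<in> Y - insert s I" "insert z (insert s I) \<in> indeps N"
        using aug[OF s(3) en(3)] by blast
      have "insert z I \<in> A" using A[of s "insert z I"] s z by (auto simp: insert_commute)
      moreover have "z \<noteq> e" using z(1) e'[OF en(3)] by auto
      ultimately show ?thesis using z en(2) by (intro bexI[of _ z]) (auto simp: insert_commute)
    next
      case ee
      obtain s where s: "s \<in> S" "s \<notin> I" "insert s I \<in> indeps N" using ee(1) by (auto simp: A_def)
      obtain s' where s': "s' \<in> S" "s' \<notin> J" "insert s' J \<in> indeps N" using ee(3) by (auto simp: A_def)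
      have cIJ: "card I < card J"
        using lt ee(2,4) fin[OF AN[OF ee(1)]] e'[OF AN[OF ee(1)]] fin[OF AN[OF ee(3)]] e'[OF AN[OF ee(3)]] by simp
      have goal: ?thesis if w: "w \<in> J" "w \<notin> I" "insert w I \<in> A" for w
        using w ee e'[OF AN[OF ee(3)]] by (intro bexI[of _ w]) (auto simp: insert_commute)
      have "card (insert s I) < card (insert s' J)"
        using cIJ s(2) s'(2) fin[OF AN[OF ee(1)]] fin[OF AN[OF ee(3)]] by simp
      then obtain z where z: "z \<in> insert s' J - insert s I" "insert z (insert s I) \<in> indeps N"
        using aug[OF s(3) s'(3)] by blast
      show ?thesis
      proof (cases "z \<in> J")
        case True
        have "insert z I \<in> A" using A[of s "insert z I"] s z by (auto simp: insert_commute)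
        then show ?thesis using goal[of z] True z by simp
      next
        case False
        then have zs: "z = s'" using z by simp
        \<comment> \<open>The augmenting element z = s' is not in \<open>J\<close>, so another w
          from \<open>J\<close> is used. Augmenting I + w from I + s + s' adds s or s', both in
          \<open>S\<close>, which puts I + w into \<open>A\<close>.\<close>
        obtain w where w: "w \<in> J - I" "insert w I \<in> indeps N"
          using aug[OF AN[OF ee(1)] AN[OF ee(3)] cIJ] by blast
        have "card (insert w I) < card (insert z (insert s I))"
          using w z s(2) fin[OF AN[OF ee(1)]] by simp
        then obtain u where u: "u \<in> insert z (insert s I) - insert w I" "insert u (insert w I) \<in> indeps N"
          using aug[OF w(2) z(2)] by blast
        have "u \<in> S" using u(1) zs s s' by auto
        then have "insert w I \<in> A" using A[of u "insert w I"] u by simp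
        then show ?thesis using goal[of w] w by simp
      qed
    qed
  qed
  have herI: "Y \<in> ?I" if X: "X \<in> ?I" and YX: "Y \<subseteq> X" for X Y
  proof (cases "X \<in> indeps N")
    case True
    then show ?thesis using matroidD(5)[OF N True YX] by simp
  next
    case False
    then obtain I where I: "I \<in> A" "X = insert e I" using X by auto
    then have YI: "Y - {e} \<in> A" using A_sub[OF I(1), of "Y - {e}"] YX by auto
    show ?thesis
    proof (cases "e \<in> Y")
      case True
      then have "Y = insert e (Y - {e})" by auto
      then show ?thesis using YI by blast
    next
      case False
      then show ?thesis using AN[OF YI] by simp
    qed
  qed
  have "indeps N \<subseteq> Pow (ground N)" using matroidD(3)[OF N] by blast
  then have subI: "?I \<subseteq> Pow (insert e (ground N))" using AN by auto
  show ?thesis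
    unfolding matroid_def principal_ext_def A_def[symmetric] fst_conv snd_conv
  proof (intro conjI ballI allI impI)
    show "finite (insert e (ground N))" using matroidD(1)[OF N] by simp
    show "{} \<in> ?I" using matroidD(2)[OF N] by simp
    show "?I \<subseteq> Pow (insert e (ground N))" by (rule subI)
    show "Y \<in> ?I" if "X \<in> ?I" "Y \<subseteq> X" for X Y using that by (rule herI)
    show "\<exists>x\<in>Y - X. insert x X \<in> ?I" if "X \<in> ?I" "Y \<in> ?I" "card X < card Y" for X Y
      using that by (rule augI)
  qed
qed

text \<open>Each subset \<open>S\<close> of a fixed independent k-set \<open>B N\<close> gives a
  different principal extension. \<open>S\<close> is recovered because e can replace s in
  \<open>B N\<close> exactly when s is in \<open>S\<close>: an element of \<open>S\<close> outside B
  N - s can only be s.\<close>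

lemma card_extensions:
  assumes finE: "finite E" and e: "e \<in> E"
    and NN: "\<And>N. N \<in> NN \<Longrightarrow> matroid N \<and> ground N = E - {e} \<and> (\<exists>B\<in>indeps N. card B = k)"
  shows "card NN * 2 ^ k \<le> card {M. matroid M \<and> ground M = E}"
proof -
  define B where "B N = (SOME B. B \<in> indeps N \<and> card B = k)" for N :: "'a setsys"
  have B: "B N \<in> indeps N" "card (B N) = k" if "N \<in> NN" for N
    using NN[OF that] someI_ex[of "\<lambda>B. B \<in> indeps N \<and> card B = k"] by (auto simp: B_def)
  let ?M = "{M. matroid M \<and> ground M = E}"
  have "?M \<subseteq> {E} \<times> Pow (Pow E)" by (auto simp: matroid_def)
  then have finM: "finite ?M" by (rule finite_subset) (use finE in simp)
  have "NN \<subseteq> {E - {e}} \<times> Pow (Pow E)"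
  proof
    fix N assume "N \<in> NN"
    then have "matroid N" "ground N = E - {e}" using NN by auto
    then show "N \<in> {E - {e}} \<times> Pow (Pow E)"
      using matroidD(3)[of N] by (cases N) auto
  qed
  then have finN: "finite NN" by (rule finite_subset) (use finE in simp)
  have finB: "finite (B N)" if "N \<in> NN" for N using matroidD(4)[of N] NN[OF that] B[OF that] by blast
  have eN: "e \<notin> I" if "N \<in> NN" "I \<in> indeps N" for N I using matroidD(3)[of N I] NN[OF that(1)] that(2) by auto
  have recN: "indeps N = {I \<in> indeps (principal_ext e S N). e \<notin> I}" if "N \<in> NN" for N S
    using eN[OF that] by (auto simp: principal_ext_def)
  have recS: "S = {s \<in> B N. insert e (B N - {s}) \<in> indeps (principal_ext e S N)}" if N: "N \<in> NN" and S: "S \<subseteq> B N" for N S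
  proof (intro set_eqI iffI)
    fix s assume s: "s \<in> S"
    have "B N - {s} \<in> indeps N" using matroidD(5)[of N "B N"] NN[OF N] B[OF N] by blast
    moreover have "insert s (B N - {s}) \<in> indeps N" using s S B[OF N] by (simp add: insert_absorb subsetD)
    ultimately have "insert e (B N - {s}) \<in> indeps (principal_ext e S N)"
      unfolding principal_ext_def snd_conv
      using s by (intro UnI2 imageI CollectI conjI bexI[of _ s]) simp_all
    then show "s \<in> {s \<in> B N. insert e (B N - {s}) \<in> indeps (principal_ext e S N)}"
      using s S by auto
  next
    fix s assume "s \<in> {s \<in> B N. insert e (B N - {s}) \<in> indeps (principal_ext e S N)}"
    then have s: "s \<in> B N" "insert e (B N - {s}) \<in> indeps (principal_ext e S N)" by auto
    have "insert e (B N - {s}) \<notin> indeps N" using eN[OF N] by blast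
    then obtain I where I: "insert e (B N - {s}) = insert e I" "I \<in> indeps N" "\<exists>t\<in>S. t \<notin> I \<and> insert t I \<in> indeps N"
      using s(2) unfolding principal_ext_def snd_conv by blast
    have "e \<notin> I" "e \<notin> B N" using eN[OF N] I(2) B(1)[OF N] by auto
    then have "I = B N - {s}" using I(1) by (auto simp: insert_ident)
    then show "s \<in> S" using I(3) S by auto
  qed
  have "card NN * 2 ^ k = (\<Sum>N\<in>NN. card (Pow (B N)))"
    using finB B(2) by (simp add: card_Pow)
  also have "\<dots> = card (Sigma NN (\<lambda>N. Pow (B N)))" using finN finB by simp
  also have "\<dots> \<le> card ?M"
  proof (rule card_inj_on_le[OF _ _ finM])
    show "(\<lambda>(N, S). principal_ext e S N) ` Sigma NN (\<lambda>N. Pow (B N)) \<subseteq> ?M"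
    proof
      fix M assume "M \<in> (\<lambda>(N, S). principal_ext e S N) ` Sigma NN (\<lambda>N. Pow (B N))"
      then obtain N S where N: "N \<in> NN" and M: "M = principal_ext e S N" by auto
      have "matroid M" unfolding M using NN[OF N] by (intro matroid_principal_ext) auto
      moreover have "ground M = E" using NN[OF N] e by (auto simp: M principal_ext_def)
      ultimately show "M \<in> ?M" by blast
    qed
    show "inj_on (\<lambda>(N, S). principal_ext e S N) (Sigma NN (\<lambda>N. Pow (B N)))"
    proof (rule inj_onI)
      fix p q
      assume p: "p \<in> Sigma NN (\<lambda>N. Pow (B N))" and q: "q \<in> Sigma NN (\<lambda>N. Pow (B N))"
        and pq: "(case p of (N, S) \<Rightarrow> principal_ext e S N) = (case q of (N, S) \<Rightarrow> principal_ext e S N)"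
      obtain N S where N: "p = (N, S)" "N \<in> NN" "S \<subseteq> B N" using p by auto
      obtain N' S' where N': "q = (N', S')" "N' \<in> NN" "S' \<subseteq> B N'" using q by auto
      have eq: "principal_ext e S N = principal_ext e S' N'" using pq N(1) N'(1) by simp
      have "indeps N = indeps N'" using recN[OF N(2), of S] recN[OF N'(2), of S'] eq by simp
      moreover have "ground N = ground N'" using NN[OF N(2)] NN[OF N'(2)] by simp
      ultimately have NN': "N = N'" by (simp add: prod_eq_iff)
      then have "S = S'" using recS[OF N(2,3)] recS[OF N'(2,3)] eq by simp
      then show "p = q" using NN' N(1) N'(1) by simp
    qed
  qed
  finally show ?thesis .
qed

definition delete :: "'a \<Rightarrow> 'a setsys \<Rightarrow> 'a setsys" where
  "delete e M = (ground M - {e}, {I \<in> indeps M. e \<notin> I})"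

lemma matroid_delete:
  assumes M: "matroid M"
  shows "matroid (delete e M)"
  unfolding matroid_def delete_def fst_conv snd_conv
proof (intro conjI ballI allI impI)
  show "finite (ground M - {e})" using matroidD(1)[OF M] by simp
  show "{I \<in> indeps M. e \<notin> I} \<subseteq> Pow (ground M - {e})" using matroidD(3)[OF M] by auto
  show "{} \<in> {I \<in> indeps M. e \<notin> I}" using matroidD(2)[OF M] by simp
  show "Y \<in> {I \<in> indeps M. e \<notin> I}" if "X \<in> {I \<in> indeps M. e \<notin> I}" "Y \<subseteq> X" for X Y
    using that matroidD(5)[OF M, of X Y] by auto
  show "\<exists>f\<in>Y - X. insert f X \<in> {I \<in> indeps M. e \<notin> I}"
    if XY: "X \<in> {I \<in> indeps M. e \<notin> I}" "Y \<in> {I \<in> indeps M. e \<notin> I}" "card X < card Y" for X Y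
  proof -
    obtain f where "f \<in> Y - X" "insert f X \<in> indeps M" using matroidD(6)[OF M, of X Y] XY by auto
    then show ?thesis using XY by (intro bexI[of _ f]) auto
  qed
qed

text \<open>A matroid in which e is known to be a coloop, or known to be a loop, is determined by
  deleting e. The deletion still has an independent set of size r - 1, all that is guaranteed if e
  is a coloop, and hence 2^(r-1) extensions.\<close>

lemma card_constant_element:
  assumes e: "e \<in> {1..n}"
  shows "card {M \<in> matroids_on n. matroid_rank M = r \<and> (\<forall>B\<in>bases_of M. e \<in> B)} * 2 ^ (r - 1) \<le> card (matroids_on n)"
    and "card {M \<in> matroids_on n. matroid_rank M = r \<and> (\<forall>B\<in>bases_of M. e \<notin> B)} * 2 ^ (r - 1) \<le> card (matroids_on n)"
proof -
  have gen: "card A * 2 ^ (r - 1) \<le> card (matroids_on n)"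
    if A: "A \<subseteq> {M \<in> matroids_on n. matroid_rank M = r}" and inj: "inj_on (delete e) A" for A
  proof -
    have "card (delete e ` A) * 2 ^ (r - 1) \<le> card {M. matroid M \<and> ground M = {1..n}}"
    proof (rule card_extensions[OF _ e])
      fix N assume "N \<in> delete e ` A"
      then obtain M where M: "M \<in> A" "N = delete e M" by blast
      then have M': "matroid M" "ground M = {1..n}" "matroid_rank M = r" using A by (auto simp: matroids_on_def)
      obtain B where B: "B \<in> indeps M" "card B = r"
        using bases_of_nonempty[OF M'(1)] M'(3) by (auto simp: bases_of_def)
      have "r - 1 \<le> card (B - {e})" using B(2) by (simp add: card_Diff_singleton_if)
      then obtain C where C: "C \<subseteq> B - {e}" "card C = r - 1" by (meson obtain_subset_with_card_n)
      have "C \<in> indeps M" using matroidD(5)[OF M'(1) B(1), of C] C by auto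
      then have "C \<in> indeps N" using C M by (auto simp: delete_def)
      then show "matroid N \<and> ground N = {1..n} - {e} \<and> (\<exists>B\<in>indeps N. card B = r - 1)"
        using matroid_delete[OF M'(1), of e] M C M' by (auto simp: delete_def)
    qed simp
    then show ?thesis using card_image[OF inj] by (simp add: matroids_on_def)
  qed
  show "card {M \<in> matroids_on n. matroid_rank M = r \<and> (\<forall>B\<in>bases_of M. e \<in> B)} * 2 ^ (r - 1) \<le> card (matroids_on n)"
  proof (rule gen)
    have rec: "indeps M = {I. I - {e} \<in> indeps (delete e M)}"
      if M: "matroid M" and co: "\<forall>B\<in>bases_of M. e \<in> B" for M
    proof (intro set_eqI iffI CollectI)
      fix I assume "I \<in> indeps M"
      then show "I - {e} \<in> indeps (delete e M)" using matroidD(5)[OF M, of I "I - {e}"] by (auto simp: delete_def)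
    next
      fix I assume "I \<in> {I. I - {e} \<in> indeps (delete e M)}"
      then have "I - {e} \<in> indeps M" by (simp add: delete_def)
      then obtain B where B: "B \<in> bases_of M" "I - {e} \<subseteq> B" unfolding indeps_eq_bases[OF M] by blast
      then have "I \<subseteq> B" using co by auto
      then show "I \<in> indeps M" using B indeps_eq_bases[OF M] by blast
    qed
    show "inj_on (delete e) {M \<in> matroids_on n. matroid_rank M = r \<and> (\<forall>B\<in>bases_of M. e \<in> B)}"
    proof (rule inj_onI)
      fix M M' assume M: "M \<in> {M \<in> matroids_on n. matroid_rank M = r \<and> (\<forall>B\<in>bases_of M. e \<in> B)}"
        and M': "M' \<in> {M \<in> matroids_on n. matroid_rank M = r \<and> (\<forall>B\<in>bases_of M. e \<in> B)}"
        and eq: "delete e M = delete e M'"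
      have "indeps M = indeps M'" using rec[of M] rec[of M'] M M' eq by (simp add: matroids_on_def)
      then show "M = M'" using M M' by (auto simp: matroids_on_def intro: prod_eqI)
    qed
  qed auto
  show "card {M \<in> matroids_on n. matroid_rank M = r \<and> (\<forall>B\<in>bases_of M. e \<notin> B)} * 2 ^ (r - 1) \<le> card (matroids_on n)"
  proof (rule gen)
    have rec: "indeps M = indeps (delete e M)" if M: "matroid M" and lo: "\<forall>B\<in>bases_of M. e \<notin> B" for M
      using indeps_eq_bases[OF M] lo by (auto simp: delete_def)
    show "inj_on (delete e) {M \<in> matroids_on n. matroid_rank M = r \<and> (\<forall>B\<in>bases_of M. e \<notin> B)}"
    proof (rule inj_onI)
      fix M M' assume M: "M \<in> {M \<in> matroids_on n. matroid_rank M = r \<and> (\<forall>B\<in>bases_of M. e \<notin> B)}"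
        and M': "M' \<in> {M \<in> matroids_on n. matroid_rank M = r \<and> (\<forall>B\<in>bases_of M. e \<notin> B)}"
        and eq: "delete e M = delete e M'"
      have "indeps M = indeps M'" using rec[of M] rec[of M'] M M' eq by (simp add: matroids_on_def)
      then show "M = M'" using M M' by (auto simp: matroids_on_def intro: prod_eqI)
    qed
  qed auto
qed

section \<open>Small stable sets of the Johnson graph\<close>

text \<open>\<open>double_counting_degree\<close> solved for \<open>a\<close>: a vertex lies in
  \<open>k\<close> blocks, a block holds \<open>s\<close> vertices, and the edges number at most
  \<beta> a^2 (ordered pairs). Without edges the result is Nr / s, at most 2 Nc / n. The edge term
  Nr \<beta> is at most n^2 / 500, which is 2/125 of the lower bound n^2 / 8 for k s; this raises 2
  to 250/123, just below 51/25.\<close>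

lemma dense_set_bound:
  fixes k s n M Nr Nc a \<beta> :: real
  assumes n: "0 < n" and k: "n / 4 \<le> k" and s: "n / 2 \<le> s" and M: "M * s = Nr * k"
    and N: "0 < Nc" "Nr \<le> Nc" "0 \<le> Nr" and a: "0 < a"
    and deg: "(k * a)\<^sup>2 \<le> M * (k * a + a * (\<beta> * a))" and \<beta>: "\<beta> = n\<^sup>2 / (500 * Nc)"
  shows "a \<le> 51 / 25 * Nc / n"
proof -
  have pos: "0 < k" "0 < s" using n k s by auto
  have "a * (k\<^sup>2 * a) \<le> a * (M * (k + \<beta> * a))"
    using deg by (simp add: power2_eq_square algebra_simps)
  then have "k\<^sup>2 * a \<le> M * (k + \<beta> * a)" using a by simp
  then have "(k\<^sup>2 * a) * s \<le> (M * (k + \<beta> * a)) * s" using pos by (intro mult_right_mono) auto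
  also have "\<dots> = (M * s) * (k + \<beta> * a)" by simp
  also have "\<dots> = k * (Nr * (k + \<beta> * a))" unfolding M by simp
  finally have "k * (k * s * a) \<le> k * (Nr * (k + \<beta> * a))" by (simp add: power2_eq_square mult_ac)
  then have "k * s * a \<le> Nr * (k + \<beta> * a)" by (rule mult_left_le_imp_le) (rule pos)
  then have 1: "k * s * a \<le> Nr * k + Nr * \<beta> * a" by (simp add: algebra_simps)
  have "Nr * \<beta> \<le> Nc * \<beta>" using N \<beta> by (intro mult_right_mono) auto
  also have "\<dots> = n\<^sup>2 / 500" using N \<beta> by simp
  also have "\<dots> \<le> 2 / 125 * (k * s)"
  proof -
    have "n / 4 * (n / 2) \<le> k * s" using n k s by (intro mult_mono) auto
    then show ?thesis by (simp add: power2_eq_square)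
  qed
  finally have "Nr * \<beta> * a \<le> 2 / 125 * (k * s) * a" using a by (intro mult_right_mono) auto
  with 1 have "123 / 125 * (k * s * a) \<le> Nr * k" by simp
  then have "k * (123 / 125 * (s * a)) \<le> k * Nr" by (simp add: mult_ac)
  then have "123 / 125 * (s * a) \<le> Nr" by (rule mult_left_le_imp_le) (rule pos)
  then have 2: "123 / 125 * (s * a) \<le> Nc" using N by simp
  have "n / 2 * a \<le> s * a" using s a by (intro mult_right_mono) auto
  then have "123 / 250 * (n * a) \<le> Nc" using 2 by simp
  then have "a * n \<le> 51 / 25 * Nc" using N by (simp add: mult.commute)
  then show ?thesis using n by (simp add: field_simps)
qed

text \<open>Blocks are taken on the side where they are large: (r+1)-sets, holding r + 1 vertices,
  if r is at least n / 2, and (r-1)-sets, holding n - r + 1 vertices, otherwise. So \<open>s\<close>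
  is at least n / 2 in \<open>dense_set_bound\<close>.\<close>

lemma johnson_high_degree:
  assumes finE: "finite E" and n: "card E = n" "0 < n" and r: "n \<le> 4 * r" "4 * r \<le> 3 * n"
    and A: "A \<subseteq> rsets E r"
  defines "Nc \<equiv> real (n choose (n div 2))"
  assumes big: "51 / 25 * Nc / real n < real (card A)"
  shows "\<exists>v\<in>A. (real n)\<^sup>2 / (500 * Nc) * real (card A) \<le> real (card {u\<in>A. u = v \<or> johnson v u})"
proof (rule ccontr)
  define \<beta> where "\<beta> = (real n)\<^sup>2 / (500 * Nc)"
  assume "\<not> ?thesis"
  then have small: "real (card {u\<in>A. u = v \<or> johnson v u}) \<le> \<beta> * real (card A)" if "v \<in> A" for v
    using that by (force simp: \<beta>_def)
  have finA: "finite A" using A finite_rsets[OF finE] finite_subset by blast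
  have Nc0: "0 < Nc" by (simp add: Nc_def)
  have "0 \<le> 51 / 25 * Nc / real n" using Nc0 by simp
  then have a0: "0 < real (card A)" using big by linarith
  have sub: "X \<in> rsets E r" if "X \<in> A" for X using that A by auto
  have deg: "real (\<Sum>X\<in>A. card {Y\<in>A. Y \<noteq> X \<and> johnson X Y}) \<le> real (card A) * (\<beta> * real (card A))"
  proof -
    have "card {Y\<in>A. Y \<noteq> X \<and> johnson X Y} \<le> card {u\<in>A. u = X \<or> johnson X u}" for X
      using finA by (intro card_mono) auto
    then have "real (card {Y\<in>A. Y \<noteq> X \<and> johnson X Y}) \<le> \<beta> * real (card A)" if "X \<in> A" for X
      using small[OF that] by (meson of_nat_mono order_trans)
    then have "(\<Sum>X\<in>A. real (card {Y\<in>A. Y \<noteq> X \<and> johnson X Y})) \<le> (\<Sum>X\<in>A. \<beta> * real (card A))"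
      by (rule sum_mono)
    then show ?thesis by simp
  qed
  have conv: "(real k * real (card A))\<^sup>2 \<le> real M * (real k * real (card A) + real (card A) * (\<beta> * real (card A)))"
    if "(k * card A)\<^sup>2 \<le> M * (k * card A + (\<Sum>X\<in>A. card {Y\<in>A. Y \<noteq> X \<and> johnson X Y}))" for k M
  proof -
    have "real ((k * card A)\<^sup>2) \<le> real (M * (k * card A + (\<Sum>X\<in>A. card {Y\<in>A. Y \<noteq> X \<and> johnson X Y})))"
      using that by (simp only: of_nat_le_iff)
    also have "\<dots> \<le> real M * (real k * real (card A) + real (card A) * (\<beta> * real (card A)))"
      unfolding of_nat_mult of_nat_add using deg by (intro mult_left_mono add_left_mono) auto
    finally show ?thesis by simp
  qed
  have Nr: "real (n choose r) \<le> Nc" by (simp add: Nc_def binomial_maximum)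
  have "real (card A) \<le> 51 / 25 * Nc / real n"
  proof (cases "n \<le> 2 * r")
    case True
    have d: "((n - r) * card A)\<^sup>2 \<le> card (rsets E (Suc r)) *
        ((n - r) * card A + (\<Sum>X\<in>A. card {Y\<in>A. Y \<noteq> X \<and> johnson X Y}))"
      by (rule double_counting_degree[where blk = "\<lambda>X. (\<lambda>x. insert x X) ` (E - X)"])
        (use finA finite_rsets[OF finE] johnson_upper_blocks[OF finE sub sub] n in auto)
    have id: "Suc r * (n choose Suc r) = (n - r) * (n choose r)"
      by (metis binomial_absorb_comp binomial_absorption)
    show ?thesis
    proof (rule dense_set_bound[OF _ _ _ _ Nc0 Nr _ a0 conv[OF d] \<beta>_def])
      show "real n / 4 \<le> real (n - r)" using r by simp
      show "real n / 2 \<le> real (Suc r)" using True by simp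
      show "real (card (rsets E (Suc r))) * real (Suc r) = real (n choose r) * real (n - r)"
        using id n by (metis card_rsets finE mult.commute of_nat_mult)
    qed (use n in auto)
  next
    case False
    have d: "(r * card A)\<^sup>2 \<le> card (rsets E (r - 1)) *
        (r * card A + (\<Sum>X\<in>A. card {Y\<in>A. Y \<noteq> X \<and> johnson X Y}))"
      by (rule double_counting_degree[where blk = "\<lambda>X. (\<lambda>x. X - {x}) ` X"])
        (use finA finite_rsets[OF finE] johnson_lower_blocks[OF finE sub sub] in auto)
    have r0: "0 < r" using r n by simp
    have id: "r * (n choose r) = (n - (r - 1)) * (n choose (r - 1))"
      using r0 by (metis Suc_diff_1 binomial_absorb_comp binomial_absorption)
    show ?thesis
    proof (rule dense_set_bound[OF _ _ _ _ Nc0 Nr _ a0 conv[OF d] \<beta>_def])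
      show "real n / 4 \<le> real r" using r by simp
      show "real n / 2 \<le> real (n - (r - 1))" using False by simp
      show "real (card (rsets E (r - 1))) * real (n - (r - 1)) = real (n choose r) * real r"
        using id n by (metis card_rsets finE mult.commute of_nat_mult)
    qed (use n in auto)
  qed
  then show False using big by simp
qed

text \<open>The weight 1/9 is p / (1 - p) for p = 1/10, the best choice for counting subsets that
  fill a tenth of an m-set with m about 2 N / n. The last factor has exponent of order N (ln n)^2 /
  n^2 plus a term 2 ln n, negligible against N / n.\<close>

lemma card_small_stable_sets:
  assumes finE: "finite E" and n: "card E = n" "0 < n" and r: "n \<le> 4 * r" "4 * r \<le> 3 * n"
  defines "Nc \<equiv> real (n choose (n div 2))"
  assumes large: "(real n)\<^sup>2 \<le> 500 * Nc"
  shows "real (card {T \<in> stable_sets johnson (rsets E r). card T \<le> k})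
    \<le> 9 ^ k * (10 / 9) powr (51 / 25 * Nc / real n)
      * exp (Nc / (real n)\<^sup>2 + 2 * ln (real n) * (500 * ln (real n) * Nc / (real n)\<^sup>2 + 1))"
proof -
  let ?V = "rsets E r" and ?m = "51 / 25 * Nc / real n"
  define \<beta> where "\<beta> = (real n)\<^sup>2 / (500 * Nc)"
  define w where "w = 1 / (real n)\<^sup>2"
  \<comment> \<open>After \<open>L\<close> steps that each remove a fraction \<beta>, at most N / n
    vertices remain, since (1 - \<beta>)^L is at most exp (- \<beta> L). \<open>L\<close> is about
    500 N ln n / n^2, and every step costs 1 / w = n^2.\<close>
  define L where "L = nat \<lceil>ln (real n) / \<beta>\<rceil>"
  have Nc0: "0 < Nc" by (simp add: Nc_def)
  have \<beta>: "0 < \<beta>" "\<beta> \<le> 1" using large n Nc0 by (auto simp: \<beta>_def)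
  have n1: "1 \<le> real n" using n by simp
  have w: "0 < w" "w \<le> 1" using n1 by (auto simp: w_def)
  have finV: "finite ?V" using finE by (rule finite_rsets)
  have cV: "real (card ?V) \<le> Nc" using card_rsets_le_central[OF finE, of r] n by (simp add: Nc_def)
  have ln0: "0 \<le> ln (real n) / \<beta>" using n1 \<beta> by simp
  have L: "ln (real n) / \<beta> \<le> real L" "real L \<le> ln (real n) / \<beta> + 1"
    using ln0 by (simp_all add: L_def)
  have "(1 - \<beta>) ^ L \<le> exp (- \<beta>) ^ L"
    using \<beta> exp_ge_add_one_self[of "- \<beta>"] by (intro power_mono) auto
  also have "\<dots> = exp (- (\<beta> * real L))" by (simp add: exp_of_nat_mult[symmetric] mult.commute)
  also have "\<dots> \<le> exp (- ln (real n))" using L \<beta> by (simp add: field_simps)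
  also have "\<dots> = 1 / real n" using n by (simp add: exp_minus divide_inverse)
  finally have "real (card ?V) * (1 - \<beta>) ^ L \<le> Nc * (1 / real n)"
    using cV \<beta> Nc0 by (intro mult_mono) auto
  also have "\<dots> \<le> ?m" using Nc0 n1 by (simp add: field_simps)
  finally have start: "real (card ?V) * (1 - \<beta>) ^ L \<le> ?m" .
  have "(\<Sum>T\<in>stable_sets johnson ?V. (1 / 9) ^ card T)
      \<le> (1 + 1 / 9) powr ?m * ((1 + w) ^ card ?V * (1 / w) ^ L)"
  proof (rule stable_sets_weight_le[OF finV _ _ w _ _ start])
    fix A assume "A \<subseteq> ?V" "?m < real (card A)"
    then show "\<exists>v\<in>A. \<beta> * real (card A) \<le> real (card {u \<in> A. u = v \<or> johnson v u})"
      using johnson_high_degree[OF finE n r] by (simp add: \<beta>_def Nc_def)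
  qed auto
  also have "\<dots> \<le> (10 / 9) powr ?m * exp (Nc / (real n)\<^sup>2 + 2 * ln (real n) * (500 * ln (real n) * Nc / (real n)\<^sup>2 + 1))"
  proof -
    have "(1 + w) ^ card ?V \<le> exp w ^ card ?V"
      using w exp_ge_add_one_self[of w] by (intro power_mono) auto
    also have "\<dots> = exp (w * real (card ?V))" by (simp add: exp_of_nat_mult[symmetric] mult.commute)
    also have "\<dots> \<le> exp (Nc / (real n)\<^sup>2)" using cV n1 by (simp add: w_def divide_right_mono)
    finally have 1: "(1 + w) ^ card ?V \<le> exp (Nc / (real n)\<^sup>2)" .
    have "1 / w = exp (2 * ln (real n))" using n by (simp add: w_def exp_double)
    then have "(1 / w) ^ L = exp (2 * ln (real n) * real L)" by (simp add: exp_of_nat_mult[symmetric] mult.commute)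
    also have "\<dots> \<le> exp (2 * ln (real n) * (500 * ln (real n) * Nc / (real n)\<^sup>2 + 1))"
    proof -
      have "ln (real n) / \<beta> = 500 * ln (real n) * Nc / (real n)\<^sup>2" by (simp add: \<beta>_def)
      then show ?thesis using L(2) n1 by (simp add: mult_left_mono)
    qed
    finally have 2: "(1 / w) ^ L \<le> exp (2 * ln (real n) * (500 * ln (real n) * Nc / (real n)\<^sup>2 + 1))" .
    have "(1 + w) ^ card ?V * (1 / w) ^ L \<le> exp (Nc / (real n)\<^sup>2) * exp (2 * ln (real n) * (500 * ln (real n) * Nc / (real n)\<^sup>2 + 1))"
      using 1 2 w by (intro mult_mono) auto
    then show ?thesis by (simp add: exp_add mult_left_mono)
  qed
  finally have Z: "(\<Sum>T\<in>stable_sets johnson ?V. (1 / 9) ^ card T)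
      \<le> (10 / 9) powr ?m * exp (Nc / (real n)\<^sup>2 + 2 * ln (real n) * (500 * ln (real n) * Nc / (real n)\<^sup>2 + 1))" .
  let ?S = "{T \<in> stable_sets johnson ?V. card T \<le> k}"
  have "real (card ?S) * (1 / 9) ^ k = (\<Sum>T\<in>?S. (1 / 9) ^ k)" by simp
  also have "\<dots> \<le> (\<Sum>T\<in>?S. (1 / 9) ^ card T)"
    by (intro sum_mono power_decreasing) auto
  also have "\<dots> \<le> (\<Sum>T\<in>stable_sets johnson ?V. (1 / 9) ^ card T)"
    using finite_stable_sets[OF finV] by (intro sum_mono2) auto
  also note Z
  finally show ?thesis by (simp add: power_one_over field_simps)
qed

section \<open>Counting the matroids of middle rank\<close>

lemma card_le_fibres:
  fixes b :: real
  assumes "finite A" "finite K" "f ` A \<subseteq> K" "\<And>k. k \<in> K \<Longrightarrow> real (card {x\<in>A. f x = k}) \<le> b"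
  shows "real (card A) \<le> real (card K) * b"
proof -
  have "A = (\<Union>k\<in>K. {x\<in>A. f x = k})" using assms(3) by auto
  then have "card A \<le> (\<Sum>k\<in>K. card {x\<in>A. f x = k})"
    using card_UN_le[OF assms(2), of "\<lambda>k. {x\<in>A. f x = k}"] by simp
  then have "real (card A) \<le> real (\<Sum>k\<in>K. card {x\<in>A. f x = k})" by (simp only: of_nat_le_iff)
  also have "\<dots> = (\<Sum>k\<in>K. real (card {x\<in>A. f x = k}))" by simp
  also have "\<dots> \<le> (\<Sum>k\<in>K. b)" using assms(4) by (rule sum_mono)
  finally show ?thesis by simp
qed

definition generic_bad :: "nat \<Rightarrow> nat \<Rightarrow> nat setsys set" where
  "generic_bad n r = {M \<in> matroids_on n. matroid_rank M = r \<and>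
     (\<forall>e\<in>{1..n}. \<exists>B\<in>bases_of M. e \<notin> B) \<and> (\<forall>e\<in>{1..n}. \<exists>B\<in>bases_of M. e \<in> B) \<and>
     ch_density M < 1 / (5 * real n)}"

lemma card_isolated_le:
  assumes n: "0 < n" and r: "0 < r" "r < n" and M: "M \<in> generic_bad n r"
  shows "card (isolated {1..n} r (bases_of M)) \<le> nat \<lfloor>real (n choose (n div 2)) / (5 * real n)\<rfloor>"
proof -
  have M': "matroid M" "ground M = {1..n}" "matroid_rank M = r" "ch_density M < 1 / (5 * real n)"
    using M by (auto simp: generic_bad_def matroids_on_def)
  have "isolated {1..n} r (bases_of M) \<subseteq> circuit_hyperplanes M"
    using isolated_circuit_hyperplane[OF M'(1)] M' r by auto
  moreover have "finite (circuit_hyperplanes M)"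
  proof (rule finite_subset)
    show "circuit_hyperplanes M \<subseteq> Pow {1..n}"
      using M'(2) by (auto simp: circuit_hyperplanes_def circuit_def)
  qed simp
  ultimately have 1: "card (isolated {1..n} r (bases_of M)) \<le> card (circuit_hyperplanes M)"
    by (intro card_mono)
  have pos: "0 < real (n choose r)" using r by simp
  have "real (card (circuit_hyperplanes M)) / real (n choose r) < 1 / (5 * real n)"
    using M'(4) by (simp add: ch_density_def M'(2,3))
  then have "real (card (circuit_hyperplanes M)) \<le> real (n choose r) / (5 * real n)"
    using pos n by (simp add: field_simps)
  also have "\<dots> \<le> real (n choose (n div 2)) / (5 * real n)"
    by (intro divide_right_mono) (auto simp: binomial_maximum)
  finally show ?thesis using 1 by (simp add: le_nat_floor order_trans[OF of_nat_mono])
qed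

text \<open>The fibres of the description \<open>f\<close> are \<open>indistinct\<close> classes,
  bounded by \<open>card_le_stable_sets\<close>. The factors in front count the descriptions: unions
  of at most \<open>q\<close> certificates, and two families of sets of size at most
  \<open>a\<close>.\<close>

lemma card_generic_bad:
  fixes \<theta> t w :: real
  assumes n: "0 < n" and r: "n \<le> 4 * r" "4 * r \<le> 3 * n"
    and par: "0 < \<theta>" "2 \<le> t" "0 < a" "0 < w" "w \<le> 1"
  defines "Nc \<equiv> real (n choose (n div 2))"
  defines "q \<equiv> Nc / \<theta> + Nc * (8 * \<theta> / t\<^sup>2 + (2 * real r + \<theta> + 2 * t * real n) / (real r)\<^sup>2) / real a"
  shows "real (card (generic_bad n r)) \<le>
    exp (5 * w * Nc + q * ln (1 / w)) * (2 ^ card {D. D \<subseteq> {1..n} \<and> card D \<le> a})\<^sup>2 *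
    (real (card (matroids_on n)) / 2 ^ c
     + real (card {T \<in> stable_sets johnson (rsets {1..n} r). card T \<le> nat \<lfloor>Nc / (5 * real n)\<rfloor> + c}))"
proof -
  let ?E = "{1..n}"
  have r0: "0 < r" "r < n" using r n by auto
  have cE: "card ?E = n" "finite ?E" by auto
  define F where "F = certs1 ?E r \<union> certs2 ?E r"
  define Sm where "Sm = {D. D \<subseteq> ?E \<and> card D \<le> a}"
  define good where "good M I \<longleftrightarrow> I \<subseteq> F \<and> \<Union>I \<inter> bases_of M = {} \<and> real (card I) \<le> q \<and>
    (\<forall>U\<in>certs1 ?E r. U \<inter> bases_of M = {} \<longrightarrow> card (U - \<Union>I) \<le> a)" for M I
  define cert where "cert M = (SOME I. good M I)" for M
  have BM: "base_system ?E r (bases_of M)" if "M \<in> generic_bad n r" for M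
    using base_system_bases_of[of M] that by (auto simp: generic_bad_def matroids_on_def)
  have cert: "good M (cert M)" if M: "M \<in> generic_bad n r" for M
  proof -
    interpret base_system ?E r "bases_of M" by (rule BM[OF M])
    obtain I where "good M I"
      using certificates[OF r0(1) par(1-3)] unfolding good_def F_def q_def Nc_def cE(1) by metis
    then show ?thesis unfolding cert_def by (rule someI)
  qed
  define trans where "trans M = {D \<in> Sm. \<forall>B\<in>bases_of M. B \<inter> D \<noteq> {}}" for M :: "nat setsys"
  define dep where "dep M = {D \<in> Sm. \<forall>B\<in>bases_of M. \<not> D \<subseteq> B}" for M :: "nat setsys"
  \<comment> \<open>Of the chosen certificates only the union is recorded, since the fibre uses only
    the known nonbases.\<close>
  define f where "f M = (\<Union>(cert M), trans M, dep M)" for M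
  define KK where "KK = (Union ` {I. I \<subseteq> F \<and> real (card I) \<le> q}) \<times> Pow Sm \<times> Pow Sm"
  have finF: "finite F" unfolding F_def using finite_certs[OF cE(2)] by blast
  have finI: "finite {I. I \<subseteq> F \<and> real (card I) \<le> q}"
    by (rule finite_subset[of _ "Pow F"]) (use finF in auto)
  have finS: "finite Sm" by (rule finite_subset[of _ "Pow ?E"]) (auto simp: Sm_def)
  have finK: "finite KK" using finI finS by (simp add: KK_def)
  have finA: "finite (generic_bad n r)"
    by (rule finite_subset[OF _ finite_matroids_on[of n]]) (auto simp: generic_bad_def)
  have img: "f ` generic_bad n r \<subseteq> KK"
    using cert by (auto simp: f_def KK_def good_def trans_def dep_def)
  define b where "b = real (card (matroids_on n)) / 2 ^ c
     + real (card {T \<in> stable_sets johnson (rsets ?E r). card T \<le> nat \<lfloor>Nc / (5 * real n)\<rfloor> + c})"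
  have fib: "real (card {M \<in> generic_bad n r. f M = k}) \<le> b" for k
  proof -
    let ?A = "{M \<in> generic_bad n r. f M = k}"
    define Kn where "Kn = fst k"
    have Aeq: "\<Union>(cert M) = Kn" "trans M = fst (snd k)" "dep M = snd (snd k)" if "M \<in> ?A" for M
      using that by (auto simp: f_def Kn_def)
    \<comment> \<open>\<open>k\<close> is arbitrary here, so \<open>Kn\<close> need not consist of
      r-sets; the intersection ensures it and loses nothing inside \<open>up\<close> and
      \<open>dn\<close>.\<close>
    have ind: "indistinct ?E r a (bases_of ` ?A) (Kn \<inter> rsets ?E r)"
    proof (rule indistinct.intro)
      fix Bs assume "Bs \<in> bases_of ` ?A"
      then obtain M where M: "M \<in> ?A" "Bs = bases_of M" by blast
      then have G: "good M (cert M)" "\<Union>(cert M) = Kn" using cert Aeq by auto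
      show "base_system ?E r Bs" using BM M by simp
      show "Kn \<inter> rsets ?E r \<inter> Bs = {}" using G M by (auto simp: good_def)
      have diff: "U - (Kn \<inter> rsets ?E r) = U - \<Union>(cert M)" if "U \<subseteq> rsets ?E r" for U
        using that G(2) by auto
      show "card (up ?E r P - (Kn \<inter> rsets ?E r)) \<le> a"
        if "P \<subseteq> ?E" "Suc (card P) = r" "up ?E r P \<inter> Bs = {}" for P
      proof -
        have "up ?E r P \<in> certs1 ?E r" using that by (auto simp: certs1_def rsets_def)
        moreover have "up ?E r P \<subseteq> rsets ?E r" by (auto simp: up_def)
        ultimately show ?thesis using G(1) that(3) M(2) diff by (simp add: good_def)
      qed
      show "card (dn ?E r Q - (Kn \<inter> rsets ?E r)) \<le> a"
        if "Q \<subseteq> ?E" "card Q = Suc r" "dn ?E r Q \<inter> Bs = {}" for Q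
      proof -
        have "dn ?E r Q \<in> certs1 ?E r" using that by (auto simp: certs1_def rsets_def)
        moreover have "dn ?E r Q \<subseteq> rsets ?E r" by (auto simp: dn_def)
        ultimately show ?thesis using G(1) that(3) M(2) diff by (simp add: good_def)
      qed
      show "\<exists>B\<in>Bs. e \<notin> B" "\<exists>B\<in>Bs. e \<in> B" if "e \<in> ?E" for e
        using M that by (auto simp: generic_bad_def)
    next
      fix Bs Cs D assume h: "Bs \<in> bases_of ` ?A" "Cs \<in> bases_of ` ?A" "D \<subseteq> ?E" "card D \<le> a"
      obtain M M' where M: "M \<in> ?A" "Bs = bases_of M" "M' \<in> ?A" "Cs = bases_of M'" using h by blast
      have D: "D \<in> Sm" using h by (simp add: Sm_def)
      have eq: "trans M = trans M'" "dep M = dep M'" using Aeq[OF M(1)] Aeq[OF M(3)] by auto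
      show "\<forall>B\<in>Cs. B \<inter> D \<noteq> {}" if "\<forall>B\<in>Bs. B \<inter> D \<noteq> {}"
      proof -
        have "D \<in> trans M" using that D M(2) by (simp add: trans_def)
        then have "D \<in> trans M'" using eq(1) by simp
        then show ?thesis using M(4) by (simp add: trans_def)
      qed
      show "\<forall>B\<in>Cs. \<not> D \<subseteq> B" if "\<forall>B\<in>Bs. \<not> D \<subseteq> B"
      proof -
        have "D \<in> dep M" using that D M(2) by (simp add: dep_def)
        then have "D \<in> dep M'" using eq(2) by simp
        then show ?thesis using M(4) by (simp add: dep_def)
      qed
    qed (use r0 in auto)
    have "inj_on bases_of ?A"
    proof (rule inj_onI)
      fix M M' assume "M \<in> ?A" "M' \<in> ?A" "bases_of M = bases_of M'"
      then show "M = M'"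
        by (intro bases_of_inject) (simp_all add: generic_bad_def matroids_on_def)
    qed
    then have "real (card ?A) = real (card (bases_of ` ?A))" by (simp add: card_image)
    also have "\<dots> \<le> real (card (stable_sets johnson (rsets ?E r))) / 2 ^ c
      + real (card {T \<in> stable_sets johnson (rsets ?E r). card T \<le> nat \<lfloor>Nc / (5 * real n)\<rfloor> + c})"
    proof (rule indistinct.card_le_stable_sets[OF ind])
      fix Bs assume "Bs \<in> bases_of ` ?A"
      then show "card (isolated ?E r Bs) \<le> nat \<lfloor>Nc / (5 * real n)\<rfloor>"
        using card_isolated_le[OF n r0] by (auto simp: Nc_def)
    qed
    also have "\<dots> \<le> b"
      using card_stable_le_matroids[OF r0(1), of n] by (simp add: b_def divide_right_mono)
    finally show ?thesis .
  qed
  have b0: "0 \<le> b" by (simp add: b_def)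
  have "real (card (generic_bad n r)) \<le> real (card KK) * b"
    by (rule card_le_fibres[OF finA finK img fib])
  also have "\<dots> \<le> (exp (5 * w * Nc + q * ln (1 / w)) * (2 ^ card Sm)\<^sup>2) * b"
  proof (rule mult_right_mono[OF _ b0])
    have N0: "0 \<le> Nc" by (simp add: Nc_def)
    have q0: "0 \<le> q" unfolding q_def using N0 par by simp
    have cF: "w * real (card F) \<le> 5 * w * Nc"
      using card_certs[OF cE(2), of r] par unfolding F_def Nc_def cE(1) by (simp add: mult_left_mono)
    have "real (card (Union ` {I. I \<subseteq> F \<and> real (card I) \<le> q})) \<le> real (card {I. I \<subseteq> F \<and> real (card I) \<le> q})"
      using finI by (simp add: card_image_le)
    also have "\<dots> \<le> exp (w * real (card F) + q * ln (1 / w))"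
      using card_small_subsets[OF finF par(4,5) q0] .
    also have "\<dots> \<le> exp (5 * w * Nc + q * ln (1 / w))" using cF by simp
    finally have "real (card (Union ` {I. I \<subseteq> F \<and> real (card I) \<le> q})) * (2 ^ card Sm * 2 ^ card Sm)
      \<le> exp (5 * w * Nc + q * ln (1 / w)) * (2 ^ card Sm * 2 ^ card Sm)"
      by (intro mult_right_mono) auto
    then show "real (card KK) \<le> exp (5 * w * Nc + q * ln (1 / w)) * (2 ^ card Sm)\<^sup>2"
      using finS by (simp add: KK_def card_cartesian_product card_Pow power2_eq_square)
  qed
  finally show ?thesis unfolding b_def Sm_def .
qed

section \<open>Asymptotics\<close>

abbreviation central :: "nat \<Rightarrow> real" where
  "central n \<equiv> real (n choose (n div 2))"

lemma ln2_ge_half: "1 / 2 \<le> ln (2::real)"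
proof -
  have "exp 1 \<le> (2::real) ^ 2" using exp_le by simp
  then have "1 \<le> ln ((2::real) ^ 2)" by (subst ln_ge_iff) auto
  also have "ln ((2::real) ^ 2) = 2 * ln 2" by (subst ln_realpow) auto
  finally show ?thesis by simp
qed

lemma two_pow_le_central: "2 ^ n \<le> (real n + 1) * central n"
proof -
  have "2 ^ n = (\<Sum>k\<le>n. real (n choose k))"
    using choose_row_sum[of n] by (metis of_nat_numeral of_nat_power of_nat_sum)
  also have "\<dots> \<le> (\<Sum>k\<le>n. central n)" by (intro sum_mono) (simp add: binomial_maximum)
  finally show ?thesis by (simp add: algebra_simps)
qed

text \<open>Binomial theorem with weight 1/3 = p / (1 - p) for p = 1/4; up to polynomial factors it
  is sharp at i = n / 4.\<close>

lemma binomial_le_four_thirds: "real (n choose i) \<le> (4 / 3) ^ n * 3 ^ i"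
proof (cases "i \<le> n")
  case True
  have "real (n choose i) * (1 / 3) ^ i \<le> (\<Sum>k\<le>n. real (n choose k) * (1 / 3) ^ k)"
    using True by (intro member_le_sum) auto
  also have "\<dots> = (1 / 3 + 1) ^ n" by (subst binomial_ring) simp
  finally show ?thesis by (simp add: power_one_over field_simps)
qed (simp add: binomial_eq_0)

text \<open>The left side is 2 to the power h(1/4) n, and h(1/4) is about 0.811; numerically,
  (4/3)^8 times 9 is below 2^7.\<close>

lemma powr_seven_eighths: "(4 / 3) powr real n * 3 powr (real n / 4) \<le> 2 powr (7 * real n / 8)"
proof -
  have "(4 / 3) powr real n * 3 powr (real n / 4) = ((4 / 3) ^ 8) powr (real n / 8) * (3 ^ 2) powr (real n / 8)"
  proof -
    have "(4 / 3) powr real n = ((4 / 3) powr 8) powr (real n / 8)"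
      "3 powr (real n / 4) = (3 powr 2) powr (real n / 8)" by (simp_all only: powr_powr) simp_all
    moreover have "(4 / 3 :: real) powr 8 = (4 / 3) ^ 8" "(3::real) powr 2 = 3 ^ 2"
      by (rule powr_numeral, simp)+
    ultimately show ?thesis by (simp only:)
  qed
  also have "\<dots> = ((4 / 3) ^ 8 * 3 ^ 2) powr (real n / 8)" by (simp only: powr_mult)
  also have "\<dots> \<le> (2 ^ 7) powr (real n / 8)"
    by (intro powr_mono2) (simp_all add: power_divide)
  also have "\<dots> = 2 powr (7 * real n / 8)"
  proof -
    have "(2::real) ^ 7 = 2 powr 7" by (rule powr_numeral[symmetric]) simp
    then show ?thesis by (simp only: powr_powr) simp
  qed
  finally show ?thesis .
qed

text \<open>Used twice: to record all small cocircuits and circuits at negligible cost, and to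
  discard the ranks outside the middle half. The power n^4 covers the polynomial losses.\<close>

lemma eventually_small_binomials:
  "\<forall>\<^sub>F n in sequentially. \<forall>i. 4 * i \<le> n \<longrightarrow> real n ^ 4 * real (n choose i) \<le> central n"
proof -
  have "\<forall>\<^sub>F n::nat in sequentially. real n ^ 4 * (real n + 1) * 2 powr (7 * real n / 8) \<le> 2 powr real n"
    by real_asymp
  then show ?thesis
  proof eventually_elim
    case (elim n)
    show ?case
    proof (intro allI impI)
      fix i assume i: "4 * i \<le> n"
      have "(3::real) ^ i = 3 powr real i" by (simp add: powr_realpow)
      also have "\<dots> \<le> 3 powr (real n / 4)" using i by (intro powr_mono) auto
      finally have "(4 / 3) ^ n * 3 ^ i \<le> (4 / 3) powr real n * 3 powr (real n / 4)"
        by (simp add: powr_realpow)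
      then have "real (n choose i) \<le> 2 powr (7 * real n / 8)"
        using binomial_le_four_thirds[of n i] powr_seven_eighths[of n] by linarith
      then have "(real n ^ 4 * (real n + 1)) * real (n choose i)
          \<le> (real n ^ 4 * (real n + 1)) * 2 powr (7 * real n / 8)"
        by (intro mult_left_mono) auto
      also have "\<dots> \<le> 2 powr real n" using elim by simp
      also have "\<dots> \<le> (real n + 1) * central n" using two_pow_le_central[of n] by (simp add: powr_realpow)
      finally have "(real n + 1) * (real n ^ 4 * real (n choose i)) \<le> (real n + 1) * central n"
        by (simp add: mult_ac)
      then show "real n ^ 4 * real (n choose i) \<le> central n"
        by (rule mult_left_le_imp_le) simp
    qed
  qed
qed

lemma card_subsets_upto:
  fixes b :: real
  assumes "\<And>i. i \<le> a \<Longrightarrow> real (n choose i) \<le> b"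
  shows "real (card {D. D \<subseteq> {1..n} \<and> card D \<le> a}) \<le> (real a + 1) * b"
proof -
  have eq: "{D. D \<subseteq> {1..n} \<and> card D \<le> a} = (\<Union>i\<in>{..a}. rsets {1..n} i)"
    by (auto simp: rsets_def)
  have "card {D. D \<subseteq> {1..n} \<and> card D \<le> a} \<le> (\<Sum>i\<le>a. card (rsets {1..n} i))"
    unfolding eq by (rule card_UN_le) simp
  then have "real (card {D. D \<subseteq> {1..n} \<and> card D \<le> a}) \<le> real (\<Sum>i\<le>a. card (rsets {1..n} i))"
    by (simp only: of_nat_le_iff)
  also have "\<dots> = (\<Sum>i\<le>a. real (n choose i))" by (simp add: card_rsets)
  also have "\<dots> \<le> (\<Sum>i\<le>a. b)" using assms by (intro sum_mono) auto
  finally show ?thesis by (simp add: algebra_simps)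
qed

text \<open>\<open>2 h(1/10) < 1\<close> for the binary entropy \<open>h\<close>: this is where the constant \<open>1/5\<close> comes from.\<close>

lemma entropy_bound:
  fixes Y :: real
  assumes "0 \<le> Y"
  shows "9 powr (41 * Y) * (10 / 9) powr (408 * Y) \<le> 2 powr (195 * Y)"
proof -
  have "9 powr (41 * Y) * (10 / 9) powr (408 * Y) = (9 ^ 41) powr Y * ((10 / 9) ^ 408) powr Y"
  proof -
    have "9 powr (41 * Y) = (9 powr 41) powr Y" "(10 / 9) powr (408 * Y) = ((10 / 9) powr 408) powr Y"
      by (simp_all only: powr_powr)
    moreover have "(9 :: real) powr 41 = 9 ^ 41" "(10 / 9 :: real) powr 408 = (10 / 9) ^ 408"
      by (rule powr_numeral, simp)+
    ultimately show ?thesis by (simp only:)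
  qed
  also have "\<dots> = (9 ^ 41 * (10 / 9) ^ 408) powr Y" by (simp only: powr_mult)
  also have "\<dots> \<le> (2 ^ 195) powr Y"
    using assms by (intro powr_mono2) (simp_all add: power_divide)
  also have "\<dots> = 2 powr (195 * Y)"
  proof -
    have "(2::real) ^ 195 = 2 powr 195" by (rule powr_numeral[symmetric]) simp
    then show ?thesis by (simp only: powr_powr)
  qed
  finally show ?thesis .
qed

lemma two_powr_le_card_matroids:
  assumes "2 \<le> n"
  shows "2 powr (central n / real n) \<le> real (card (matroids_on n))"
proof -
  have "card (stable_sets johnson (rsets {1..n} (n div 2))) \<le> card (matroids_on n)"
    using assms by (intro card_stable_le_matroids) auto
  then have "real (card (stable_sets johnson (rsets {1..n} (n div 2)))) \<le> real (card (matroids_on n))"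
    by (simp only: of_nat_le_iff)
  moreover have "2 powr (central n / real n) \<le> real (card (stable_sets johnson (rsets {1..n} (n div 2))))"
    using assms by (intro graham_sloane) auto
  ultimately show ?thesis by (rule order_trans[rotated])
qed

text \<open>The parameters are \<theta> = n^(5/4), t = n^(3/4) and w = n^(-5/4). With
  \<open>r\<close> and \<open>a\<close> of order n the main terms of \<open>q\<close> are N /
  \<theta>, N \<theta> / (n t^2) and N t / n^2; these exponents balance them at N n^(-5/4), which
  remains \<open>o(N / n)\<close> after multiplication by ln (1 / w).\<close>

lemma eventually_errors:
  "\<forall>\<^sub>F n in sequentially. 64 \<le> n \<and> 2 \<le> real n powr (3/4) \<and>
     5 * real n powr (-5/4) + (real n powr (-5/4) + (8 * real n powr (-1/4)
       + 16 * (2 * real n + real n powr (5/4) + 2 * real n powr (7/4)) / (real n)\<^sup>2) * 16 / real n) * (5/4 * ln (real n))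
       \<le> 1 / (1000 * real n) \<and>
     1 / (real n)\<^sup>2 + 1000 * (ln (real n))\<^sup>2 / (real n)\<^sup>2 \<le> 1 / (2000 * real n) \<and>
     2 * ln (real n) \<le> 2 ^ n / (real n * (real n + 1)) / 2000 \<and>
     (real n)\<^sup>2 \<le> 500 * (2 ^ n / (real n + 1))"
  by (intro eventually_conj; real_asymp)

text \<open>Budget with X = N / n: descriptions cost a factor exp (X/1000 + X/2000). Matroids with
  at least \<open>c\<close> nontrivial classes gain 2^(-c), about exp (- Y ln 2), where Y ln 2 is at
  least X / 400. The others gain 2^(-5 Y) against the total, and lose another exp (X/1000) in the
  Kleitman--Winston error.\<close>

lemma eventually_card_generic_bad:
  "\<forall>\<^sub>F n in sequentially. \<forall>r. n \<le> 4 * r \<and> 4 * r \<le> 3 * n \<longrightarrow>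
     real (card (generic_bad n r)) \<le> 3 * exp (- (central n / real n) / 1000) * real (card (matroids_on n))"
  using eventually_small_binomials eventually_errors
proof eventually_elim
  case (elim n)
  show ?case
  proof (intro allI impI)
    fix r assume r: "n \<le> 4 * r \<and> 4 * r \<le> 3 * n"
    define X where "X = central n / real n"
    \<comment> \<open>Unit of account X / 200: circuit-hyperplanes contribute 40 and nontrivial
      classes 1, so stable sets have size at most 41 Y; the exponent 51/25 X is 408 Y;
      \<open>entropy_bound\<close> then uses 195 of the 200 units in 2^X.\<close>
    define Y where "Y = X / 200"
    define m where "m = real (card (matroids_on n))"
    define a where "a = n div 8"
    define w where "w = real n powr (-5/4)"
    define c where "c = nat \<lfloor>Y\<rfloor>"
    have n: "64 \<le> n" "0 < real n" using elim by auto
    have N0: "0 < central n" by simp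
    have X0: "0 < X" using n N0 by (simp add: X_def)
    have Xn: "central n = X * real n" using n by (simp add: X_def)
    have Xge: "2 ^ n / (real n * (real n + 1)) \<le> X"
    proof -
      have "2 ^ n / (real n * (real n + 1)) \<le> ((real n + 1) * central n) / (real n * (real n + 1))"
        using two_pow_le_central[of n] n by (intro divide_right_mono) auto
      also have "\<dots> = X" using n by (simp add: X_def)
      finally show ?thesis .
    qed
    have a: "0 < a" "real n / 16 \<le> real a" "a + 1 \<le> n"
      using n(1) by (auto simp: a_def)
    have w: "0 < w" "w \<le> 1" using n powr_mono[of "-5/4" 0 "real n"] by (auto simp: w_def)
    define q where "q = central n / (real n powr (5/4)) + central n * (8 * real n powr (5/4) / (real n powr (3/4))\<^sup>2
      + (2 * real r + real n powr (5/4) + 2 * real n powr (3/4) * real n) / (real r)\<^sup>2) / real a"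
    have t2: "2 \<le> real n powr (3/4)" using elim by blast
    have bad: "real (card (generic_bad n r)) \<le> exp (5 * w * central n + q * ln (1 / w))
        * (2 ^ card {D. D \<subseteq> {1..n} \<and> card D \<le> a})\<^sup>2
        * (m / 2 ^ c + real (card {T \<in> stable_sets johnson (rsets {1..n} r). card T \<le> nat \<lfloor>central n / (5 * real n)\<rfloor> + c}))"
      unfolding q_def m_def by (rule card_generic_bad) (use n r t2 a w in auto)
    \<comment> \<open>The two factors 16 come from r \<ge> n / 4, squared, and from a \<ge> n /
      16.\<close>
    have q: "q \<le> central n * (real n powr (-5/4) + (8 * real n powr (-1/4)
       + 16 * (2 * real n + real n powr (5/4) + 2 * real n powr (7/4)) / (real n)\<^sup>2) * 16 / real n)"
    proof -
      have 1: "central n / (real n powr (5/4)) = central n * real n powr (-5/4)"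
        using n by (simp add: powr_minus_divide)
      have "(real n powr (3/4))\<^sup>2 = real n powr (3/2)"
        by (simp add: power2_eq_square flip: powr_add)
      moreover have "real n powr (5/4) / real n powr (3/2) = real n powr (-1/4)"
        unfolding powr_diff[symmetric] by simp
      ultimately have 2: "8 * real n powr (5/4) / (real n powr (3/4))\<^sup>2 = 8 * real n powr (-1/4)"
        by (simp only: times_divide_eq_right[symmetric])
      have "real n powr (3/4) * real n powr 1 = real n powr (7/4)"
        unfolding powr_add[symmetric] by simp
      then have 7: "real n powr (3/4) * real n = real n powr (7/4)" using n by simp
      have "(2 * real r + real n powr (5/4) + 2 * real n powr (3/4) * real n) / (real r)\<^sup>2
        \<le> (2 * real n + real n powr (5/4) + 2 * real n powr (7/4)) / (real n / 4)\<^sup>2"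
        using r n 7 by (intro frac_le power_mono) (auto simp: mult.assoc)
      also have "\<dots> = 16 * (2 * real n + real n powr (5/4) + 2 * real n powr (7/4)) / (real n)\<^sup>2"
        by (simp add: power_divide)
      finally have 3: "8 * real n powr (5/4) / (real n powr (3/4))\<^sup>2
        + (2 * real r + real n powr (5/4) + 2 * real n powr (3/4) * real n) / (real r)\<^sup>2
        \<le> 8 * real n powr (-1/4) + 16 * (2 * real n + real n powr (5/4) + 2 * real n powr (7/4)) / (real n)\<^sup>2"
        (is "?l \<le> ?R") using 2 by simp
      have "central n * ?l / real a \<le> central n * ?R / (real n / 16)"
        using 3 a n by (intro frac_le mult_left_mono) (auto intro!: mult_nonneg_nonneg add_nonneg_nonneg divide_nonneg_nonneg)
      also have "\<dots> = central n * (?R * 16 / real n)" by simp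
      finally have "q \<le> central n * real n powr (-5/4) + central n * (?R * 16 / real n)"
        unfolding q_def 1 by simp
      then show ?thesis by (simp only: distrib_left)
    qed
    have e1: "5 * w * central n + q * ln (1 / w) \<le> X / 1000"
    proof -
      define Q where "Q = real n powr (-5/4) + (8 * real n powr (-1/4)
       + 16 * (2 * real n + real n powr (5/4) + 2 * real n powr (7/4)) / (real n)\<^sup>2) * 16 / real n"
      have lw: "ln (1 / w) = 5/4 * ln (real n)" using n by (simp add: w_def ln_div ln_powr)
      have l0: "0 \<le> 5/4 * ln (real n)" using n by simp
      have "5 * w * central n + q * ln (1 / w) \<le> 5 * w * central n + (central n * Q) * (5/4 * ln (real n))"
        unfolding lw using q l0 unfolding Q_def by (intro add_left_mono mult_right_mono) auto
      also have "\<dots> = central n * (5 * real n powr (-5/4) + Q * (5/4 * ln (real n)))"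
        by (simp add: w_def algebra_simps)
      also have "\<dots> \<le> central n * (1 / (1000 * real n))"
        using elim(2) unfolding Q_def by (intro mult_left_mono) auto
      also have "\<dots> = X / 1000" by (simp add: X_def)
      finally show ?thesis .
    qed
    have e2: "(2 ^ card {D. D \<subseteq> {1..n} \<and> card D \<le> a})\<^sup>2 \<le> exp (X / 2000)"
    proof -
      define S where "S = card {D. D \<subseteq> {1..n} \<and> card D \<le> a}"
      have "real (n choose i) \<le> central n / real n ^ 4" if "i \<le> a" for i
      proof -
        have "4 * i \<le> n" using that by (simp add: a_def)
        then have "real n ^ 4 * real (n choose i) \<le> central n" using elim(1) by blast
        then show ?thesis using n by (simp add: pos_le_divide_eq mult.commute)
      qed
      then have "real S \<le> (real a + 1) * (central n / real n ^ 4)"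
        unfolding S_def by (rule card_subsets_upto)
      also have "\<dots> \<le> real n * (central n / real n ^ 4)"
        using a(3) by (intro mult_right_mono) auto
      also have "\<dots> = X / (real n)\<^sup>2"
        using n by (simp add: Xn power2_eq_square power4_eq_xxxx)
      also have "\<dots> \<le> X / 4000"
      proof -
        have "64 * 64 \<le> real n * real n" using n by (intro mult_mono) auto
        then show ?thesis using X0 n by (intro divide_left_mono) (auto simp: power2_eq_square)
      qed
      finally have S: "real S \<le> X / 4000" .
      have "(2::real) \<le> exp 1" using exp_ge_add_one_self[of 1] by simp
      then have "(2::real) ^ (2 * S) \<le> exp 1 ^ (2 * S)" by (intro power_mono) auto
      also have "\<dots> = exp (2 * real S)" by (simp flip: exp_of_nat_mult)
      also have "\<dots> \<le> exp (X / 2000)" using S by simp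
      finally show ?thesis unfolding S_def[symmetric] by (simp add: power_mult[symmetric] mult.commute)
    qed
    have e3: "real (card {T \<in> stable_sets johnson (rsets {1..n} r). card T \<le> nat \<lfloor>central n / (5 * real n)\<rfloor> + c})
      \<le> m * exp (- 5 * Y * ln 2) * exp (X / 1000)"
    proof -
      define k where "k = nat \<lfloor>central n / (5 * real n)\<rfloor> + c"
      have Y0: "0 \<le> Y" using X0 by (simp add: Y_def)
      have "real c \<le> Y" using Y0 by (simp add: c_def)
      moreover have "real (nat \<lfloor>central n / (5 * real n)\<rfloor>) \<le> central n / (5 * real n)" using N0 n by simp
      moreover have "central n / (5 * real n) = 40 * Y" by (simp add: Y_def X_def)
      ultimately have k: "real k \<le> 41 * Y" unfolding k_def of_nat_add by linarith
      have "(9::real) ^ k = 9 powr real k" by (simp add: powr_realpow)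
      also have "\<dots> \<le> 9 powr (41 * Y)" using k by (intro powr_mono) auto
      finally have k9: "(9::real) ^ k \<le> 9 powr (41 * Y)" .
      have m408: "51 / 25 * central n / real n = 408 * Y" by (simp add: Y_def X_def)
      have err: "central n / (real n)\<^sup>2 + 2 * ln (real n) * (500 * ln (real n) * central n / (real n)\<^sup>2 + 1) \<le> X / 1000"
      proof -
        have "central n / (real n)\<^sup>2 + 2 * ln (real n) * (500 * ln (real n) * central n / (real n)\<^sup>2 + 1)
          = central n * (1 / (real n)\<^sup>2 + 1000 * (ln (real n))\<^sup>2 / (real n)\<^sup>2) + 2 * ln (real n)"
          by (simp add: power2_eq_square algebra_simps)
        also have "\<dots> \<le> central n * (1 / (2000 * real n)) + X / 2000"
        proof (intro add_mono mult_left_mono)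
          have "2 * ln (real n) \<le> 2 ^ n / (real n * (real n + 1)) / 2000" using elim(2) by blast
          also have "\<dots> \<le> X / 2000" using Xge by (rule divide_right_mono) simp
          finally show "2 * ln (real n) \<le> X / 2000" .
        qed (use elim(2) in auto)
        also have "\<dots> = X / 1000" by (simp add: X_def)
        finally show ?thesis .
      qed
      have large: "(real n)\<^sup>2 \<le> 500 * central n"
      proof -
        have "2 ^ n / (real n + 1) \<le> central n"
          using two_pow_le_central[of n] by (simp add: pos_divide_le_eq mult.commute)
        moreover have "(real n)\<^sup>2 \<le> 500 * (2 ^ n / (real n + 1))" using elim(2) by blast
        ultimately show ?thesis by linarith
      qed
      have "real (card {T \<in> stable_sets johnson (rsets {1..n} r). card T \<le> k})
        \<le> 9 ^ k * (10 / 9) powr (408 * Y)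
          * exp (central n / (real n)\<^sup>2 + 2 * ln (real n) * (500 * ln (real n) * central n / (real n)\<^sup>2 + 1))"
        unfolding m408[symmetric] by (rule card_small_stable_sets) (use n r large in auto)
      also have "\<dots> \<le> 9 powr (41 * Y) * (10 / 9) powr (408 * Y) * exp (X / 1000)"
        using k9 err by (intro mult_mono) auto
      also have "\<dots> \<le> 2 powr (195 * Y) * exp (X / 1000)"
        using entropy_bound[OF Y0] by (intro mult_right_mono) auto
      also have "2 powr (195 * Y) = 2 powr X * exp (- 5 * Y * ln 2)"
        by (simp add: Y_def powr_def algebra_simps flip: exp_add)
      also have "\<dots> \<le> m * exp (- 5 * Y * ln 2)"
        using two_powr_le_card_matroids[of n] n by (intro mult_right_mono) (auto simp: m_def X_def)
      finally show ?thesis by (simp add: k_def mult_right_mono)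
    qed
    have e4: "m / 2 ^ c \<le> m * (2 * exp (- Y * ln 2))"
    proof -
      have "Y - 1 \<le> real c" by (simp add: c_def) linarith
      then have "2 powr (Y - 1) \<le> 2 powr real c" by (intro powr_mono) auto
      then have "exp (Y * ln 2) / 2 \<le> 2 ^ c" by (simp add: powr_diff powr_realpow) (simp add: powr_def)
      then have "m / 2 ^ c \<le> m / (exp (Y * ln 2) / 2)"
        by (intro divide_left_mono) (auto simp: m_def)
      also have "m / (exp z / 2) = m * (2 * exp (- z))" for z
        by (simp add: exp_minus field_simps)
      finally show ?thesis unfolding mult_minus_left .
    qed
    have "real (card (generic_bad n r)) \<le> exp (X / 1000) * exp (X / 2000)
        * (m * (2 * exp (- Y * ln 2)) + m * exp (- 5 * Y * ln 2) * exp (X / 1000))"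
      by (rule order_trans[OF bad]) (intro mult_mono add_mono e2 e3 e4, use e1 in \<open>auto simp: m_def\<close>)
    also have "\<dots> = m * (2 * exp (3 * X / 2000 - Y * ln 2) + exp (5 * X / 2000 - 5 * Y * ln 2))"
      by (simp add: algebra_simps flip: exp_add)
    \<comment> \<open>The first exponent is tight, 3/2000 - 1/400 = -1/1000; the second has
      slack.\<close>
    also have "\<dots> \<le> m * (2 * exp (- X / 1000) + exp (- X / 1000))"
    proof -
      have "1 / 2 \<le> ln (2::real)" by (rule ln2_ge_half)
      then have "Y * (1 / 2) \<le> Y * ln 2" using X0 by (intro mult_left_mono) (auto simp: Y_def)
      then have "X / 400 \<le> Y * ln 2" by (simp add: Y_def)
      then show ?thesis using X0 by (intro mult_left_mono add_mono) (auto simp: m_def)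
    qed
    finally show "real (card (generic_bad n r)) \<le> 3 * exp (- (central n / real n) / 1000) * real (card (matroids_on n))"
      by (simp add: X_def m_def algebra_simps)
  qed
qed

section \<open>Adding up the exceptions over all ranks\<close>

lemma card_rank_le:
  assumes "r \<le> n"
  shows "real (card {M \<in> matroids_on n. matroid_rank M = r}) \<le> 2 powr real (n choose r)"
proof -
  have "card {M \<in> matroids_on n. matroid_rank M = r} \<le> card (Pow (rsets {1..n} r))"
  proof (rule card_inj_on_le)
    show "inj_on bases_of {M \<in> matroids_on n. matroid_rank M = r}"
    proof (rule inj_onI)
      fix M M' assume "M \<in> {M \<in> matroids_on n. matroid_rank M = r}"
        "M' \<in> {M \<in> matroids_on n. matroid_rank M = r}" "bases_of M = bases_of M'"
      then show "M = M'" by (intro bases_of_inject) (simp_all add: matroids_on_def)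
    qed
    show "bases_of ` {M \<in> matroids_on n. matroid_rank M = r} \<subseteq> Pow (rsets {1..n} r)"
      using base_system.bases[OF base_system_bases_of] by (fastforce simp: matroids_on_def)
  qed (simp add: finite_rsets)
  then have "real (card {M \<in> matroids_on n. matroid_rank M = r}) \<le> real (card (Pow (rsets {1..n} r)))"
    by (simp only: of_nat_le_iff)
  then show ?thesis by (simp add: card_Pow finite_rsets card_rsets powr_realpow)
qed

definition bad :: "nat \<Rightarrow> nat setsys set" where
  "bad n = {M \<in> matroids_on n. ch_density M < 1 / (5 * real n)}"

text \<open>In the middle ranks a bad matroid is generic or has a coloop or a loop; for each of the
  n elements the latter are a fraction of at most 2^(-(r-1)), with r at least n / 4, of all
  matroids.\<close>

lemma card_bad_rank_le:
  assumes n: "64 \<le> n" and r: "r \<le> n"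
    and sb: "\<forall>i. 4 * i \<le> n \<longrightarrow> real n ^ 4 * real (n choose i) \<le> central n"
    and gb: "\<forall>r. n \<le> 4 * r \<and> 4 * r \<le> 3 * n \<longrightarrow>
      real (card (generic_bad n r)) \<le> 3 * exp (- (central n / real n) / 1000) * real (card (matroids_on n))"
  shows "real (card {M \<in> bad n. matroid_rank M = r}) \<le>
    (3 * exp (- (central n / real n) / 1000) + 4 * real n * 2 powr (- real n / 4)) * real (card (matroids_on n))"
proof (cases "n \<le> 4 * r \<and> 4 * r \<le> 3 * n")
  case True
  define m where "m = real (card (matroids_on n))"
  define C where "C e = {M \<in> matroids_on n. matroid_rank M = r \<and> (\<forall>B\<in>bases_of M. e \<in> B)}" for e
  define L where "L e = {M \<in> matroids_on n. matroid_rank M = r \<and> (\<forall>B\<in>bases_of M. e \<notin> B)}" for e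
  have sub: "{M \<in> bad n. matroid_rank M = r} \<subseteq> generic_bad n r \<union> (\<Union>e\<in>{1..n}. C e \<union> L e)"
    by (auto simp: bad_def generic_bad_def C_def L_def)
  have fin: "finite (C e)" "finite (L e)" "finite (generic_bad n r)" for e
    using finite_matroids_on[of n] by (auto simp: C_def L_def generic_bad_def)
  have pw: "2 powr (real n / 4) / 2 \<le> (2::real) ^ (r - 1)"
  proof -
    have "2 powr (real n / 4) \<le> 2 powr real r" using True by (intro powr_mono) auto
    also have "\<dots> = 2 * 2 ^ (r - 1)"
      using True n by (simp add: powr_realpow power_Suc[symmetric] del: power_Suc)
    finally show ?thesis by simp
  qed
  have gen: "real x \<le> 2 * 2 powr (- real n / 4) * m" if "x * 2 ^ (r - 1) \<le> card (matroids_on n)" for x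
  proof -
    have "real (x * 2 ^ (r - 1)) \<le> m" using that unfolding m_def by (simp only: of_nat_le_iff)
    moreover have "real x * (2 powr (real n / 4) / 2) \<le> real x * 2 ^ (r - 1)"
      using pw by (intro mult_left_mono) auto
    ultimately have "real x * (2 powr (real n / 4) / 2) \<le> m" by simp
    then have "real x \<le> m / (2 powr (real n / 4) / 2)" by (simp add: pos_le_divide_eq)
    also have "m / (2 powr z / 2) = 2 * 2 powr (- z) * m" for z :: real
      by (simp add: powr_minus field_simps)
    finally show ?thesis unfolding minus_divide_left .
  qed
  have CL: "real (card (C e \<union> L e)) \<le> 4 * 2 powr (- real n / 4) * m" if e: "e \<in> {1..n}" for e
  proof -
    have "real (card (C e)) \<le> 2 * 2 powr (- real n / 4) * m" "real (card (L e)) \<le> 2 * 2 powr (- real n / 4) * m"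
      unfolding C_def L_def by (rule gen, rule card_constant_element[OF e])+
    moreover have "real (card (C e \<union> L e)) \<le> real (card (C e)) + real (card (L e))"
      using card_Un_le[of "C e" "L e"] by linarith
    ultimately show ?thesis by linarith
  qed
  have "card {M \<in> bad n. matroid_rank M = r} \<le> card (generic_bad n r \<union> (\<Union>e\<in>{1..n}. C e \<union> L e))"
    by (rule card_mono[OF _ sub]) (use fin in auto)
  also have "\<dots> \<le> card (generic_bad n r) + card (\<Union>e\<in>{1..n}. C e \<union> L e)" by (rule card_Un_le)
  also have "\<dots> \<le> card (generic_bad n r) + (\<Sum>e\<in>{1..n}. card (C e \<union> L e))"
    by (intro add_left_mono card_UN_le) simp
  finally have "real (card {M \<in> bad n. matroid_rank M = r})
      \<le> real (card (generic_bad n r) + (\<Sum>e\<in>{1..n}. card (C e \<union> L e)))" by (simp only: of_nat_le_iff)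
  also have "\<dots> = real (card (generic_bad n r)) + (\<Sum>e\<in>{1..n}. real (card (C e \<union> L e)))" by simp
  also have "\<dots> \<le> 3 * exp (- (central n / real n) / 1000) * m + (\<Sum>e\<in>{1..n}. 4 * 2 powr (- real n / 4) * m)"
    using gb True CL unfolding m_def by (intro add_mono sum_mono) auto
  also have "\<dots> = (3 * exp (- (central n / real n) / 1000) + 4 * real n * 2 powr (- real n / 4)) * m"
    by (simp add: algebra_simps)
  finally show ?thesis unfolding m_def .
next
  case False
  define m where "m = real (card (matroids_on n))"
  define X where "X = central n / real n"
  have n0: "0 < real n" using n by simp
  \<comment> \<open>Outside the middle ranks even the number of all families of r-sets is
    negligible: the binomial coefficient is at most X / 2, for large \<open>r\<close> by symmetry,
    whereas there are at least 2^X matroids.\<close>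
  have "real n ^ 4 * real (n choose r) \<le> central n"
  proof (cases "4 * r \<le> n")
    case True
    then show ?thesis using sb by blast
  next
    case F: False
    then have "4 * (n - r) \<le> n" using False by simp
    then show ?thesis using sb binomial_symmetric[OF r] by simp
  qed
  moreover have "2 * real n \<le> real n ^ 4"
  proof -
    have "1 * 1 \<le> real n * real n" using n by (intro mult_mono) auto
    then have "2 * real n * 1 \<le> (real n * real n) * (real n * real n)" using n by (intro mult_mono) auto
    then show ?thesis by (simp add: power4_eq_xxxx mult_ac)
  qed
  then have "2 * real n * real (n choose r) \<le> real n ^ 4 * real (n choose r)" by (intro mult_right_mono) auto
  ultimately have "2 * real n * real (n choose r) \<le> central n" by linarith
  then have "real (n choose r) \<le> X / 2" using n0 by (simp add: X_def field_simps)
  then have "2 powr real (n choose r) \<le> 2 powr (X / 2)" by (intro powr_mono) auto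
  moreover have "{M \<in> bad n. matroid_rank M = r} \<subseteq> {M \<in> matroids_on n. matroid_rank M = r}"
    by (auto simp: bad_def)
  then have "card {M \<in> bad n. matroid_rank M = r} \<le> card {M \<in> matroids_on n. matroid_rank M = r}"
    using finite_matroids_on[of n] by (intro card_mono) auto
  then have "real (card {M \<in> bad n. matroid_rank M = r}) \<le> 2 powr real (n choose r)"
    using card_rank_le[OF r] by linarith
  ultimately have "real (card {M \<in> bad n. matroid_rank M = r}) \<le> 2 powr (X / 2)" by linarith
  also have "2 powr (X / 2) = exp (- (X / 2 * ln 2)) * 2 powr X"
    by (simp add: powr_def algebra_simps flip: exp_add)
  also have "\<dots> \<le> exp (- X / 1000) * m"
  proof (rule mult_mono)
    have "1 / 2 \<le> ln (2::real)" by (rule ln2_ge_half)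
    then have "X / 2 * (1 / 2) \<le> X / 2 * ln 2" by (intro mult_left_mono) (auto simp: X_def)
    moreover have "0 \<le> X" by (simp add: X_def)
    ultimately show "exp (- (X / 2 * ln 2)) \<le> exp (- X / 1000)" by simp
    show "2 powr X \<le> m" using two_powr_le_card_matroids[of n] n by (simp add: X_def m_def)
  qed auto
  also have "\<dots> \<le> (3 * exp (- X / 1000) + 4 * real n * 2 powr (- real n / 4)) * m"
    by (intro mult_right_mono) (auto simp: m_def intro: add_increasing2)
  finally show ?thesis unfolding m_def X_def .
qed

text \<open>The factor n + 1 counts the ranks. The central coefficient in the exponent is replaced
  by its lower bound 2^n / (n + 1), so that the final limit involves elementary functions
  only.\<close>

lemma eventually_card_bad:
  "\<forall>\<^sub>F n in sequentially. real (card (bad n)) \<le>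
     (real n + 1) * (3 * exp (- (2 ^ n / (real n * (real n + 1))) / 1000) + 4 * real n * 2 powr (- real n / 4))
     * real (card (matroids_on n))"
  using eventually_small_binomials eventually_card_generic_bad eventually_ge_at_top[of 64]
proof eventually_elim
  case (elim n)
  define b where "b = (3 * exp (- (central n / real n) / 1000) + 4 * real n * 2 powr (- real n / 4)) * real (card (matroids_on n))"
  have rk: "matroid_rank M \<le> n" if "M \<in> matroids_on n" for M
    using base_system.r_le[OF base_system_bases_of, of M] that by (auto simp: matroids_on_def)
  have "bad n = (\<Union>r\<in>{..n}. {M \<in> bad n. matroid_rank M = r})"
    using rk by (auto simp: bad_def)
  then have "card (bad n) \<le> (\<Sum>r\<le>n. card {M \<in> bad n. matroid_rank M = r})"
    using card_UN_le[of "{..n}" "\<lambda>r. {M \<in> bad n. matroid_rank M = r}"] by simp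
  then have "real (card (bad n)) \<le> real (\<Sum>r\<le>n. card {M \<in> bad n. matroid_rank M = r})"
    by (simp only: of_nat_le_iff)
  also have "\<dots> = (\<Sum>r\<le>n. real (card {M \<in> bad n. matroid_rank M = r}))" by simp
  also have "\<dots> \<le> (\<Sum>r\<le>n. b)"
    unfolding b_def using elim by (intro sum_mono card_bad_rank_le) auto
  also have "\<dots> = (real n + 1) * b" by simp
  also have "\<dots> \<le> (real n + 1) * ((3 * exp (- (2 ^ n / (real n * (real n + 1))) / 1000)
      + 4 * real n * 2 powr (- real n / 4)) * real (card (matroids_on n)))"
  proof -
    have "2 ^ n / (real n * (real n + 1)) \<le> ((real n + 1) * central n) / (real n * (real n + 1))"
      using two_pow_le_central[of n] elim by (intro divide_right_mono) auto
    then have "2 ^ n / (real n * (real n + 1)) \<le> central n / real n" using elim by simp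
    then have "- (central n / real n) / 1000 \<le> - (2 ^ n / (real n * (real n + 1))) / 1000"
      by (intro divide_right_mono le_imp_neg_le) simp_all
    then have "exp (- (central n / real n) / 1000) \<le> exp (- (2 ^ n / (real n * (real n + 1))) / 1000)"
      by (simp only: exp_le_cancel_iff)
    then show ?thesis
      unfolding b_def by (intro mult_left_mono mult_right_mono add_right_mono) simp_all
  qed
  finally show ?case by (simp add: mult.assoc)
qed

theorem theorem5p3:
  "(\<lambda>n::nat. real (card {M \<in> matroids_on n. ch_density M \<ge> 1 / (5 * real n)})
       / real (card (matroids_on n))) \<longlonglongrightarrow> 1"
proof -
  let ?g = "\<lambda>n. {M \<in> matroids_on n. ch_density M \<ge> 1 / (5 * real n)}"
  let ?h = "\<lambda>n::nat. (real n + 1) * (3 * exp (- (2 ^ n / (real n * (real n + 1))) / 1000) + 4 * real n * 2 powr (- real n / 4))"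
  have pos: "0 < real (card (matroids_on n))" for n
    using finite_matroids_on matroids_on_nonempty by (simp add: card_gt_0_iff)
  have split: "real (card (matroids_on n)) = real (card (?g n)) + real (card (bad n))" for n
  proof -
    have un: "?g n \<union> bad n = matroids_on n" and disj: "?g n \<inter> bad n = {}" by (auto simp: bad_def)
    have "finite (?g n)" "finite (bad n)" using finite_matroids_on[of n] by (auto simp: bad_def)
    then have "card (?g n \<union> bad n) = card (?g n) + card (bad n)" using disj by (rule card_Un_disjoint)
    then show ?thesis unfolding un by (simp only: of_nat_add)
  qed
  show ?thesis
  proof (rule tendsto_sandwich)
    show "\<forall>\<^sub>F n in sequentially. 1 - ?h n \<le> real (card (?g n)) / real (card (matroids_on n))"
      using eventually_card_bad
    proof eventually_elim
      case (elim n)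
      then have "(1 - ?h n) * real (card (matroids_on n)) \<le> real (card (?g n))"
        using split[of n] by (simp add: left_diff_distrib)
      then show ?case using pos[of n] by (simp add: pos_le_divide_eq)
    qed
    show "\<forall>\<^sub>F n in sequentially. real (card (?g n)) / real (card (matroids_on n)) \<le> 1"
      using split pos by (intro always_eventually allI) (simp add: pos_divide_le_eq)
    show "(\<lambda>n. 1 - ?h n) \<longlonglongrightarrow> 1" by real_asymp
  qed simp
qed

end
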